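(* Let $\Omega=\mathbb{R}^{\mathbb{N}}$ and let $\mathbb{E}$ be a regular sublinear expectation on $(\Omega,C_b(\Omega))$ such that the coordinate process $\{\xi_k\}_{k\ge1}$ is contained in $L^{\gamma}_{\mathbb{E}}(\Omega)$ for some $\gamma>1$ and is i.i.d. under $\mathbb{E}$. Write $\overline{\mu}=\mathbb{E}[\xi_1]$, $\underline{\mu}=-\mathbb{E}[-\xi_1]$, $\bar{\xi}_n=\frac{\xi_1+\cdots+\xi_n}{n}$. Let $\Theta_0$ be a weakly compact subset of $\mathcal{M}_1(\Omega)$ such that $\mathbb{E}[X]=\sup_{P\in\Theta_0}E_P[X]$ for $X\in C_b(\Omega)$. Then, for any $d\in\mathbb{N}$ and any $\mathcal{F}_d$-measurable random variable $\Pi=\pi(\xi_1,\dots,\xi_d)$ with values in $[\underline{\mu},\overline{\mu}]$, there exists a probability $P^{\Pi}\in\Theta_0$ such that $$\lim_{n\rightarrow\infty}\bar{\xi}_n=\Pi,\quad P^{\Pi}\text{-a.s.}$$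
   Context: $\Omega=\mathbb{R}^{\mathbb{N}}$ carries the metric $d(x,y)=\sum_{k=1}^\infty 2^{-k}(|x(k)-y(k)|\wedge1)$ (a Polish space); $\xi_k(\omega)=\omega(k)$; $\mathcal{F}_d=\sigma\{\xi_1,\dots,\xi_d\}$; $\pi:\mathbb{R}^d\to\mathbb{R}$ is a Borel function. $\mathcal{M}_1(\Omega)$ denotes the Borel probability measures on $\Omega$, and $C_b(\Omega)$ the bounded continuous functions. A sublinear expectation on $(\Omega,C_b(\Omega))$ is a functional of the form $\mathbb{E}[X]=\sup_{P\in\Theta'}E_P[X]$ for some set $\Theta'\subset\mathcal{M}_1(\Omega)$. It is regular if $\mathbb{E}[X_n]\downarrow0$ whenever $X_n\in C_b(\Omega)$ and $X_n\downarrow0$ pointwise on $\Omega$. Let $\Theta=\{P\in\mathcal{M}_1(\Omega): E_P[X]\le\mathbb{E}[X]\ \text{for any } X\in C_b(\Omega)\}$ be the maximal representing set. For $p\ge1$, $L^p_{\mathbb{E}}(\Omega)$ is the completion of $C_b(\Omega)$ under $\|X\|_p=(\mathbb{E}[|X|^p])^{1/p}$, identified with Borel functions $X$ for which there are $X_n\in C_b(\Omega)$ with $\sup_{P\in\Theta}E_P[|X-X_n|^p]\to0$ (modulo sets null under every $P\in\Theta$); for such $X$, $\mathbb{E}[X]=\sup_{P\in\Theta}E_P[X]$. $C_{b,Lip}(\mathbb{R}^n)$: bounded Lipschitz functions on $\mathbb{R}^n$. $\mathbf{X}$ ($m$-dimensional) is independent of $\mathbf{Y}$ ($n$-dimensional)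 under $\mathbb{E}$ if $\mathbb{E}[\varphi(\mathbf{Y},\mathbf{X})]=\mathbb{E}\big[\mathbb{E}[\varphi(\mathbf{y},\mathbf{X})]|_{\mathbf{y}=\mathbf{Y}}\big]$ for any $\varphi\in C_{b,Lip}(\mathbb{R}^{n+m})$. $\mathbf{X}\overset{d}{=}\mathbf{Y}$ means $\mathbb{E}[\varphi(\mathbf{X})]=\mathbb{E}[\varphi(\mathbf{Y})]$ for every bounded Lipschitz $\varphi$. $(X_i)_{i\ge1}$ is i.i.d. if, for each $i\ge1$, $X_{i+1}$ is independent of $(X_1,\dots,X_i)$ and $X_{i+1}\overset{d}{=}X_i$. *)

theory Defs
  imports "HOL-Probability.Probability"
begin

(* The topology of this type is the product topology, i.e. the one induced by the metric
   sum_k 2^-k * min |x(k) - y(k)| 1. Coordinates are numbered from 0, so xi k is the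
   (k+1)-st coordinate variable. *)
type_synonym seqspace = "nat \<Rightarrow> real"

definition xi :: "nat \<Rightarrow> seqspace \<Rightarrow> real" where
  "xi k = (\<lambda>\<omega>. \<omega> k)"

definition coord_algebra :: "nat \<Rightarrow> seqspace measure" where
  "coord_algebra d = sigma UNIV {xi k -` B | k B. k < d \<and> B \<in> sets borel}"

definition sample_mean :: "nat \<Rightarrow> seqspace \<Rightarrow> real" where
  "sample_mean n \<omega> = (\<Sum>k<n. xi k \<omega>) / real n"

definition prob_measures :: "seqspace measure set" where
  "prob_measures = {P. prob_space P \<and> sets P = sets borel}"

definition Cb :: "(seqspace \<Rightarrow> real) set" where
  "Cb = {X. continuous_on UNIV X \<and> bounded (range X)}"

definition weak_topology :: "seqspace measure topology" where
  "weak_topology = topology_generated_by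
     {{P \<in> prob_measures. integral\<^sup>L P X \<in> U} | X U. X \<in> Cb \<and> open U}"

(* Only the values of E on Cb carry meaning. Without nonemptiness of the representing set
   the real supremum would be an unspecified constant. *)
definition sublinear_expectation :: "((seqspace \<Rightarrow> real) \<Rightarrow> real) \<Rightarrow> bool" where
  "sublinear_expectation E \<longleftrightarrow>
     (\<exists>\<Theta>. \<Theta> \<noteq> {} \<and> \<Theta> \<subseteq> prob_measures \<and>
        (\<forall>X\<in>Cb. E X = (SUP P\<in>\<Theta>. integral\<^sup>L P X)))"

definition regular_expectation :: "((seqspace \<Rightarrow> real) \<Rightarrow> real) \<Rightarrow> bool" where
  "regular_expectation E \<longleftrightarrow>
     (\<forall>X. (\<forall>n. X n \<in> Cb) \<and> (\<forall>\<omega>. decseq (\<lambda>n. X n \<omega>) \<and> (\<lambda>n. X n \<omega>) \<longlonglongrightarrow> 0)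
        \<longrightarrow> decseq (\<lambda>n. E (X n)) \<and> (\<lambda>n. E (X n)) \<longlonglongrightarrow> 0)"

definition maximal_set :: "((seqspace \<Rightarrow> real) \<Rightarrow> real) \<Rightarrow> seqspace measure set" where
  "maximal_set E = {P \<in> prob_measures. \<forall>X\<in>Cb. integral\<^sup>L P X \<le> E X}"

(* Representatives of the elements of the completion of Cb; the supremum is taken in
   ennreal because it may be infinite for some approximants. *)
definition Lp_space :: "real \<Rightarrow> ((seqspace \<Rightarrow> real) \<Rightarrow> real) \<Rightarrow> (seqspace \<Rightarrow> real) set" where
  "Lp_space p E = {X \<in> borel_measurable borel.
     \<exists>Y. (\<forall>n. Y n \<in> Cb) \<and>
       (\<lambda>n. SUP P\<in>maximal_set E. \<integral>\<^sup>+\<omega>. ennreal (\<bar>X \<omega> - Y n \<omega>\<bar> powr p) \<partial>P) \<longlonglongrightarrow> 0}"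

(* Extension of E to Lp_space p E, p >= 1; it agrees with E on Cb. *)
definition ext_expectation :: "((seqspace \<Rightarrow> real) \<Rightarrow> real) \<Rightarrow> (seqspace \<Rightarrow> real) \<Rightarrow> real" where
  "ext_expectation E X = (SUP P\<in>maximal_set E. integral\<^sup>L P X)"

definition upper_mean :: "((seqspace \<Rightarrow> real) \<Rightarrow> real) \<Rightarrow> real" where
  "upper_mean E = ext_expectation E (xi 0)"

definition lower_mean :: "((seqspace \<Rightarrow> real) \<Rightarrow> real) \<Rightarrow> real" where
  "lower_mean E = - ext_expectation E (\<lambda>\<omega>. - xi 0 \<omega>)"

(* Since n varies, R^n is rendered as the extensional functions on {..<n}, i.e. the space of
   the product measure space over {..<n}; L2_set gives the Euclidean norm. *)
definition Rn :: "nat \<Rightarrow> (nat \<Rightarrow> real) set" where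
  "Rn n = {..<n} \<rightarrow>\<^sub>E UNIV"

definition borel_Rn :: "nat \<Rightarrow> (nat \<Rightarrow> real) measure" where
  "borel_Rn n = (\<Pi>\<^sub>M i\<in>{..<n}. borel)"

definition Cb_Lip :: "nat \<Rightarrow> ((nat \<Rightarrow> real) \<Rightarrow> real) set" where
  "Cb_Lip n = {\<phi>.
     (\<exists>C. \<forall>x\<in>Rn n. \<bar>\<phi> x\<bar> \<le> C) \<and>
     (\<exists>L. \<forall>x\<in>Rn n. \<forall>y\<in>Rn n. \<bar>\<phi> x - \<phi> y\<bar> \<le> L * L2_set (\<lambda>i. x i - y i) {..<n})}"

(* The random vector (X i, ..., X (i + n - 1)). *)
definition rvec :: "(nat \<Rightarrow> seqspace \<Rightarrow> real) \<Rightarrow> nat \<Rightarrow> nat \<Rightarrow> seqspace \<Rightarrow> (nat \<Rightarrow> real)" where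
  "rvec X i n \<omega> = (\<lambda>j\<in>{..<n}. X (i + j) \<omega>)"

(* The pair (y, x) of y in R^n and x in R^m as an element of R^(n+m). *)
definition vappend :: "nat \<Rightarrow> nat \<Rightarrow> (nat \<Rightarrow> real) \<Rightarrow> (nat \<Rightarrow> real) \<Rightarrow> (nat \<Rightarrow> real)" where
  "vappend n m y x = (\<lambda>i\<in>{..<n + m}. if i < n then y i else x (i - n))"

(* The m-dimensional X is independent of the n-dimensional Y; the order matters. *)
definition independent_of ::
  "((seqspace \<Rightarrow> real) \<Rightarrow> real) \<Rightarrow> nat \<Rightarrow> (seqspace \<Rightarrow> (nat \<Rightarrow> real)) \<Rightarrow>
     nat \<Rightarrow> (seqspace \<Rightarrow> (nat \<Rightarrow> real)) \<Rightarrow> bool" where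
  "independent_of E m X n Y \<longleftrightarrow>
     (\<forall>\<phi>\<in>Cb_Lip (n + m).
        ext_expectation E (\<lambda>\<omega>. \<phi> (vappend n m (Y \<omega>) (X \<omega>))) =
        ext_expectation E
          (\<lambda>\<omega>. (\<lambda>y. ext_expectation E (\<lambda>\<omega>'. \<phi> (vappend n m y (X \<omega>')))) (Y \<omega>)))"

definition identically_distributed ::
  "((seqspace \<Rightarrow> real) \<Rightarrow> real) \<Rightarrow> nat \<Rightarrow> (seqspace \<Rightarrow> (nat \<Rightarrow> real)) \<Rightarrow>
     (seqspace \<Rightarrow> (nat \<Rightarrow> real)) \<Rightarrow> bool" where
  "identically_distributed E n X Y \<longleftrightarrow>
     (\<forall>\<phi>\<in>Cb_Lip n. ext_expectation E (\<lambda>\<omega>. \<phi> (X \<omega>)) = ext_expectation E (\<lambda>\<omega>. \<phi> (Y \<omega>)))"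

definition iid :: "((seqspace \<Rightarrow> real) \<Rightarrow> real) \<Rightarrow> (nat \<Rightarrow> seqspace \<Rightarrow> real) \<Rightarrow> bool" where
  "iid E X \<longleftrightarrow>
     (\<forall>i\<ge>1. independent_of E 1 (rvec X i 1) i (rvec X 0 i) \<and>
            identically_distributed E 1 (rvec X i 1) (rvec X (i - 1) 1))"

end

theory Submission
  imports Defs
begin

text \<open>
  Let \<open>P\<close> be a measure whose expectations are dominated by \<open>E\<close>. That the coordinates are i.i.d. under \<open>E\<close> says,
  in terms of \<open>P\<close>, that the conditional law of \<open>\<xi>\<^sub>k\<close> given the earlier coordinates is dominated by
  the upper expectation of one coordinate (\<open>conditional_mean_le\<close>). In particular its conditional mean
  \<open>D\<^sub>k\<close> lies between the lower and the upper mean, and a martingale argument, which uses only moments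
  of some order \<open>\<gamma> > 1\<close>, shows that the averages of \<open>\<xi>\<^sub>k - D\<^sub>k\<close> tend to \<open>0\<close> almost surely
  (\<open>strong_law\<close>). So it suffices to find \<open>P \<in> \<Theta>\<^sub>0\<close> whose conditional means have averages
  converging to \<open>Z\<close>.

  In general one cannot have \<open>D\<^sub>k = Z\<close>, because \<open>\<Theta>\<^sub>0\<close> need not be convex: if it consists of the point masses
  at the sequences of signs, every conditional mean is \<open>1\<close> or \<open>-1\<close>. What can be prescribed are
  extreme conditional means. Write \<open>Z\<close> as the convex combination of the lower and the upper mean
  with weight \<open>\<theta>\<close> on the latter; both means are then used with the right frequency if \<open>D\<^sub>k\<close> is the upper
  mean exactly when \<open>\<lfloor>(k + 1) \<theta>\<rfloor> > \<lfloor>k \<theta>\<rfloor>\<close>. Such a \<open>D\<^sub>k\<close> is a Borel function of the first \<open>d\<close> coordinates.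

  Extreme conditional means are characterized by optimality. Let \<open>s\<^sub>k = 1\<close> where \<open>D\<^sub>k\<close> is to be the
  upper mean and \<open>s\<^sub>k = -1\<close> elsewhere. Then \<open>s\<^sub>k (\<xi>\<^sub>k - D\<^sub>k)\<close> has expectation at most \<open>0\<close> under each such
  measure, with equality only if \<open>D\<^sub>k\<close> is the conditional mean (\<open>prescribed_conditional_mean\<close>). If the
  \<open>s\<^sub>k\<close> were Lipschitz and the coordinates bounded, a measure of the compact set \<open>\<Theta>\<^sub>0\<close> that maximizes
  the sum of these functions would have all the required conditional means at once, since independence
  makes the maximum equal to \<open>0\<close> (\<open>conditional_sup_attained\<close>). Borel functions \<open>s\<^sub>k\<close> can be approximated
  by Lipschitz functions only in \<open>L\<^sup>1\<close> of a fixed law of the first \<open>d\<close> coordinates, so this law must not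
  move along the approximation. To fix it, one adds to the sum a Lipschitz function \<open>f\<close> of the first
  \<open>d\<close> coordinates all of whose maximizers in \<open>\<Theta>\<^sub>0\<close> have the same law on these coordinates
  (\<open>exposed_marginal\<close>). Adding \<open>f\<close> does not disturb the other terms: the maximum of the total is the
  maximum of \<open>f\<close>, and it is reached only where \<open>f\<close> and every other term are maximal separately.
  Weak compactness and the uniform integrability given by \<open>\<gamma> > 1\<close> then allow the passage to the limit
  (\<open>extremal_drift\<close>).
\<close>

section \<open>Weak compactness in sequential form\<close>

lemma prob_measuresD:
  assumes "P \<in> prob_measures"
  shows "prob_space P" "sets P = sets borel" "space P = UNIV"
  using assms sets_eq_imp_space_eq[of P borel] by (auto simp: prob_measures_def)

lemma prob_measures_measurable:
  assumes "P \<in> prob_measures"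
  shows "measurable P N = measurable borel N"
  by (rule measurable_cong_sets) (simp_all add: prob_measuresD[OF assms])

lemma integrable_bounded:
  fixes h :: "seqspace \<Rightarrow> real"
  assumes P: "P \<in> prob_measures" and "h \<in> borel_measurable borel" and "\<And>x. \<bar>h x\<bar> \<le> C"
  shows "integrable P h"
proof -
  interpret prob_space P by (rule prob_measuresD[OF P])
  show ?thesis
    by (rule integrable_const_bound[of _ C]) (use assms in \<open>auto simp: prob_measures_measurable\<close>)
qed

lemma CbD:
  assumes "X \<in> Cb"
  shows "X \<in> borel_measurable borel" and "\<exists>C. \<forall>x. \<bar>X x\<bar> \<le> C"
proof -
  show "X \<in> borel_measurable borel"
    using assms by (auto simp: Cb_def intro: borel_measurable_continuous_onI)
  show "\<exists>C. \<forall>x. \<bar>X x\<bar> \<le> C"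
    using assms by (auto simp: Cb_def bounded_iff)
qed

lemma integrable_Cb: "P \<in> prob_measures \<Longrightarrow> X \<in> Cb \<Longrightarrow> integrable P X"
  by (meson CbD integrable_bounded)

lemma topspace_weak: "topspace weak_topology \<subseteq> prob_measures"
  by (auto simp: weak_topology_def)

text \<open>Limits of measures are only ever tested against countably many functions; for these, some
  subsequence converges to a cluster point, which makes metrizability of the weak topology dispensable.\<close>

lemma weak_subsequence:
  assumes K: "compactin weak_topology K" and Pn: "\<And>n::nat. Pn n \<in> K"
    and X: "\<And>i::nat. X i \<in> Cb"
  obtains P r where "P \<in> K" "strict_mono r"
    "\<And>i. (\<lambda>n. integral\<^sup>L (Pn (r n)) (X i)) \<longlonglongrightarrow> integral\<^sup>L P (X i)"
proof -
  have Kp: "K \<subseteq> prob_measures"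
    using K topspace_weak by (auto simp: compactin_def)
  define U where "U P k = {Q \<in> prob_measures. \<forall>i\<le>k. \<bar>integral\<^sup>L Q (X i) - integral\<^sup>L P (X i)\<bar> < 1 / real (Suc k)}" for P k
  have U_open: "openin weak_topology (U P k)" for P k
  proof -
    have "U P k = \<Inter> ((\<lambda>i. {Q \<in> prob_measures. integral\<^sup>L Q (X i) \<in> ball (integral\<^sup>L P (X i)) (1 / real (Suc k))}) ` {..k})"
      by (auto simp: U_def dist_real_def abs_minus_commute)
    also have "openin weak_topology \<dots>"
    proof (rule openin_Inter)
      fix S assume "S \<in> (\<lambda>i. {Q \<in> prob_measures. integral\<^sup>L Q (X i) \<in> ball (integral\<^sup>L P (X i)) (1 / real (Suc k))}) ` {..k}"
      then obtain i where S: "S = {Q \<in> prob_measures. integral\<^sup>L Q (X i) \<in> ball (integral\<^sup>L P (X i)) (1 / real (Suc k))}" by auto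
      show "openin weak_topology S"
        unfolding weak_topology_def S
        by (rule topology_generated_by_Basis) (use X in blast)
    qed auto
    finally show ?thesis .
  qed
  \<comment> \<open>A cluster point exists: otherwise finitely many neighbourhoods, each left for good, would cover \<open>K\<close>.\<close>
  have "\<exists>P\<in>K. \<forall>k N. \<exists>n\<ge>N. Pn n \<in> U P k"
  proof (rule ccontr)
    assume "\<not> ?thesis"
    then have "\<forall>P\<in>K. \<exists>k N. \<forall>n\<ge>N. Pn n \<notin> U P k" by auto
    then obtain k and N :: "seqspace measure \<Rightarrow> nat" where kN: "\<And>P n. P \<in> K \<Longrightarrow> n \<ge> N P \<Longrightarrow> Pn n \<notin> U P (k P)" by metis
    have sub: "K \<subseteq> \<Union> ((\<lambda>P. U P (k P)) ` K)" using Kp by (auto simp: U_def)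
    obtain \<F> where F: "finite \<F>" "\<F> \<subseteq> (\<lambda>P. U P (k P)) ` K" "K \<subseteq> \<Union> \<F>"
      using K[unfolded compactin_def, THEN conjunct2, rule_format, of "(\<lambda>P. U P (k P)) ` K"] U_open sub
      by blast
    then obtain F where "finite F" "F \<subseteq> K" "\<F> = (\<lambda>P. U P (k P)) ` F"
      by (meson finite_subset_image)
    with F have cov: "K \<subseteq> (\<Union>P\<in>F. U P (k P))" by simp
    define n where "n = (\<Sum>P\<in>F. N P)"
    have "N P \<le> n" if "P \<in> F" for P
      unfolding n_def using \<open>finite F\<close> that by (auto intro: member_le_sum)
    moreover obtain P where "P \<in> F" "Pn n \<in> U P (k P)" using cov Pn by blast
    ultimately show False using kN \<open>F \<subseteq> K\<close> by blast
  qed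
  then obtain P where P: "P \<in> K" "\<And>k N. \<exists>n\<ge>N. Pn n \<in> U P k" by blast
  have "\<exists>r. \<forall>n. Pn (r n) \<in> U P n \<and> r n < r (Suc n)"
  proof (rule dependent_nat_choice[of "\<lambda>n m. Pn m \<in> U P n" "\<lambda>_ m m'. m < m'"])
    show "\<exists>m. Pn m \<in> U P 0" using P(2) by blast
    show "\<exists>m'. Pn m' \<in> U P (Suc n) \<and> m < m'" for m n
      using P(2)[of "Suc m" "Suc n"] Suc_le_lessD by blast
  qed
  then obtain r where r: "\<And>n. Pn (r n) \<in> U P n" "\<And>n. r n < r (Suc n)" by blast
  show ?thesis
  proof
    show "P \<in> K" by fact
    show "strict_mono r" using r(2) by (simp add: strict_mono_Suc_iff)
    show "(\<lambda>n. integral\<^sup>L (Pn (r n)) (X i)) \<longlonglongrightarrow> integral\<^sup>L P (X i)" for i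
    proof (rule LIM_zero_cancel, rule Lim_null_comparison)
      show "\<forall>\<^sub>F n in sequentially. norm (integral\<^sup>L (Pn (r n)) (X i) - integral\<^sup>L P (X i)) \<le> 1 / real (Suc n)"
        using eventually_ge_at_top[of i] by eventually_elim (use r(1) in \<open>auto simp: U_def less_imp_le\<close>)
      show "(\<lambda>n. 1 / real (Suc n)) \<longlonglongrightarrow> 0"
        using LIMSEQ_inverse_real_of_nat by (simp add: inverse_eq_divide)
    qed
  qed
qed

section \<open>The functional on bounded continuous functions\<close>

text \<open>Without \<open>nonempty\<close> the supremum in \<open>represents\<close> would be an unspecified real number.\<close>

locale weakly_compact_expectation =
  fixes E :: "(seqspace \<Rightarrow> real) \<Rightarrow> real" and \<Theta>\<^sub>0 :: "seqspace measure set"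
  assumes compact: "compactin weak_topology \<Theta>\<^sub>0"
    and nonempty: "\<Theta>\<^sub>0 \<noteq> {}"
    and represents: "X \<in> Cb \<Longrightarrow> E X = (SUP P\<in>\<Theta>\<^sub>0. integral\<^sup>L P X)"
begin

abbreviation "\<Theta> \<equiv> maximal_set E"

lemma \<Theta>\<^sub>0_prob: "P \<in> \<Theta>\<^sub>0 \<Longrightarrow> P \<in> prob_measures"
  using compact topspace_weak by (auto simp: compactin_def)

lemma \<Theta>_prob: "P \<in> \<Theta> \<Longrightarrow> P \<in> prob_measures"
  by (simp add: maximal_set_def)

lemma integral_le_bound:
  assumes "P \<in> prob_measures" "X \<in> Cb" "\<And>x. X x \<le> C"
  shows "integral\<^sup>L P X \<le> C"
proof -
  interpret prob_space P using assms prob_measuresD by auto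
  show ?thesis
    using integral_le_const[OF integrable_Cb[OF assms(1,2)]] assms(3) by simp
qed

lemma bdd_above_Cb:
  assumes "X \<in> Cb" shows "bdd_above ((\<lambda>P. integral\<^sup>L P X) ` \<Theta>\<^sub>0)"
proof -
  obtain C where "\<And>x. \<bar>X x\<bar> \<le> C" using CbD[OF assms] by auto
  then have "integral\<^sup>L P X \<le> C" if "P \<in> \<Theta>\<^sub>0" for P
    using integral_le_bound[OF \<Theta>\<^sub>0_prob[OF that] assms] by (meson abs_le_D1)
  then show ?thesis by (auto simp: bdd_above_def)
qed

lemma \<Theta>\<^sub>0_subset: "P \<in> \<Theta>\<^sub>0 \<Longrightarrow> P \<in> \<Theta>"
  by (auto simp: maximal_set_def \<Theta>\<^sub>0_prob represents bdd_above_Cb intro!: cSUP_upper)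

lemma \<Theta>_le: "P \<in> \<Theta> \<Longrightarrow> X \<in> Cb \<Longrightarrow> integral\<^sup>L P X \<le> E X"
  by (simp add: maximal_set_def)

lemma \<Theta>_nonempty: "\<Theta> \<noteq> {}"
  using nonempty \<Theta>\<^sub>0_subset by blast

lemma E_least:
  assumes "X \<in> Cb" "\<And>P. P \<in> \<Theta>\<^sub>0 \<Longrightarrow> integral\<^sup>L P X \<le> C" shows "E X \<le> C"
  unfolding represents[OF assms(1)] by (rule cSUP_least[OF nonempty assms(2)])

lemma ext_expectation_Cb:
  assumes "X \<in> Cb" shows "ext_expectation E X = E X"
  unfolding ext_expectation_def
proof (rule antisym)
  show "(SUP P\<in>\<Theta>. integral\<^sup>L P X) \<le> E X"
    by (rule cSUP_least[OF \<Theta>_nonempty \<Theta>_le[OF _ assms]])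
  have "bdd_above ((\<lambda>P. integral\<^sup>L P X) ` \<Theta>)"
    using \<Theta>_le[OF _ assms] by (auto simp: bdd_above_def)
  then show "E X \<le> (SUP P\<in>\<Theta>. integral\<^sup>L P X)"
    by (intro E_least[OF assms] cSUP_upper \<Theta>\<^sub>0_subset)
qed

text \<open>Compactness turns the supremum over \<open>\<Theta>\<^sub>0\<close> into a maximum. Measures with extreme conditional means are
  found as such maximizers and as limits of them.\<close>

lemma E_attained:
  assumes X: "X \<in> Cb"
  obtains P where "P \<in> \<Theta>\<^sub>0" "integral\<^sup>L P X = E X"
proof -
  have "\<exists>P\<in>\<Theta>\<^sub>0. E X - 1 / real (Suc n) < integral\<^sup>L P X" for n
  proof -
    have "E X - 1 / real (Suc n) < (SUP P\<in>\<Theta>\<^sub>0. integral\<^sup>L P X)"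
      using represents[OF X] by simp
    then show ?thesis using less_cSUP_iff[OF nonempty bdd_above_Cb[OF X]] by blast
  qed
  then obtain Pn where Pn: "\<And>n. Pn n \<in> \<Theta>\<^sub>0" "\<And>n. E X - 1 / real (Suc n) < integral\<^sup>L (Pn n) X"
    by metis
  obtain P r where P: "P \<in> \<Theta>\<^sub>0" "strict_mono r"
    "\<And>i::nat. (\<lambda>n. integral\<^sup>L (Pn (r n)) X) \<longlonglongrightarrow> integral\<^sup>L P X"
    by (rule weak_subsequence[OF compact Pn(1), of "\<lambda>_. X"]) (use X in auto)
  have l: "(\<lambda>n. E X - 1 / real (Suc n)) \<longlonglongrightarrow> E X - 0"
    using LIMSEQ_inverse_real_of_nat by (intro tendsto_intros) (simp add: inverse_eq_divide)
  have "(\<lambda>n. E X - 1 / real (Suc (r n))) \<longlonglongrightarrow> E X - 0"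
    using LIMSEQ_subseq_LIMSEQ[OF l P(2)] by (simp add: o_def)
  then have "E X - 0 \<le> integral\<^sup>L P X"
    by (rule LIMSEQ_le[OF _ P(3)]) (use Pn(2) less_imp_le in blast)
  then show thesis using that[OF P(1)] \<Theta>_le[OF \<Theta>\<^sub>0_subset[OF P(1)] X] by simp
qed

end

section \<open>Functions of finitely many coordinates\<close>

definition trunc :: "nat \<Rightarrow> seqspace \<Rightarrow> seqspace" where
  "trunc n w = (\<lambda>j. if j < n then w j else 0)"

text \<open>The Borel functions that are measurable with respect to the first \<open>n\<close> coordinates. Invariance under
  \<open>trunc n\<close> replaces the spaces \<open>\<real>\<^sup>n\<close>, so that all these functions live on one space.\<close>

definition past :: "nat \<Rightarrow> (seqspace \<Rightarrow> real) set" where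
  "past n = {h \<in> borel_measurable borel. \<forall>w. h (trunc n w) = h w}"

text \<open>The test functions of the definition of independence, as functions on the sequence space. The
  \<open>\<ell>\<^sub>1\<close> distance is equivalent to the Euclidean one and easier to add up.\<close>

definition cyl_Lip :: "nat \<Rightarrow> (seqspace \<Rightarrow> real) set" where
  "cyl_Lip n = {F. (\<exists>C. \<forall>x. \<bar>F x\<bar> \<le> C) \<and>
     (\<exists>L\<ge>0. \<forall>x y. \<bar>F x - F y\<bar> \<le> L * (\<Sum>j<n. \<bar>x j - y j\<bar>))}"

definition bLip :: "(real \<Rightarrow> real) set" where
  "bLip = {\<psi>. (\<exists>C. \<forall>x. \<bar>\<psi> x\<bar> \<le> C) \<and> (\<exists>L\<ge>0. \<forall>x y. \<bar>\<psi> x - \<psi> y\<bar> \<le> L * \<bar>x - y\<bar>)}"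

lemma measurable_coordinate [measurable]: "(\<lambda>w::seqspace. w k) \<in> borel_measurable borel"
  by (rule measurable_product_coordinates)

lemma measurable_trunc [measurable]: "trunc n \<in> borel \<rightarrow>\<^sub>M borel"
proof (rule measurable_coordinatewise_then_product)
  fix i show "(\<lambda>w. trunc n w i) \<in> borel_measurable borel"
    by (cases "i < n") (simp_all add: trunc_def)
qed

lemma pastI:
  assumes "h \<in> borel_measurable borel"
    and "\<And>x y. (\<And>j. j < n \<Longrightarrow> x j = y j) \<Longrightarrow> h x = h y"
  shows "h \<in> past n"
proof -
  have "h (trunc n w) = h w" for w by (rule assms(2)) (simp add: trunc_def)
  then show ?thesis using assms(1) by (simp add: past_def)
qed

lemma pastD:
  assumes "h \<in> past n"
  shows "h \<in> borel_measurable borel"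
    and "(\<And>j. j < n \<Longrightarrow> x j = y j) \<Longrightarrow> h x = h y"
proof -
  show "h \<in> borel_measurable borel" using assms by (simp add: past_def)
  assume "\<And>j. j < n \<Longrightarrow> x j = y j"
  then have "trunc n x = trunc n y" by (auto simp: trunc_def)
  then show "h x = h y" using assms unfolding past_def by (metis (mono_tags, lifting) mem_Collect_eq)
qed

lemma past_mono:
  assumes "m \<le> n" "h \<in> past m" shows "h \<in> past n"
proof (rule pastI[OF pastD(1)[OF assms(2)]])
  show "h x = h y" if "\<And>j. j < n \<Longrightarrow> x j = y j" for x y
    by (rule pastD(2)[OF assms(2)]) (use that assms(1) in simp)
qed

lemma past_add: "f \<in> past n \<Longrightarrow> g \<in> past n \<Longrightarrow> (\<lambda>w. f w + g w) \<in> past n"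
  by (auto simp: past_def intro: borel_measurable_add)

lemma past_diff: "f \<in> past n \<Longrightarrow> g \<in> past n \<Longrightarrow> (\<lambda>w. f w - g w) \<in> past n"
  by (auto simp: past_def intro: borel_measurable_diff)

lemma past_mult: "f \<in> past n \<Longrightarrow> g \<in> past n \<Longrightarrow> (\<lambda>w. f w * g w) \<in> past n"
  by (auto simp: past_def intro: borel_measurable_times)

lemma past_sum: "(\<And>i. i \<in> I \<Longrightarrow> f i \<in> past n) \<Longrightarrow> (\<lambda>w. \<Sum>i\<in>I. f i w) \<in> past n"
  by (auto simp: past_def intro: borel_measurable_sum)

lemma past_compose: "f \<in> past n \<Longrightarrow> \<psi> \<in> borel_measurable borel \<Longrightarrow> (\<lambda>w. \<psi> (f w)) \<in> past n"
  by (auto simp: past_def intro: measurable_compose)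

lemma past_coordinate: "k < n \<Longrightarrow> (\<lambda>w. w k) \<in> past n"
  by (rule pastI) auto

lemma past_const: "(\<lambda>_. c) \<in> past n"
  by (simp add: past_def)

lemma past_if:
  assumes "s \<in> past n" "f \<in> past n" "g \<in> past n"
  shows "(\<lambda>w. if s w = c then f w else g w) \<in> past n"
proof -
  have [measurable]: "s \<in> borel_measurable borel" "f \<in> borel_measurable borel" "g \<in> borel_measurable borel"
    using assms by (auto intro: pastD(1))
  have "(\<lambda>w. if s w = c then f w else g w) \<in> borel_measurable borel" by measurable
  then show ?thesis using assms by (simp add: past_def)
qed

lemma cyl_LipI:
  assumes "\<And>x. \<bar>F x\<bar> \<le> C" "L \<ge> 0" "\<And>x y. \<bar>F x - F y\<bar> \<le> L * (\<Sum>j<n. \<bar>x j - y j\<bar>)"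
  shows "F \<in> cyl_Lip n"
  using assms unfolding cyl_Lip_def by blast

lemma cyl_LipE:
  assumes "F \<in> cyl_Lip n"
  obtains C L where "C \<ge> 0" "\<And>x. \<bar>F x\<bar> \<le> C" "L \<ge> 0"
    "\<And>x y. \<bar>F x - F y\<bar> \<le> L * (\<Sum>j<n. \<bar>x j - y j\<bar>)"
proof -
  from assms obtain C L where *: "\<And>x. \<bar>F x\<bar> \<le> C" "L \<ge> 0"
    "\<And>x y. \<bar>F x - F y\<bar> \<le> L * (\<Sum>j<n. \<bar>x j - y j\<bar>)"
    unfolding cyl_Lip_def by blast
  moreover have "C \<ge> 0" using *(1)[of undefined] by linarith
  ultimately show thesis using that by blast
qed

lemma bLipI:
  assumes "\<And>x. \<bar>\<psi> x\<bar> \<le> C" "L \<ge> 0" "\<And>x y. \<bar>\<psi> x - \<psi> y\<bar> \<le> L * \<bar>x - y\<bar>"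
  shows "\<psi> \<in> bLip"
  using assms unfolding bLip_def by blast

lemma cyl_Lip_eq:
  assumes "F \<in> cyl_Lip n" "\<And>j. j < n \<Longrightarrow> x j = y j"
  shows "F x = F y"
proof -
  obtain L where "\<bar>F x - F y\<bar> \<le> L * (\<Sum>j<n. \<bar>x j - y j\<bar>)"
    using assms(1) unfolding cyl_Lip_def by blast
  moreover have "(\<Sum>j<n. \<bar>x j - y j\<bar>) = 0" using assms(2) by simp
  ultimately show ?thesis by simp
qed

lemma cyl_Lip_Cb:
  assumes "F \<in> cyl_Lip n" shows "F \<in> Cb"
proof -
  obtain C L where CL: "\<And>x. \<bar>F x\<bar> \<le> C" "\<And>x y. \<bar>F x - F y\<bar> \<le> L * (\<Sum>j<n. \<bar>x j - y j\<bar>)"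
    using assms unfolding cyl_Lip_def by blast
  have "isCont F x" for x
    unfolding isCont_def
  proof (rule LIM_zero_cancel, rule Lim_null_comparison)
    show "\<forall>\<^sub>F y in at x. norm (F y - F x) \<le> L * (\<Sum>j<n. \<bar>y j - x j\<bar>)"
      using CL(2) by (auto intro: always_eventually)
    have "continuous_on UNIV (\<lambda>y::seqspace. L * (\<Sum>j<n. \<bar>y j - x j\<bar>))"
      by (intro continuous_intros continuous_on_product_coordinates)
    then have "isCont (\<lambda>y::seqspace. L * (\<Sum>j<n. \<bar>y j - x j\<bar>)) x"
      by (simp add: continuous_on_eq_continuous_at)
    then show "((\<lambda>y. L * (\<Sum>j<n. \<bar>y j - x j\<bar>)) \<longlongrightarrow> 0) (at x)"
      unfolding isCont_def by simp
  qed
  then show ?thesis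
    using CL(1) by (auto simp: Cb_def bounded_iff continuous_on_eq_continuous_at)
qed

lemma cyl_Lip_measurable: "F \<in> cyl_Lip n \<Longrightarrow> F \<in> borel_measurable borel"
  by (rule CbD(1)[OF cyl_Lip_Cb])

lemma cyl_Lip_past:
  assumes "F \<in> cyl_Lip n" shows "F \<in> past n"
proof (rule pastI[OF cyl_Lip_measurable[OF assms]])
  show "F x = F y" if "\<And>j. j < n \<Longrightarrow> x j = y j" for x y
    by (rule cyl_Lip_eq[OF assms that])
qed

lemma cyl_Lip_mono:
  assumes "m \<le> n" "F \<in> cyl_Lip m" shows "F \<in> cyl_Lip n"
proof -
  obtain C L where CL: "\<And>x. \<bar>F x\<bar> \<le> C" "L \<ge> 0" "\<And>x y. \<bar>F x - F y\<bar> \<le> L * (\<Sum>j<m. \<bar>x j - y j\<bar>)"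
    by (rule cyl_LipE[OF assms(2)], rule that)
  show ?thesis
  proof (rule cyl_LipI[OF CL(1,2)])
    fix x y :: seqspace
    have "(\<Sum>j<m. \<bar>x j - y j\<bar>) \<le> (\<Sum>j<n. \<bar>x j - y j\<bar>)"
      using assms(1) by (intro sum_mono2) auto
    then show "\<bar>F x - F y\<bar> \<le> L * (\<Sum>j<n. \<bar>x j - y j\<bar>)"
      by (rule order_trans[OF CL(3) mult_left_mono[OF _ CL(2)]])
  qed
qed

lemma cyl_Lip_const: "(\<lambda>_. c) \<in> cyl_Lip n"
  by (rule cyl_LipI[of _ "\<bar>c\<bar>" 0]) auto

lemma cyl_Lip_coordinate:
  assumes "\<psi> \<in> bLip" "k < n" shows "(\<lambda>w. \<psi> (w k)) \<in> cyl_Lip n"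
proof -
  obtain C L where CL: "\<And>x. \<bar>\<psi> x\<bar> \<le> C" "L \<ge> 0" "\<And>x y. \<bar>\<psi> x - \<psi> y\<bar> \<le> L * \<bar>x - y\<bar>"
    using assms(1) unfolding bLip_def by blast
  show ?thesis
  proof (rule cyl_LipI[OF CL(1,2)])
    fix x y :: seqspace
    have "\<bar>x k - y k\<bar> \<le> (\<Sum>j<n. \<bar>x j - y j\<bar>)"
      using assms(2) by (intro member_le_sum) auto
    then show "\<bar>\<psi> (x k) - \<psi> (y k)\<bar> \<le> L * (\<Sum>j<n. \<bar>x j - y j\<bar>)"
      by (rule order_trans[OF CL(3) mult_left_mono[OF _ CL(2)]])
  qed
qed

lemma cyl_Lip_add:
  assumes "F \<in> cyl_Lip n" "G \<in> cyl_Lip n" shows "(\<lambda>x. F x + G x) \<in> cyl_Lip n"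
proof -
  obtain C L where 1: "\<And>x. \<bar>F x\<bar> \<le> C" "L \<ge> 0" "\<And>x y. \<bar>F x - F y\<bar> \<le> L * (\<Sum>j<n. \<bar>x j - y j\<bar>)"
    by (rule cyl_LipE[OF assms(1)], rule that)
  obtain C' L' where 2: "\<And>x. \<bar>G x\<bar> \<le> C'" "L' \<ge> 0" "\<And>x y. \<bar>G x - G y\<bar> \<le> L' * (\<Sum>j<n. \<bar>x j - y j\<bar>)"
    by (rule cyl_LipE[OF assms(2)], rule that)
  show ?thesis
  proof (rule cyl_LipI[of _ "C + C'" "L + L'"])
    show "\<bar>F x + G x\<bar> \<le> C + C'" for x using 1(1)[of x] 2(1)[of x] by linarith
    show "\<bar>F x + G x - (F y + G y)\<bar> \<le> (L + L') * (\<Sum>j<n. \<bar>x j - y j\<bar>)" for x y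
      using 1(3)[of x y] 2(3)[of x y] by (simp add: algebra_simps)
  qed (use 1 2 in simp)
qed

lemma cyl_Lip_mult:
  assumes "F \<in> cyl_Lip n" "G \<in> cyl_Lip n" shows "(\<lambda>x. F x * G x) \<in> cyl_Lip n"
proof -
  obtain C L where 1: "C \<ge> 0" "\<And>x. \<bar>F x\<bar> \<le> C" "L \<ge> 0" "\<And>x y. \<bar>F x - F y\<bar> \<le> L * (\<Sum>j<n. \<bar>x j - y j\<bar>)"
    by (rule cyl_LipE[OF assms(1)], rule that)
  obtain C' L' where 2: "C' \<ge> 0" "\<And>x. \<bar>G x\<bar> \<le> C'" "L' \<ge> 0" "\<And>x y. \<bar>G x - G y\<bar> \<le> L' * (\<Sum>j<n. \<bar>x j - y j\<bar>)"
    by (rule cyl_LipE[OF assms(2)], rule that)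
  show ?thesis
  proof (rule cyl_LipI[of _ "C * C'" "L * C' + C * L'"])
    show "\<bar>F x * G x\<bar> \<le> C * C'" for x using 1 2 by (simp add: abs_mult mult_mono)
    show "\<bar>F x * G x - F y * G y\<bar> \<le> (L * C' + C * L') * (\<Sum>j<n. \<bar>x j - y j\<bar>)" for x y
    proof -
      have "\<bar>F x * G x - F y * G y\<bar> = \<bar>(F x - F y) * G x + F y * (G x - G y)\<bar>"
        by (simp add: algebra_simps)
      also have "\<dots> \<le> \<bar>F x - F y\<bar> * \<bar>G x\<bar> + \<bar>F y\<bar> * \<bar>G x - G y\<bar>"
        by (metis abs_mult abs_triangle_ineq)
      also have "\<dots> \<le> (L * (\<Sum>j<n. \<bar>x j - y j\<bar>)) * C' + C * (L' * (\<Sum>j<n. \<bar>x j - y j\<bar>))"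
        using 1 2 by (intro add_mono mult_mono) (auto intro: sum_nonneg)
      finally show ?thesis by (simp add: algebra_simps)
    qed
  qed (use 1 2 in simp)
qed

lemma cyl_Lip_compose:
  assumes "F \<in> cyl_Lip n" "M \<ge> 0" "\<And>x y. \<bar>\<psi> x - \<psi> y\<bar> \<le> M * \<bar>x - y\<bar>"
  shows "(\<lambda>x. \<psi> (F x)) \<in> cyl_Lip n"
proof -
  obtain C L where 1: "C \<ge> 0" "\<And>x. \<bar>F x\<bar> \<le> C" "L \<ge> 0" "\<And>x y. \<bar>F x - F y\<bar> \<le> L * (\<Sum>j<n. \<bar>x j - y j\<bar>)"
    by (rule cyl_LipE[OF assms(1)], rule that)
  show ?thesis
  proof (rule cyl_LipI[of _ "\<bar>\<psi> 0\<bar> + M * C" "M * L"])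
    show "\<bar>\<psi> (F x)\<bar> \<le> \<bar>\<psi> 0\<bar> + M * C" for x
    proof -
      have "\<bar>\<psi> (F x)\<bar> \<le> \<bar>\<psi> 0\<bar> + \<bar>\<psi> (F x) - \<psi> 0\<bar>" by linarith
      then show ?thesis using assms(3)[of "F x" 0] mult_left_mono[OF 1(2)[of x] assms(2)] by simp
    qed
    show "\<bar>\<psi> (F x) - \<psi> (F y)\<bar> \<le> M * L * (\<Sum>j<n. \<bar>x j - y j\<bar>)" for x y
      using assms(3)[of "F x" "F y"] mult_left_mono[OF 1(4)[of x y] assms(2)] by (simp add: mult.assoc)
  qed (use 1 assms in simp)
qed

lemma cyl_Lip_sum:
  assumes "\<And>i. i \<in> I \<Longrightarrow> F i \<in> cyl_Lip n" shows "(\<lambda>x. \<Sum>i\<in>I. F i x) \<in> cyl_Lip n"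
  using assms by (induction I rule: infinite_finite_induct) (auto intro: cyl_Lip_const cyl_Lip_add)

lemma cyl_Lip_posneg:
  assumes "F \<in> cyl_Lip n"
  shows "(\<lambda>x. max 0 (F x)) \<in> cyl_Lip n" "(\<lambda>x. max 0 (- F x)) \<in> cyl_Lip n"
    "(\<lambda>x. - F x) \<in> cyl_Lip n" "(\<lambda>x. \<bar>F x\<bar>) \<in> cyl_Lip n"
  by (rule cyl_Lip_compose[OF assms, of 1]; simp)+

lemma cyl_Lip_Cb_Lip:
  assumes "F \<in> cyl_Lip n" shows "F \<in> Cb_Lip n"
proof -
  obtain C L where 1: "\<And>x. \<bar>F x\<bar> \<le> C" "L \<ge> 0" "\<And>x y. \<bar>F x - F y\<bar> \<le> L * (\<Sum>j<n. \<bar>x j - y j\<bar>)"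
    by (rule cyl_LipE[OF assms(1)], rule that)
  have "\<bar>F x - F y\<bar> \<le> (L * real n) * L2_set (\<lambda>i. x i - y i) {..<n}" for x y
  proof -
    have "\<bar>x j - y j\<bar> \<le> L2_set (\<lambda>i. x i - y i) {..<n}" if "j < n" for j
    proof -
      have "\<bar>x j - y j\<bar> = sqrt (\<Sum>i\<in>{j}. (x i - y i)\<^sup>2)" by simp
      also have "\<dots> \<le> L2_set (\<lambda>i. x i - y i) {..<n}"
        unfolding L2_set_def using that by (intro real_sqrt_le_mono sum_mono2) auto
      finally show ?thesis .
    qed
    then have "(\<Sum>j<n. \<bar>x j - y j\<bar>) \<le> (\<Sum>j<n. L2_set (\<lambda>i. x i - y i) {..<n})"
      by (intro sum_mono) auto
    then have "L * (\<Sum>j<n. \<bar>x j - y j\<bar>) \<le> (L * real n) * L2_set (\<lambda>i. x i - y i) {..<n}"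
      using mult_left_mono[OF _ 1(2)] by (simp add: mult.assoc)
    with 1(3)[of x y] show ?thesis by linarith
  qed
  then show ?thesis using 1(1) unfolding Cb_Lip_def by blast
qed

text \<open>The link between Lipschitz functions for the metric of the sequence space, which regularity of
  measures provides, and Lipschitz functions of finitely many coordinates.\<close>

lemma dist_trunc_le:
  fixes x y :: seqspace
  shows "dist (trunc n x) (trunc n y) \<le> 2 * (\<Sum>j<n. \<bar>x j - y j\<bar>)"
proof -
  let ?S = "\<Sum>j<n. \<bar>x j - y j\<bar>"
  let ?t = "\<lambda>i. (1/2)^i * min (dist (trunc n x (from_nat i)) (trunc n y (from_nat i))) 1 :: real"
  have b: "dist (trunc n x j) (trunc n y j) \<le> ?S" for j
    by (cases "j < n") (auto simp: trunc_def dist_real_def sum_nonneg intro!: member_le_sum)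
  have le: "?t i \<le> (1/2)^i * ?S" for i
    using b[of "from_nat i"] by (intro mult_left_mono) auto
  have s: "summable (\<lambda>i. (1/2)^i * ?S)"
    by (intro summable_mult2 summable_geometric) simp
  have "summable ?t"
    by (rule summable_comparison_test_ev[OF _ s]) (use le in \<open>auto intro!: always_eventually\<close>)
  then have "dist (trunc n x) (trunc n y) \<le> (\<Sum>i. (1/2)^i * ?S)"
    unfolding dist_fun_def using le s by (intro suminf_le) auto
  also have "\<dots> = 2 * ?S"
    by (subst suminf_mult2[symmetric]) (simp_all add: suminf_geometric summable_geometric)
  finally show ?thesis .
qed

section \<open>Lipschitz cylinder functions are dense\<close>

text \<open>By inner regularity \<open>B\<close> contains a compact set \<open>K\<close> of almost the same measure, and the functions
  \<open>max 0 (1 - m * infdist x K)\<close> converge to the indicator function of \<open>K\<close> from above.\<close>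

lemma L1_approx_Lipschitz_indicator:
  fixes Q :: "'a::polish_space measure"
  assumes Q: "finite_measure Q" "sets Q = sets borel" and B: "B \<in> sets borel" and e: "\<epsilon> > 0"
  shows "\<exists>g L. (\<forall>x. 0 \<le> g x \<and> g x \<le> 1) \<and> L \<ge> 0 \<and> (\<forall>x y. \<bar>g x - g y\<bar> \<le> L * dist x y) \<and>
    (\<integral>x. \<bar>indicat_real B x - g x\<bar> \<partial>Q) < \<epsilon>"
proof -
  interpret finite_measure Q by fact
  have spQ: "space Q = UNIV" using sets_eq_imp_space_eq[OF Q(2)] by simp
  have mQ: "measurable Q N = measurable borel N" for N
    by (rule measurable_cong_sets) (simp_all add: Q)
  have Bm: "B \<in> sets Q" using B Q by simp
  have "\<exists>K. K \<subseteq> B \<and> compact K \<and> measure Q B \<le> measure Q K + \<epsilon>/2"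
  proof (rule ccontr)
    assume "\<not> ?thesis"
    then have neg: "measure Q K \<le> measure Q B - \<epsilon>/2" if "K \<subseteq> B" "compact K" for K
      using that by (meson le_diff_eq linear)
    from neg[of "{}"] have pos: "0 \<le> measure Q B - \<epsilon>/2" by simp
    have "emeasure Q B = (SUP K\<in>{K. K \<subseteq> B \<and> compact K}. emeasure Q K)"
      by (rule inner_regular[OF Q(2) _ B]) (simp add: emeasure_finite)
    also have "\<dots> \<le> ennreal (measure Q B - \<epsilon>/2)"
      using neg by (intro SUP_least) (auto simp: emeasure_eq_measure intro: ennreal_leI)
    finally have "measure Q B \<le> measure Q B - \<epsilon>/2"
      using pos by (simp add: emeasure_eq_measure)
    then show False using e by simp
  qed
  then obtain K where K: "K \<subseteq> B" "compact K" and mKB: "measure Q B \<le> measure Q K + \<epsilon>/2" by blast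
  have Km: "K \<in> sets Q" using K by (simp add: Q(2) borel_closed compact_imp_closed)
  have intK: "integrable Q (indicat_real A)" if "A \<in> sets borel" for A
    using that by (intro integrable_const_bound[of _ 1]) (auto simp: mQ)
  define g where "g m x = (if K = {} then 0 else max 0 (1 - real m * infdist x K))" for m x
  have g01: "0 \<le> g m x \<and> g m x \<le> 1" for m x
    by (auto simp: g_def infdist_nonneg)
  have gL: "\<bar>g m x - g m y\<bar> \<le> real m * dist x y" for m x y
  proof (cases "K = {}")
    case False
    have "\<bar>real m * infdist x K - real m * infdist y K\<bar> \<le> real m * dist x y"
      using infdist_triangle_abs[of x K y] by (metis abs_mult abs_of_nat mult_left_mono of_nat_0_le_iff right_diff_distrib')
    then show ?thesis by (auto simp: g_def False)
  qed (simp add: g_def)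
  have gm: "g m \<in> borel_measurable borel" for m
    using gL by (intro borel_measurable_continuous_onI lipschitz_on_continuous_on[of "real m"] lipschitz_onI)
      (auto simp: dist_real_def)
  have g_lim: "(\<lambda>m. g m x) \<longlonglongrightarrow> indicat_real K x" for x
  proof (cases "x \<in> K")
    case True
    then have "g m x = 1" for m by (auto simp: g_def)
    then show ?thesis using True by simp
  next
    case False
    show ?thesis
    proof (cases "K = {}")
      case ne: False
      have pos: "infdist x K > 0"
        using False ne compact_imp_closed[OF K(2)] infdist_nonneg[of x K]
        by (metis in_closed_iff_infdist_zero less_eq_real_def)
      then obtain N where "1 < real N * infdist x K" by (meson reals_Archimedean3)
      have "g m x = 0" if "m \<ge> N" for m
      proof -
        have "real N * infdist x K \<le> real m * infdist x K" using that pos by (intro mult_right_mono) auto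
        then show ?thesis using \<open>1 < real N * infdist x K\<close> ne by (simp add: g_def)
      qed
      then have "\<forall>\<^sub>F m in sequentially. g m x = 0" by (auto simp: eventually_sequentially)
      then show ?thesis using False by (auto intro: tendsto_eventually)
    qed (simp add: g_def)
  qed
  have "(\<lambda>m. \<integral>x. \<bar>indicat_real K x - g m x\<bar> \<partial>Q) \<longlonglongrightarrow> (\<integral>x. 0 \<partial>Q)"
  proof (rule integral_dominated_convergence[where w="\<lambda>_. 1"])
    show "AE x in Q. (\<lambda>m. \<bar>indicat_real K x - g m x\<bar>) \<longlonglongrightarrow> 0"
      using tendsto_rabs_zero[OF LIM_zero[OF g_lim]] by (simp add: abs_minus_commute)
    show "AE x in Q. norm \<bar>indicat_real K x - g m x\<bar> \<le> 1" for m
      using g01[of m] by (auto simp: indicator_def)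
  qed (use gm Km in \<open>auto simp: mQ Q(2)\<close>)
  then have "\<forall>\<^sub>F m in sequentially. (\<integral>x. \<bar>indicat_real K x - g m x\<bar> \<partial>Q) < \<epsilon>/2"
    using e by (intro order_tendstoD) auto
  then obtain m where m: "(\<integral>x. \<bar>indicat_real K x - g m x\<bar> \<partial>Q) < \<epsilon>/2"
    by (auto simp: eventually_sequentially)
  have intg: "integrable Q (g m)"
    using g01 gm by (intro integrable_const_bound[of _ 1]) (auto simp: mQ)
  have iB: "integrable Q (indicat_real B)" and iK: "integrable Q (indicat_real K)"
    using B Km by (auto simp: Q(2) intro: intK)
  have "(\<integral>x. \<bar>indicat_real B x - g m x\<bar> \<partial>Q)
      \<le> (\<integral>x. (indicat_real B x - indicat_real K x) + \<bar>indicat_real K x - g m x\<bar> \<partial>Q)"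
    using K(1) by (intro integral_mono Bochner_Integration.integrable_add
        Bochner_Integration.integrable_diff integrable_abs iB iK intg)
      (auto simp: indicator_def)
  also have "\<dots> = (measure Q B - measure Q K) + (\<integral>x. \<bar>indicat_real K x - g m x\<bar> \<partial>Q)"
    using iB iK intg Bm Km by (simp add: spQ)
  also have "\<dots> < \<epsilon>" using m mKB by linarith
  finally show ?thesis
    using g01 gL by (intro exI[of _ "g m"] exI[of _ "real m"]) auto
qed

lemma L1_approx_Lipschitz:
  fixes Q :: "'a::polish_space measure" and f :: "'a \<Rightarrow> real"
  assumes Q: "finite_measure Q" "sets Q = sets borel" and f: "integrable Q f"
  shows "\<forall>\<epsilon>>0. \<exists>g C L. (\<forall>x. \<bar>g x\<bar> \<le> C) \<and> L \<ge> 0 \<and> (\<forall>x y. \<bar>g x - g y\<bar> \<le> L * dist x y) \<and>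
    (\<integral>x. \<bar>f x - g x\<bar> \<partial>Q) < \<epsilon>"
  using f
proof (induction rule: integrable_induct)
  interpret finite_measure Q by fact
  have mQ: "measurable Q N = measurable borel N" for N
    by (rule measurable_cong_sets) (simp_all add: Q)
  have intL: "integrable Q g" if "\<And>x. \<bar>g x\<bar> \<le> C" "L \<ge> 0" "\<And>x y. \<bar>g x - g y\<bar> \<le> L * dist x y" for g :: "'a \<Rightarrow> real" and C L
  proof (rule integrable_const_bound[of _ C])
    have "continuous_on UNIV g"
      using that(2,3) by (intro lipschitz_on_continuous_on[of L] lipschitz_onI) (auto simp: dist_real_def)
    then show "g \<in> borel_measurable Q" by (simp add: mQ borel_measurable_continuous_onI)
  qed (use that in auto)
  {
    case (base A c)
    show ?case
    proof (intro allI impI)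
      fix \<epsilon> :: real assume "\<epsilon> > 0"
      then have "\<epsilon> / (\<bar>c\<bar> + 1) > 0" by simp
      from L1_approx_Lipschitz_indicator[OF Q _ this, of A] base(1)[unfolded Q(2)]
      obtain g L where g: "\<And>x. 0 \<le> g x \<and> g x \<le> 1" "L \<ge> 0" "\<And>x y. \<bar>g x - g y\<bar> \<le> L * dist x y"
        "(\<integral>x. \<bar>indicat_real A x - g x\<bar> \<partial>Q) < \<epsilon> / (\<bar>c\<bar> + 1)" by blast
      have "(\<integral>x. \<bar>indicat_real A x *\<^sub>R c - c * g x\<bar> \<partial>Q) = (\<integral>x. \<bar>c\<bar> * \<bar>indicat_real A x - g x\<bar> \<partial>Q)"
        by (intro Bochner_Integration.integral_cong) (auto simp: abs_mult[symmetric] algebra_simps)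
      also have "\<dots> = \<bar>c\<bar> * (\<integral>x. \<bar>indicat_real A x - g x\<bar> \<partial>Q)" by simp
      also have "\<dots> \<le> (\<bar>c\<bar> + 1) * (\<integral>x. \<bar>indicat_real A x - g x\<bar> \<partial>Q)"
        by (intro mult_right_mono integral_nonneg_AE) auto
      also have "\<dots> < \<epsilon>" using g(4) by (simp add: field_simps)
      finally have 1: "(\<integral>x. \<bar>indicat_real A x *\<^sub>R c - c * g x\<bar> \<partial>Q) < \<epsilon>" .
      have 2: "\<bar>c * g x\<bar> \<le> \<bar>c\<bar>" for x
        using g(1)[of x] by (auto simp: abs_mult intro: mult_left_le)
      have 3: "\<bar>c * g x - c * g y\<bar> \<le> (\<bar>c\<bar> * L) * dist x y" for x y
      proof -
        have "\<bar>c * g x - c * g y\<bar> = \<bar>c\<bar> * \<bar>g x - g y\<bar>" by (simp add: abs_mult[symmetric] algebra_simps)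
        then show ?thesis using mult_left_mono[OF g(3)[of x y], of "\<bar>c\<bar>"] by (simp add: mult.assoc)
      qed
      show "\<exists>g C L. (\<forall>x. \<bar>g x\<bar> \<le> C) \<and> L \<ge> 0 \<and> (\<forall>x y. \<bar>g x - g y\<bar> \<le> L * dist x y) \<and>
          (\<integral>x. \<bar>indicat_real A x *\<^sub>R c - g x\<bar> \<partial>Q) < \<epsilon>"
        by (intro exI[of _ "\<lambda>x. c * g x"] exI[of _ "\<bar>c\<bar>"] exI[of _ "\<bar>c\<bar> * L"] conjI allI 1 2 3)
          (use g(2) in simp)
    qed
  next
    case (add f1 f2)
    show ?case
    proof (intro allI impI)
      fix \<epsilon> :: real assume "\<epsilon> > 0"
      then have e2: "\<epsilon>/2 > 0" by simp
      obtain g1 C1 L1 where g1: "\<And>x. \<bar>g1 x\<bar> \<le> C1" "L1 \<ge> 0" "\<And>x y. \<bar>g1 x - g1 y\<bar> \<le> L1 * dist x y"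
        "(\<integral>x. \<bar>f1 x - g1 x\<bar> \<partial>Q) < \<epsilon>/2" using add(3) e2 by blast
      obtain g2 C2 L2 where g2: "\<And>x. \<bar>g2 x\<bar> \<le> C2" "L2 \<ge> 0" "\<And>x y. \<bar>g2 x - g2 y\<bar> \<le> L2 * dist x y"
        "(\<integral>x. \<bar>f2 x - g2 x\<bar> \<partial>Q) < \<epsilon>/2" using add(4) e2 by blast
      have i: "integrable Q g1" "integrable Q g2"
        by (rule intL[OF g1(1-3)], rule intL[OF g2(1-3)])
      have "(\<integral>x. \<bar>f1 x + f2 x - (g1 x + g2 x)\<bar> \<partial>Q) \<le> (\<integral>x. \<bar>f1 x - g1 x\<bar> + \<bar>f2 x - g2 x\<bar> \<partial>Q)"
        using add(1,2) i by (intro integral_mono) auto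
      also have "\<dots> < \<epsilon>" using add(1,2) i g1(4) g2(4) by simp
      finally have 1: "(\<integral>x. \<bar>f1 x + f2 x - (g1 x + g2 x)\<bar> \<partial>Q) < \<epsilon>" .
      have 2: "\<bar>g1 x + g2 x\<bar> \<le> C1 + C2" for x using g1(1)[of x] g2(1)[of x] by linarith
      have 3: "\<bar>g1 x + g2 x - (g1 y + g2 y)\<bar> \<le> (L1 + L2) * dist x y" for x y
        using g1(3)[of x y] g2(3)[of x y] by (simp add: algebra_simps)
      show "\<exists>g C L. (\<forall>x. \<bar>g x\<bar> \<le> C) \<and> L \<ge> 0 \<and> (\<forall>x y. \<bar>g x - g y\<bar> \<le> L * dist x y) \<and>
          (\<integral>x. \<bar>f1 x + f2 x - g x\<bar> \<partial>Q) < \<epsilon>"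
        by (intro exI[of _ "\<lambda>x. g1 x + g2 x"] exI[of _ "C1 + C2"] exI[of _ "L1 + L2"] conjI allI 1 2 3)
          (use g1(2) g2(2) in simp)
    qed
  next
    case (lim f s)
    show ?case
    proof (intro allI impI)
      fix \<epsilon> :: real assume e: "\<epsilon> > 0"
      have "(\<lambda>i. \<integral>x. \<bar>f x - s i x\<bar> \<partial>Q) \<longlonglongrightarrow> (\<integral>x. 0 \<partial>Q)"
      proof (rule integral_dominated_convergence[where w="\<lambda>x. 3 * \<bar>f x\<bar>"])
        show "AE x in Q. (\<lambda>i. \<bar>f x - s i x\<bar>) \<longlonglongrightarrow> 0"
        proof (rule AE_I2)
          fix x assume "x \<in> space Q"
          from tendsto_rabs_zero[OF LIM_zero[OF lim.hyps(2)[OF this]]]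
          show "(\<lambda>i. \<bar>f x - s i x\<bar>) \<longlonglongrightarrow> 0" by (simp add: abs_minus_commute)
        qed
        show "AE x in Q. norm \<bar>f x - s i x\<bar> \<le> 3 * \<bar>f x\<bar>" for i
        proof (rule AE_I2)
          fix x assume "x \<in> space Q"
          from lim.hyps(3)[OF this, of i] show "norm \<bar>f x - s i x\<bar> \<le> 3 * \<bar>f x\<bar>" by simp
        qed
      qed (use lim.hyps(1,4) in auto)
      then have "\<forall>\<^sub>F i in sequentially. (\<integral>x. \<bar>f x - s i x\<bar> \<partial>Q) < \<epsilon>/2"
        using e by (intro order_tendstoD) auto
      then obtain i where i: "(\<integral>x. \<bar>f x - s i x\<bar> \<partial>Q) < \<epsilon>/2"
        by (auto simp: eventually_sequentially)
      have e2: "\<epsilon>/2 > 0" using e by simp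
      obtain g C L where g: "\<And>x. \<bar>g x\<bar> \<le> C" "L \<ge> 0" "\<And>x y. \<bar>g x - g y\<bar> \<le> L * dist x y"
        "(\<integral>x. \<bar>s i x - g x\<bar> \<partial>Q) < \<epsilon>/2" using lim.IH[of i] e2 by blast
      have ig: "integrable Q g" by (rule intL[OF g(1-3)])
      have "(\<integral>x. \<bar>f x - g x\<bar> \<partial>Q) \<le> (\<integral>x. \<bar>f x - s i x\<bar> + \<bar>s i x - g x\<bar> \<partial>Q)"
        using lim.hyps(1,4) ig by (intro integral_mono) auto
      also have "\<dots> < \<epsilon>" using lim.hyps(1,4) ig g(4) i by simp
      finally have "(\<integral>x. \<bar>f x - g x\<bar> \<partial>Q) < \<epsilon>" .
      then show "\<exists>g C L. (\<forall>x. \<bar>g x\<bar> \<le> C) \<and> L \<ge> 0 \<and> (\<forall>x y. \<bar>g x - g y\<bar> \<le> L * dist x y) \<and>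
          (\<integral>x. \<bar>f x - g x\<bar> \<partial>Q) < \<epsilon>"
        using g(1-3) by blast
    qed
  }
qed

text \<open>Apply the density of Lipschitz functions to the image of \<open>P\<close> under \<open>trunc n\<close>, and clip the approximant
  to the range of \<open>h\<close>, which can only bring it closer to \<open>h\<close>.\<close>

lemma cyl_Lip_dense:
  assumes P: "P \<in> prob_measures" and h: "h \<in> past n" and h01: "\<And>x. h x \<in> {a..b}" and e: "\<epsilon> > 0"
  obtains g where "g \<in> cyl_Lip n" "\<And>x. g x \<in> {a..b}" "(\<integral>x. \<bar>h x - g x\<bar> \<partial>P) < \<epsilon>"
proof -
  interpret prob_space P using prob_measuresD[OF P] by simp
  have ab: "a \<le> b" using h01[of undefined] by simp
  have hb: "\<bar>h x\<bar> \<le> max \<bar>a\<bar> \<bar>b\<bar>" for x using h01[of x] by auto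
  have tm: "trunc n \<in> P \<rightarrow>\<^sub>M borel" by (simp add: prob_measures_measurable[OF P])
  define Q where "Q = distr P borel (trunc n)"
  have Qp: "prob_space Q" unfolding Q_def by (rule prob_space_distr[OF tm])
  then have Q: "finite_measure Q" "sets Q = sets borel" "Q \<in> prob_measures"
    by (auto simp: Q_def prob_measures_def prob_space_def)
  have ih: "integrable Q h"
    by (rule integrable_bounded[OF Q(3) pastD(1)[OF h] hb])
  obtain g C L where g: "\<And>x. \<bar>g x\<bar> \<le> C" "L \<ge> 0" "\<And>x y. \<bar>g x - g y\<bar> \<le> L * dist x y"
    "(\<integral>x. \<bar>h x - g x\<bar> \<partial>Q) < \<epsilon>" using L1_approx_Lipschitz[OF Q(1,2) ih] e by blast
  have gm: "g \<in> borel_measurable borel"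
    using g(2,3) by (intro borel_measurable_continuous_onI lipschitz_on_continuous_on[of L] lipschitz_onI)
      (auto simp: dist_real_def)
  define g' where "g' x = max a (min b (g (trunc n x)))" for x
  show thesis
  proof
    show "g' \<in> cyl_Lip n"
    proof (rule cyl_LipI[of _ "max \<bar>a\<bar> \<bar>b\<bar>" "2 * L"])
      fix x y
      have "\<bar>g' x - g' y\<bar> \<le> \<bar>g (trunc n x) - g (trunc n y)\<bar>" by (auto simp: g'_def)
      also have "\<dots> \<le> L * (2 * (\<Sum>j<n. \<bar>x j - y j\<bar>))"
        using g(3)[of "trunc n x" "trunc n y"] mult_left_mono[OF dist_trunc_le[of n x y] g(2)] by linarith
      finally show "\<bar>g' x - g' y\<bar> \<le> 2 * L * (\<Sum>j<n. \<bar>x j - y j\<bar>)" by simp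
    qed (use g(2) ab in \<open>auto simp: g'_def\<close>)
    show "g' x \<in> {a..b}" for x using ab by (auto simp: g'_def)
    have ig: "integrable Q g" by (rule integrable_bounded[OF Q(3) gm g(1)])
    have "(\<integral>x. \<bar>h x - g' x\<bar> \<partial>P) \<le> (\<integral>x. \<bar>h (trunc n x) - g (trunc n x)\<bar> \<partial>P)"
    proof (rule integral_mono)
      have h_measurable[measurable]: "h \<in> borel_measurable borel" by (rule pastD(1)[OF h])
      have g'_measurable[measurable]: "g' \<in> borel_measurable borel"
        unfolding g'_def using gm by measurable
      show "integrable P (\<lambda>x. \<bar>h x - g' x\<bar>)"
      proof (rule integrable_bounded[OF P])
        show "\<bar>\<bar>h x - g' x\<bar>\<bar> \<le> b - a" for x using h01[of x] ab by (auto simp: g'_def)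
      qed measurable
      show "integrable P (\<lambda>x. \<bar>h (trunc n x) - g (trunc n x)\<bar>)"
        using ih ig by (intro integrable_distr[OF tm]) (auto simp: Q_def[symmetric])
      show "\<bar>h x - g' x\<bar> \<le> \<bar>h (trunc n x) - g (trunc n x)\<bar>" for x
      proof -
        have "h (trunc n x) = h x" using h by (simp add: past_def)
        then show ?thesis using h01[of x] by (auto simp: g'_def)
      qed
    qed
    also have "\<dots> = (\<integral>x. \<bar>h x - g x\<bar> \<partial>Q)"
    proof -
      have [measurable]: "h \<in> borel_measurable borel" "g \<in> borel_measurable borel"
        using gm pastD(1)[OF h] by auto
      show ?thesis unfolding Q_def by (intro integral_distr[symmetric] tm) measurable
    qed
    also note g(4)
    finally show "(\<integral>x. \<bar>h x - g' x\<bar> \<partial>P) < \<epsilon>" .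
  qed
qed

section \<open>Independence\<close>

locale iid_expectation = weakly_compact_expectation +
  assumes iid: "iid E xi"
begin

lemma E_const: "E (\<lambda>_. c) = c"
proof -
  have "(\<lambda>_. c) \<in> Cb" by (rule cyl_Lip_Cb[OF cyl_Lip_const])
  then obtain P where P: "P \<in> \<Theta>\<^sub>0" "integral\<^sup>L P (\<lambda>_. c) = E (\<lambda>_. c)" by (rule E_attained)
  interpret prob_space P using P \<Theta>\<^sub>0_prob prob_measuresD by blast
  show ?thesis using P(2) by (simp add: prob_space)
qed

lemma E_affine_nonneg:
  assumes X: "X \<in> Cb" and Y: "(\<lambda>w. a + s * X w) \<in> Cb" and s: "s \<ge> 0"
  shows "E (\<lambda>w. a + s * X w) = a + s * E X"
proof (rule antisym)
  have int: "(\<integral>w. a + s * X w \<partial>P) = a + s * integral\<^sup>L P X" if "P \<in> \<Theta>\<^sub>0" for P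
  proof -
    interpret prob_space P using that \<Theta>\<^sub>0_prob prob_measuresD by blast
    show ?thesis using integrable_Cb[OF \<Theta>\<^sub>0_prob[OF that] X] by (simp add: prob_space)
  qed
  show "E (\<lambda>w. a + s * X w) \<le> a + s * E X"
    by (rule E_least[OF Y]) (auto simp: int intro!: mult_left_mono s \<Theta>_le X \<Theta>\<^sub>0_subset)
  obtain P where P: "P \<in> \<Theta>\<^sub>0" "integral\<^sup>L P X = E X" by (rule E_attained[OF X])
  show "a + s * E X \<le> E (\<lambda>w. a + s * X w)"
    using \<Theta>_le[OF \<Theta>\<^sub>0_subset[OF P(1)] Y] int[OF P(1)] P(2) by simp
qed

text \<open>The upper expectation of \<open>\<psi> (\<xi>)\<close> for a generic coordinate \<open>\<xi>\<close>; coordinate \<open>0\<close> stands for all of them.\<close>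

definition upper_exp :: "(real \<Rightarrow> real) \<Rightarrow> real" where
  "upper_exp \<psi> = E (\<lambda>w. \<psi> (w 0))"

text \<open>The upper expectation of \<open>b * \<psi> (\<xi>)\<close>.\<close>

abbreviation scaled_exp :: "(real \<Rightarrow> real) \<Rightarrow> real \<Rightarrow> real" where
  "scaled_exp \<psi> b \<equiv> max 0 b * upper_exp \<psi> + max 0 (- b) * upper_exp (\<lambda>x. - \<psi> x)"

lemma bLip_uminus: "\<psi> \<in> bLip \<Longrightarrow> (\<lambda>x. - \<psi> x) \<in> bLip"
  unfolding bLip_def by (simp add: abs_minus_commute)

lemma coordinate_Cb: "\<psi> \<in> bLip \<Longrightarrow> (\<lambda>w. \<psi> (w k)) \<in> Cb"
  by (rule cyl_Lip_Cb[OF cyl_Lip_coordinate[of _ k "Suc k"]]) auto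

lemma upper_exp_coordinate:
  assumes \<psi>: "\<psi> \<in> bLip"
  shows "E (\<lambda>w. \<psi> (w k)) = upper_exp \<psi>"
proof (induction k)
  case (Suc k)
  have "(\<lambda>x. \<psi> (x 0)) \<in> Cb_Lip 1"
    by (rule cyl_Lip_Cb_Lip[OF cyl_Lip_coordinate[OF \<psi>]]) simp
  moreover have "identically_distributed E 1 (rvec xi (Suc k) 1) (rvec xi k 1)"
    using iid by (auto simp: iid_def dest: spec[of _ "Suc k"])
  ultimately have "ext_expectation E (\<lambda>w. \<psi> (rvec xi (Suc k) 1 w 0)) = ext_expectation E (\<lambda>w. \<psi> (rvec xi k 1 w 0))"
    unfolding identically_distributed_def by (rule bspec[rotated])
  then show ?case
    using Suc by (simp add: rvec_def xi_def ext_expectation_Cb coordinate_Cb[OF \<psi>])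
qed (simp add: upper_exp_def)

text \<open>With the past frozen, the function is affine in \<open>\<psi> (w k)\<close>; its upper expectation depends on the sign of
  the slope, whence \<open>scaled_exp\<close>.\<close>

lemma independence:
  assumes k: "k \<ge> 1" and A: "A \<in> cyl_Lip k" and s: "s \<in> cyl_Lip k" and \<psi>: "\<psi> \<in> bLip"
  shows "E (\<lambda>w. A w + s w * \<psi> (w k)) =
    E (\<lambda>w. A w + scaled_exp \<psi> (s w))"
proof -
  define F where "F w = A w + s w * \<psi> (w k)" for w
  have F: "F \<in> cyl_Lip (Suc k)"
    unfolding F_def using A s \<psi>
    by (intro cyl_Lip_add cyl_Lip_mult cyl_Lip_coordinate cyl_Lip_mono[of k "Suc k"]) auto
  have inCb: "(\<lambda>w'. a + b * \<psi> (w' k)) \<in> Cb" for a b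
    by (rule cyl_Lip_Cb[of _ "Suc k"])
      (intro cyl_Lip_add cyl_Lip_mult cyl_Lip_const cyl_Lip_coordinate \<psi>, simp)
  have inner: "E (\<lambda>w'. a + b * \<psi> (w' k)) = a + scaled_exp \<psi> b" for a b
  proof (cases "b \<ge> 0")
    case True
    from E_affine_nonneg[OF coordinate_Cb[OF \<psi>] inCb True] True show ?thesis
      by (simp add: upper_exp_coordinate[OF \<psi>])
  next
    case False
    have "(\<lambda>w'. a + (- b) * - \<psi> (w' k)) \<in> Cb" using inCb by simp
    from E_affine_nonneg[OF coordinate_Cb[OF bLip_uminus[OF \<psi>]] this] False show ?thesis
      by (simp add: upper_exp_coordinate[OF bLip_uminus[OF \<psi>]])
  qed
  have v: "F (vappend k 1 (rvec xi 0 k w) (rvec xi k 1 w')) = A w + s w * \<psi> (w' k)" for w w'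
  proof -
    have "A (vappend k 1 (rvec xi 0 k w) (rvec xi k 1 w')) = A w"
      by (rule cyl_Lip_eq[OF A]) (simp add: vappend_def rvec_def xi_def)
    moreover have "s (vappend k 1 (rvec xi 0 k w) (rvec xi k 1 w')) = s w"
      by (rule cyl_Lip_eq[OF s]) (simp add: vappend_def rvec_def xi_def)
    ultimately show ?thesis by (simp add: F_def vappend_def rvec_def xi_def)
  qed
  have "independent_of E 1 (rvec xi k 1) k (rvec xi 0 k)"
    using iid k by (auto simp: iid_def)
  moreover have "F \<in> Cb_Lip (k + 1)" using cyl_Lip_Cb_Lip[OF F] by simp
  ultimately have "ext_expectation E (\<lambda>w. F (vappend k 1 (rvec xi 0 k w) (rvec xi k 1 w))) =
      ext_expectation E (\<lambda>w. ext_expectation E (\<lambda>w'. F (vappend k 1 (rvec xi 0 k w) (rvec xi k 1 w'))))"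
    unfolding independent_of_def by blast
  then have "ext_expectation E (\<lambda>w. A w + s w * \<psi> (w k)) =
      ext_expectation E (\<lambda>w. A w + scaled_exp \<psi> (s w))"
    unfolding v ext_expectation_Cb[OF inCb] inner .
  moreover have "(\<lambda>w. A w + scaled_exp \<psi> (s w)) \<in> Cb"
    by (rule cyl_Lip_Cb[of _ k]) (intro cyl_Lip_add cyl_Lip_mult cyl_Lip_const cyl_Lip_posneg A s)
  ultimately show ?thesis
    using cyl_Lip_Cb[OF F, unfolded F_def] by (simp only: ext_expectation_Cb)
qed

lemma le_upper_exp:
  assumes "\<psi> \<in> bLip" "P \<in> \<Theta>" shows "(\<integral>w. \<psi> (w k) \<partial>P) \<le> upper_exp \<psi>"
  using \<Theta>_le[OF assms(2) coordinate_Cb[OF assms(1), of k]] by (simp add: upper_exp_coordinate[OF assms(1)])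

text \<open>Independence in terms of a single measure: the conditional expectation of \<open>\<psi> (w k)\<close> given the past is at
  most \<open>upper_exp \<psi>\<close>. For a Lipschitz weight \<open>h\<close> this holds because \<open>h w * (\<psi> (w k) - upper_exp \<psi>)\<close> has
  upper expectation \<open>0\<close>; density extends it to Borel weights.\<close>

lemma conditional_mean_le_bounded:
  assumes P: "P \<in> \<Theta>" and k: "k \<ge> 1" and h: "h \<in> past k" "\<And>w. h w \<in> {0..B}" and \<psi>: "\<psi> \<in> bLip"
  shows "(\<integral>w. h w * \<psi> (w k) \<partial>P) \<le> upper_exp \<psi> * (\<integral>w. h w \<partial>P)"
proof (rule field_le_epsilon)
  fix \<epsilon> :: real assume e: "\<epsilon> > 0"
  note Pp = \<Theta>_prob[OF P]
  interpret prob_space P using prob_measuresD[OF Pp] by simp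
  obtain C where C: "\<And>x. \<bar>\<psi> x\<bar> \<le> C" using \<psi> unfolding bLip_def by blast
  have C0: "C \<ge> 0" using C[of 0] by simp
  define c where "c = C + \<bar>upper_exp \<psi>\<bar> + 1"
  have c: "c > 0" using C0 by (simp add: c_def)
  obtain g where g: "g \<in> cyl_Lip k" "\<And>x. g x \<in> {0..B}" "(\<integral>x. \<bar>h x - g x\<bar> \<partial>P) < \<epsilon> / c"
    by (rule cyl_Lip_dense[OF Pp h, of "\<epsilon> / c"]) (use e c in auto)
  have B: "B \<ge> 0" using g(2)[of undefined] by simp
  have [measurable]: "g \<in> borel_measurable borel" "h \<in> borel_measurable borel"
    "(\<lambda>w. \<psi> (w k)) \<in> borel_measurable borel"
    using cyl_Lip_measurable[OF g(1)] pastD(1)[OF h(1)] CbD(1)[OF coordinate_Cb[OF \<psi>]] by auto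
  have ig: "integrable P g" "integrable P h"
    using g(2) h(2) by (auto intro!: integrable_bounded[OF Pp, of _ B])
  have ip: "integrable P (\<lambda>w. f w * \<psi> (w k))" if "f \<in> borel_measurable borel" "\<And>x. f x \<in> {0..B}" for f
  proof (rule integrable_bounded[OF Pp, of _ "B * C"])
    show "(\<lambda>w. f w * \<psi> (w k)) \<in> borel_measurable borel" using that by measurable
    show "\<bar>f x * \<psi> (x k)\<bar> \<le> B * C" for x
      using that(2)[of x] C[of "x k"] B by (auto simp: abs_mult intro!: mult_mono)
  qed
  have "E (\<lambda>w. - upper_exp \<psi> * g w + g w * \<psi> (w k)) = E (\<lambda>_. 0)"
  proof -
    have "E (\<lambda>w. - upper_exp \<psi> * g w + g w * \<psi> (w k)) =
        E (\<lambda>w. - upper_exp \<psi> * g w + scaled_exp \<psi> (g w))"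
      by (rule independence[OF k _ g(1) \<psi>]) (intro cyl_Lip_mult cyl_Lip_const g)
    also have "(\<lambda>w. - upper_exp \<psi> * g w + scaled_exp \<psi> (g w)) = (\<lambda>_. 0)"
    proof
      fix w
      have "max 0 (g w) = g w" "max 0 (- g w) = 0" using g(2)[of w] by auto
      then show "- upper_exp \<psi> * g w + scaled_exp \<psi> (g w) = 0" by simp
    qed
    finally show ?thesis .
  qed
  moreover have "(\<lambda>w. - upper_exp \<psi> * g w + g w * \<psi> (w k)) \<in> Cb"
    by (rule cyl_Lip_Cb[of _ "Suc k"])
      (intro cyl_Lip_add cyl_Lip_mult cyl_Lip_const cyl_Lip_coordinate \<psi> cyl_Lip_mono[OF _ g(1)]; simp)
  ultimately have "(\<integral>w. - upper_exp \<psi> * g w + g w * \<psi> (w k) \<partial>P) \<le> 0"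
    using \<Theta>_le[OF P] by (metis E_const)
  then have 1: "(\<integral>w. g w * \<psi> (w k) \<partial>P) \<le> upper_exp \<psi> * (\<integral>w. g w \<partial>P)"
    using ig ip[of g] g(2) by simp
  have "(\<integral>w. h w * \<psi> (w k) \<partial>P) - upper_exp \<psi> * (\<integral>w. h w \<partial>P)
      \<le> ((\<integral>w. h w * \<psi> (w k) \<partial>P) - upper_exp \<psi> * (\<integral>w. h w \<partial>P)) - ((\<integral>w. g w * \<psi> (w k) \<partial>P) - upper_exp \<psi> * (\<integral>w. g w \<partial>P))"
    using 1 by linarith
  also have "\<dots> = (\<integral>w. (h w - g w) * (\<psi> (w k) - upper_exp \<psi>) \<partial>P)"
  proof -
    have "(\<integral>w. (h w - g w) * (\<psi> (w k) - upper_exp \<psi>) \<partial>P) =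
        (\<integral>w. (h w * \<psi> (w k) - upper_exp \<psi> * h w) - (g w * \<psi> (w k) - upper_exp \<psi> * g w) \<partial>P)"
      by (rule Bochner_Integration.integral_cong) (auto simp: algebra_simps)
    then show ?thesis using ig ip[of g] ip[of h] g(2) h(2) by simp
  qed
  also have "\<dots> \<le> (\<integral>w. c * \<bar>h w - g w\<bar> \<partial>P)"
  proof (rule integral_mono)
    show "integrable P (\<lambda>w. c * \<bar>h w - g w\<bar>)" using ig by simp
    have "integrable P (\<lambda>w. (h w * \<psi> (w k) - upper_exp \<psi> * h w) - (g w * \<psi> (w k) - upper_exp \<psi> * g w))"
      using ig ip[of g] ip[of h] g(2) h(2) by simp
    then show "integrable P (\<lambda>w. (h w - g w) * (\<psi> (w k) - upper_exp \<psi>))"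
      by (simp add: algebra_simps)
    show "(h w - g w) * (\<psi> (w k) - upper_exp \<psi>) \<le> c * \<bar>h w - g w\<bar>" for w
    proof -
      have "(h w - g w) * (\<psi> (w k) - upper_exp \<psi>) \<le> \<bar>h w - g w\<bar> * \<bar>\<psi> (w k) - upper_exp \<psi>\<bar>"
        by (metis abs_ge_self abs_mult)
      also have "\<dots> \<le> \<bar>h w - g w\<bar> * c"
        using C[of "w k"] by (intro mult_left_mono) (auto simp: c_def)
      finally show ?thesis by (simp add: mult.commute)
    qed
  qed
  also have "\<dots> \<le> \<epsilon>" using g(3) c by (simp add: field_simps)
  finally show "(\<integral>w. h w * \<psi> (w k) \<partial>P) \<le> upper_exp \<psi> * (\<integral>w. h w \<partial>P) + \<epsilon>" by simp
qed

end

section \<open>Moments\<close>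

lemma excess_le_powr:
  fixes x M p :: real
  assumes "M > 0" "p \<ge> 1"
  shows "max 0 (\<bar>x\<bar> - M) \<le> M powr (1 - p) * \<bar>x\<bar> powr p"
proof (cases "\<bar>x\<bar> \<le> M")
  case False
  then have x: "\<bar>x\<bar> > 0" using assms by linarith
  have "\<bar>x\<bar> powr (1 - p) \<le> M powr (1 - p)"
    using False assms by (intro powr_mono2') auto
  then have "\<bar>x\<bar> powr (1 - p) * \<bar>x\<bar> powr p \<le> M powr (1 - p) * \<bar>x\<bar> powr p"
    by (intro mult_right_mono) auto
  then have "\<bar>x\<bar> \<le> M powr (1 - p) * \<bar>x\<bar> powr p"
    using x by (simp add: powr_add[symmetric])
  then show ?thesis using assms by auto
qed simp

lemma min_square_le_powr:
  fixes x M p :: real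
  assumes "M > 0" "0 \<le> p" "p \<le> 2"
  shows "(min \<bar>x\<bar> M)\<^sup>2 \<le> M powr (2 - p) * \<bar>x\<bar> powr p"
proof (cases "x = 0")
  case False
  define m where "m = min \<bar>x\<bar> M"
  have m: "m > 0" "m \<le> \<bar>x\<bar>" "m \<le> M" using False assms by (auto simp: m_def)
  have "m\<^sup>2 = m powr (2 - p) * m powr p"
    using m by (simp add: powr_add[symmetric])
  also have "\<dots> \<le> M powr (2 - p) * \<bar>x\<bar> powr p"
    using m assms by (intro mult_mono powr_mono2) auto
  finally show ?thesis by (simp add: m_def)
qed (use assms in simp)

definition cutoff :: "real \<Rightarrow> real \<Rightarrow> real" where
  "cutoff M x = max (- M) (min M x)"

lemma cutoff_simps:
  assumes "M \<ge> 0"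
  shows "\<bar>cutoff M x\<bar> \<le> M" "\<bar>cutoff M x\<bar> \<le> \<bar>x\<bar>" "\<bar>cutoff M x - cutoff M y\<bar> \<le> \<bar>x - y\<bar>"
    "\<bar>x - cutoff M x\<bar> = max 0 (\<bar>x\<bar> - M)" "cutoff M (- x) = - cutoff M x"
    "\<bar>cutoff M x\<bar> = min \<bar>x\<bar> M"
  using assms by (auto simp: cutoff_def)

locale iid_moment_expectation = iid_expectation +
  fixes \<gamma> :: real
  assumes \<gamma>: "\<gamma> > 1" and Lp: "xi k \<in> Lp_space \<gamma> E"
begin

text \<open>Some element of \<open>Cb\<close> is within distance \<open>1\<close> of the coordinate in \<open>L\<^sup>\<gamma>\<close>, uniformly over \<open>\<Theta>\<close>, and it
  is bounded.\<close>

lemma moment_bound: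
  "\<exists>C\<ge>0. \<forall>P\<in>\<Theta>. integrable P (\<lambda>w. \<bar>w k\<bar> powr \<gamma>) \<and> (\<integral>w. \<bar>w k\<bar> powr \<gamma> \<partial>P) \<le> C"
proof -
  obtain Y where Y: "\<And>n. Y n \<in> Cb"
    and lim: "(\<lambda>n. SUP P\<in>\<Theta>. \<integral>\<^sup>+w. ennreal (\<bar>xi k w - Y n w\<bar> powr \<gamma>) \<partial>P) \<longlonglongrightarrow> 0"
    using Lp[of k] unfolding Lp_space_def by blast
  have "\<forall>\<^sub>F n in sequentially. (SUP P\<in>\<Theta>. \<integral>\<^sup>+w. ennreal (\<bar>xi k w - Y n w\<bar> powr \<gamma>) \<partial>P) < 1"
    by (rule order_tendstoD[OF lim]) simp
  then obtain n where n: "(SUP P\<in>\<Theta>. \<integral>\<^sup>+w. ennreal (\<bar>xi k w - Y n w\<bar> powr \<gamma>) \<partial>P) < 1"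
    by (auto simp: eventually_sequentially)
  obtain c where c: "\<And>x. \<bar>Y n x\<bar> \<le> c" using CbD(2)[OF Y] by blast
  have c0: "c \<ge> 0" using c[of undefined] by simp
  define K where "K = 2 powr \<gamma> * (1 + c powr \<gamma>)"
  have K0: "K \<ge> 0" by (simp add: K_def)
  have pw: "\<bar>w k\<bar> powr \<gamma> \<le> 2 powr \<gamma> * (\<bar>xi k w - Y n w\<bar> powr \<gamma> + c powr \<gamma>)" for w
  proof -
    define a where "a = max \<bar>xi k w - Y n w\<bar> c"
    have "\<bar>w k\<bar> \<le> \<bar>xi k w - Y n w\<bar> + c" using c[of w] by (simp add: xi_def)
    also have "\<dots> \<le> 2 * a" by (auto simp: a_def max_def)
    finally have "\<bar>w k\<bar> \<le> 2 * a" .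
    then have "\<bar>w k\<bar> powr \<gamma> \<le> (2 * a) powr \<gamma>" using \<gamma> by (intro powr_mono2) auto
    also have "\<dots> = 2 powr \<gamma> * a powr \<gamma>" using c0 by (intro powr_mult)
    also have "a powr \<gamma> \<le> \<bar>xi k w - Y n w\<bar> powr \<gamma> + c powr \<gamma>" by (auto simp: a_def max_def)
    finally show ?thesis by (simp add: mult_left_mono)
  qed
  have "integrable P (\<lambda>w. \<bar>w k\<bar> powr \<gamma>) \<and> (\<integral>w. \<bar>w k\<bar> powr \<gamma> \<partial>P) \<le> K" if P: "P \<in> \<Theta>" for P
  proof -
    note Pp = \<Theta>_prob[OF P]
    interpret prob_space P using prob_measuresD[OF Pp] by simp
    have [measurable]: "Y n \<in> borel_measurable borel" by (rule CbD(1)[OF Y])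
    have m: "(\<lambda>w. \<bar>w k\<bar> powr \<gamma>) \<in> borel_measurable P"
      unfolding prob_measures_measurable[OF Pp] by measurable
    have m2: "(\<lambda>w. ennreal (\<bar>xi k w - Y n w\<bar> powr \<gamma>)) \<in> borel_measurable P"
      unfolding prob_measures_measurable[OF Pp] xi_def by measurable
    have "(\<integral>\<^sup>+w. ennreal (\<bar>w k\<bar> powr \<gamma>) \<partial>P) \<le>
        (\<integral>\<^sup>+w. ennreal (2 powr \<gamma>) * (ennreal (\<bar>xi k w - Y n w\<bar> powr \<gamma>) + ennreal (c powr \<gamma>)) \<partial>P)"
      using pw by (intro nn_integral_mono) (simp add: ennreal_plus[symmetric] ennreal_mult[symmetric] ennreal_leI del: ennreal_plus)
    also have "\<dots> = ennreal (2 powr \<gamma>) * ((\<integral>\<^sup>+w. ennreal (\<bar>xi k w - Y n w\<bar> powr \<gamma>) \<partial>P) + ennreal (c powr \<gamma>))"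
      using m2 by (simp add: nn_integral_cmult nn_integral_add emeasure_space_1)
    also have "\<dots> \<le> ennreal (2 powr \<gamma>) * (1 + ennreal (c powr \<gamma>))"
    proof (intro mult_left_mono add_mono)
      have "(\<integral>\<^sup>+w. ennreal (\<bar>xi k w - Y n w\<bar> powr \<gamma>) \<partial>P) \<le> (SUP P\<in>\<Theta>. \<integral>\<^sup>+w. ennreal (\<bar>xi k w - Y n w\<bar> powr \<gamma>) \<partial>P)"
        by (rule SUP_upper[OF P])
      then show "(\<integral>\<^sup>+w. ennreal (\<bar>xi k w - Y n w\<bar> powr \<gamma>) \<partial>P) \<le> 1" using n by simp
    qed auto
    also have "\<dots> = ennreal K"
      by (simp add: K_def ennreal_mult ennreal_plus)
    finally have le: "(\<integral>\<^sup>+w. ennreal (\<bar>w k\<bar> powr \<gamma>) \<partial>P) \<le> ennreal K" .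
    have int: "integrable P (\<lambda>w. \<bar>w k\<bar> powr \<gamma>)"
      using m le by (intro integrableI_bounded) (auto simp: top_unique less_top[symmetric] intro: le_less_trans)
    moreover have "(\<integral>w. \<bar>w k\<bar> powr \<gamma> \<partial>P) \<le> K"
      using le K0 by (subst (asm) nn_integral_eq_integral[OF int]) auto
    ultimately show ?thesis by blast
  qed
  then show ?thesis using K0 by blast
qed

lemma moment_bound_le:
  assumes p: "0 \<le> p" "p \<le> \<gamma>"
  shows "\<exists>C\<ge>0. \<forall>P\<in>\<Theta>. integrable P (\<lambda>w. \<bar>w k\<bar> powr p) \<and> (\<integral>w. \<bar>w k\<bar> powr p \<partial>P) \<le> C"
proof -
  obtain C where C: "C \<ge> 0" "\<And>P. P \<in> \<Theta> \<Longrightarrow> integrable P (\<lambda>w. \<bar>w k\<bar> powr \<gamma>)"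
    "\<And>P. P \<in> \<Theta> \<Longrightarrow> (\<integral>w. \<bar>w k\<bar> powr \<gamma> \<partial>P) \<le> C"
    using moment_bound[of k] by blast
  have pw: "\<bar>x\<bar> powr p \<le> 1 + \<bar>x\<bar> powr \<gamma>" for x :: real
  proof (cases "\<bar>x\<bar> \<le> 1")
    case True
    then have "\<bar>x\<bar> powr p \<le> 1" using p by (intro powr_le1) auto
    then show ?thesis by (smt (verit) powr_ge_zero)
  next
    case False
    then have "\<bar>x\<bar> powr p \<le> \<bar>x\<bar> powr \<gamma>" using p by (intro powr_mono) auto
    then show ?thesis by simp
  qed
  have "integrable P (\<lambda>w. \<bar>w k\<bar> powr p) \<and> (\<integral>w. \<bar>w k\<bar> powr p \<partial>P) \<le> 1 + C" if P: "P \<in> \<Theta>" for P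
  proof -
    interpret prob_space P using prob_measuresD[OF \<Theta>_prob[OF P]] by simp
    have m: "(\<lambda>w. \<bar>w k\<bar> powr p) \<in> borel_measurable P"
      unfolding prob_measures_measurable[OF \<Theta>_prob[OF P]] by measurable
    have i: "integrable P (\<lambda>w. 1 + \<bar>w k\<bar> powr \<gamma>)" using C(2)[OF P] by simp
    have ip: "integrable P (\<lambda>w. \<bar>w k\<bar> powr p)"
      by (rule Bochner_Integration.integrable_bound[OF i m]) (use pw in \<open>auto intro!: AE_I2 order_trans[OF pw]\<close>)
    have "(\<integral>w. \<bar>w k\<bar> powr p \<partial>P) \<le> (\<integral>w. 1 + \<bar>w k\<bar> powr \<gamma> \<partial>P)"
      by (rule integral_mono[OF ip i pw])
    also have "\<dots> = 1 + (\<integral>w. \<bar>w k\<bar> powr \<gamma> \<partial>P)" using C(2)[OF P] by (simp add: prob_space)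
    finally show ?thesis using ip C(3)[OF P] by linarith
  qed
  moreover have "1 + C \<ge> 0" using C(1) by simp
  ultimately show ?thesis by blast
qed

lemma integrable_abs_coordinate:
  assumes "P \<in> \<Theta>" shows "integrable P (\<lambda>w. \<bar>w k\<bar>)" "integrable P (\<lambda>w. w k)"
proof -
  have "integrable P (\<lambda>w. \<bar>w k\<bar> powr 1)" using moment_bound_le[of 1 k] \<gamma> assms by auto
  then show 1: "integrable P (\<lambda>w. \<bar>w k\<bar>)" by simp
  have "(\<lambda>w. w k) \<in> borel_measurable P"
    unfolding prob_measures_measurable[OF \<Theta>_prob[OF assms]] by measurable
  then show "integrable P (\<lambda>w. w k)"
    by (rule Bochner_Integration.integrable_bound[OF 1]) auto
qed

lemma integrable_past_times_coordinate:
  assumes P: "P \<in> \<Theta>" and h: "h \<in> past n" "\<And>w. \<bar>h w\<bar> \<le> B"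
    and \<psi>: "\<psi> \<in> borel_measurable borel" "\<And>x. \<bar>\<psi> x\<bar> \<le> a + L * \<bar>x\<bar>"
  shows "integrable P (\<lambda>w. h w * \<psi> (w k))"
proof -
  interpret prob_space P using prob_measuresD[OF \<Theta>_prob[OF P]] by simp
  have [measurable]: "h \<in> borel_measurable borel" "\<psi> \<in> borel_measurable borel"
    using \<psi> h by (auto intro: pastD)
  show ?thesis
  proof (rule Bochner_Integration.integrable_bound)
    show "integrable P (\<lambda>w. B * (a + L * \<bar>w k\<bar>))"
      using integrable_abs_coordinate[OF P] by simp
    show "(\<lambda>w. h w * \<psi> (w k)) \<in> borel_measurable P"
      unfolding prob_measures_measurable[OF \<Theta>_prob[OF P]] by measurable
    show "AE w in P. norm (h w * \<psi> (w k)) \<le> norm (B * (a + L * \<bar>w k\<bar>))"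
    proof (rule AE_I2)
      fix w
      have "\<bar>h w * \<psi> (w k)\<bar> \<le> B * (a + L * \<bar>w k\<bar>)"
        unfolding abs_mult using h(2)[of w] \<psi>(2)[of "w k"] by (intro mult_mono) auto
      then show "norm (h w * \<psi> (w k)) \<le> norm (B * (a + L * \<bar>w k\<bar>))" by auto
    qed
  qed
qed

text \<open>Uniform integrability of a coordinate over \<open>\<Theta>\<close>, with a rate.\<close>

lemma tail_bound:
  "\<exists>C\<ge>0. \<forall>P\<in>\<Theta>. \<forall>M>0. (\<integral>w. max 0 (\<bar>w k\<bar> - M) \<partial>P) \<le> C * M powr (1 - \<gamma>)"
proof -
  obtain C where C: "C \<ge> 0" "\<And>P. P \<in> \<Theta> \<Longrightarrow> integrable P (\<lambda>w. \<bar>w k\<bar> powr \<gamma>)"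
    "\<And>P. P \<in> \<Theta> \<Longrightarrow> (\<integral>w. \<bar>w k\<bar> powr \<gamma> \<partial>P) \<le> C"
    using moment_bound[of k] by blast
  have "(\<integral>w. max 0 (\<bar>w k\<bar> - M) \<partial>P) \<le> C * M powr (1 - \<gamma>)" if P: "P \<in> \<Theta>" and M: "M > 0" for P M
  proof -
    interpret prob_space P using prob_measuresD[OF \<Theta>_prob[OF P]] by simp
    have "(\<integral>w. max 0 (\<bar>w k\<bar> - M) \<partial>P) \<le> (\<integral>w. M powr (1 - \<gamma>) * \<bar>w k\<bar> powr \<gamma> \<partial>P)"
    proof (rule integral_mono)
      show "integrable P (\<lambda>w. max 0 (\<bar>w k\<bar> - M))"
        using integrable_abs_coordinate[OF P] by simp
    qed (use excess_le_powr[OF M] \<gamma> C(2)[OF P] in auto)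
    also have "\<dots> = M powr (1 - \<gamma>) * (\<integral>w. \<bar>w k\<bar> powr \<gamma> \<partial>P)" by simp
    also have "\<dots> \<le> M powr (1 - \<gamma>) * C" using C(3)[OF P] by (intro mult_left_mono) auto
    finally show ?thesis by (simp add: mult.commute)
  qed
  then show ?thesis using C(1) by blast
qed

lemma tail_rate: "(\<lambda>n. real n powr (1 - \<gamma>)) \<longlonglongrightarrow> 0" "(\<lambda>n. real (Suc n) powr (1 - \<gamma>)) \<longlonglongrightarrow> 0"
  using \<gamma> by (auto intro!: tendsto_neg_powr filterlim_real_sequentially
      filterlim_compose[OF filterlim_real_sequentially filterlim_Suc] simp del: of_nat_Suc)

text \<open>The bound on conditional expectations for unbounded \<open>\<psi>\<close>. A Lipschitz function grows at most linearly,
  so cutting it off changes its upper expectation by an amount that \<open>tail_bound\<close> controls.\<close>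

lemma conditional_mean_le:
  assumes P: "P \<in> \<Theta>" and k: "k \<ge> 1" and h: "h \<in> past k" "\<And>w. h w \<in> {0..B}"
    and \<psi>: "L \<ge> 0" "\<And>x y. \<bar>\<psi> x - \<psi> y\<bar> \<le> L * \<bar>x - y\<bar>"
    and c: "\<And>Q. Q \<in> \<Theta> \<Longrightarrow> (\<integral>w. \<psi> (w 0) \<partial>Q) \<le> c"
  shows "(\<integral>w. h w * \<psi> (w k) \<partial>P) \<le> c * (\<integral>w. h w \<partial>P)"
proof -
  interpret prob_space P using prob_measuresD[OF \<Theta>_prob[OF P]] by simp
  have B: "B \<ge> 0" using h(2)[of undefined] by simp
  have hB: "\<bar>h w\<bar> \<le> B" for w using h(2)[of w] by auto
  define a where "a = \<bar>\<psi> 0\<bar>"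
  have grow: "\<bar>\<psi> x\<bar> \<le> a + (L + 1) * \<bar>x\<bar>" for x
  proof -
    have "\<bar>\<psi> x\<bar> \<le> a + L * \<bar>x\<bar>" using \<psi>(2)[of x 0] by (simp add: a_def)
    then show ?thesis using \<psi>(1) by (simp add: algebra_simps) 
  qed
  have \<psi>m [measurable]: "\<psi> \<in> borel_measurable borel"
    using \<psi> by (intro borel_measurable_continuous_onI lipschitz_on_continuous_on[of L] lipschitz_onI)
      (auto simp: dist_real_def)
  have hm [measurable]: "h \<in> borel_measurable borel" by (rule pastD(1)[OF h(1)])
  obtain C where C: "C \<ge> 0" "\<And>Q M. Q \<in> \<Theta> \<Longrightarrow> M > 0 \<Longrightarrow> (\<integral>w. max 0 (\<bar>w 0\<bar> - M) \<partial>Q) \<le> C * M powr (1 - \<gamma>)"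
    using tail_bound[of 0] by blast
  define \<psi>' where "\<psi>' n x = cutoff (a + (L + 1) * real (Suc n)) (\<psi> x)" for n x
  have M0: "a + (L + 1) * real (Suc n) \<ge> 0" for n using \<psi>(1) by (auto simp: a_def intro!: add_nonneg_nonneg mult_nonneg_nonneg)
  have bL: "\<psi>' n \<in> bLip" for n
  proof (rule bLipI[OF _ \<psi>(1)])
    show "\<bar>\<psi>' n x\<bar> \<le> a + (L + 1) * real (Suc n)" for x unfolding \<psi>'_def by (rule cutoff_simps(1)[OF M0])
    show "\<bar>\<psi>' n x - \<psi>' n y\<bar> \<le> L * \<bar>x - y\<bar>" for x y
      unfolding \<psi>'_def by (rule order_trans[OF cutoff_simps(3)[OF M0] \<psi>(2)])
  qed
  have \<psi>'m [measurable]: "\<psi>' n \<in> borel_measurable borel" for n unfolding \<psi>'_def cutoff_def by measurable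
  have diff: "\<psi>' n x \<le> \<psi> x + (L + 1) * max 0 (\<bar>x\<bar> - real (Suc n))" for n x
  proof -
    have "\<psi>' n x - \<psi> x \<le> max 0 (\<bar>\<psi> x\<bar> - (a + (L + 1) * real (Suc n)))"
      using cutoff_simps(4)[OF M0, of "\<psi> x" n] by (simp add: \<psi>'_def)
    also have "\<dots> \<le> max 0 ((L + 1) * (\<bar>x\<bar> - real (Suc n)))"
      using grow[of x] by (auto simp: algebra_simps)
    also have "\<dots> = (L + 1) * max 0 (\<bar>x\<bar> - real (Suc n))"
      using \<psi>(1) by (simp add: max_def mult_le_0_iff zero_le_mult_iff)
    finally show ?thesis by linarith
  qed
  define \<tau> where "\<tau> n = (L + 1) * (C * real (Suc n) powr (1 - \<gamma>))" for n
  have mean: "upper_exp (\<psi>' n) \<le> c + \<tau> n" for n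
    unfolding upper_exp_def
  proof (rule E_least[OF coordinate_Cb[OF bL]])
    fix Q assume "Q \<in> \<Theta>\<^sub>0"
    then have Q: "Q \<in> \<Theta>" by (rule \<Theta>\<^sub>0_subset)
    have one: "(\<lambda>_. 1) \<in> past 0" by (rule cyl_Lip_past[OF cyl_Lip_const])
    have i: "integrable Q (\<lambda>w. \<psi> (w 0))"
      using integrable_past_times_coordinate[OF Q one, of 1 \<psi> a "L + 1" 0] grow by simp
    have "(\<integral>w. \<psi>' n (w 0) \<partial>Q) \<le> (\<integral>w. \<psi> (w 0) + (L + 1) * max 0 (\<bar>w 0\<bar> - real (Suc n)) \<partial>Q)"
    proof (rule integral_mono[OF _ _ diff])
      interpret Q: prob_space Q using prob_measuresD[OF \<Theta>_prob[OF Q]] by simp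
      show "integrable Q (\<lambda>w. \<psi>' n (w 0))" by (rule integrable_Cb[OF \<Theta>_prob[OF Q] coordinate_Cb[OF bL]])
      show "integrable Q (\<lambda>w. \<psi> (w 0) + (L + 1) * max 0 (\<bar>w 0\<bar> - real (Suc n)))"
        using i integrable_abs_coordinate[OF Q] by simp
    qed
    also have "\<dots> = (\<integral>w. \<psi> (w 0) \<partial>Q) + (L + 1) * (\<integral>w. max 0 (\<bar>w 0\<bar> - real (Suc n)) \<partial>Q)"
    proof -
      interpret Q: prob_space Q using prob_measuresD[OF \<Theta>_prob[OF Q]] by simp
      show ?thesis using i integrable_abs_coordinate[OF Q] by simp
    qed
    also have "\<dots> \<le> c + \<tau> n"
      unfolding \<tau>_def using c[OF Q] C(2)[OF Q, of "real (Suc n)"] \<psi>(1) by (intro add_mono mult_left_mono) auto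
    finally show "(\<integral>w. \<psi>' n (w 0) \<partial>Q) \<le> c + \<tau> n" .
  qed
  have h0: "(\<integral>w. h w \<partial>P) \<ge> 0" using h(2) by (intro integral_nonneg_AE) auto
  have le: "(\<integral>w. h w * \<psi>' n (w k) \<partial>P) \<le> (c + \<tau> n) * (\<integral>w. h w \<partial>P)" for n
    using conditional_mean_le_bounded[OF P k h bL, of n] mult_right_mono[OF mean h0, of n] by linarith
  have "\<tau> \<longlonglongrightarrow> (L + 1) * (C * 0)" unfolding \<tau>_def by (intro tendsto_intros tail_rate)
  then have lim2: "(\<lambda>n. (c + \<tau> n) * (\<integral>w. h w \<partial>P)) \<longlonglongrightarrow> (c + 0) * (\<integral>w. h w \<partial>P)"
    by (intro tendsto_intros) simp
  have lim1: "(\<lambda>n. \<integral>w. h w * \<psi>' n (w k) \<partial>P) \<longlonglongrightarrow> (\<integral>w. h w * \<psi> (w k) \<partial>P)"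
  proof (rule integral_dominated_convergence[where w="\<lambda>w. B * (a + (L + 1) * \<bar>w k\<bar>)"])
    show "(\<lambda>w. h w * \<psi> (w k)) \<in> borel_measurable P" "(\<lambda>w. h w * \<psi>' n (w k)) \<in> borel_measurable P" for n
      unfolding prob_measures_measurable[OF \<Theta>_prob[OF P]] by measurable
    show "integrable P (\<lambda>w. B * (a + (L + 1) * \<bar>w k\<bar>))"
      using integrable_abs_coordinate[OF P] by simp
    show "AE w in P. (\<lambda>n. h w * \<psi>' n (w k)) \<longlonglongrightarrow> h w * \<psi> (w k)"
    proof (rule AE_I2)
      fix w :: seqspace
      obtain N where N: "\<bar>w k\<bar> \<le> real N" using real_arch_simple by blast
      have "\<psi>' n (w k) = \<psi> (w k)" if "n \<ge> N" for n
      proof -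
        have "(L + 1) * \<bar>w k\<bar> \<le> (L + 1) * real (Suc n)"
          using N that \<psi>(1) by (intro mult_left_mono) auto
        then have "\<bar>\<psi> (w k)\<bar> \<le> a + (L + 1) * real (Suc n)" using grow[of "w k"] by linarith
        then show ?thesis by (auto simp: \<psi>'_def cutoff_def)
      qed
      then have "\<forall>\<^sub>F n in sequentially. h w * \<psi>' n (w k) = h w * \<psi> (w k)"
        unfolding eventually_sequentially by auto
      then show "(\<lambda>n. h w * \<psi>' n (w k)) \<longlonglongrightarrow> h w * \<psi> (w k)" by (rule tendsto_eventually)
    qed
    show "AE w in P. norm (h w * \<psi>' n (w k)) \<le> B * (a + (L + 1) * \<bar>w k\<bar>)" for n
    proof (rule AE_I2)
      fix w :: seqspace
      have "\<bar>\<psi>' n (w k)\<bar> \<le> a + (L + 1) * \<bar>w k\<bar>"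
        unfolding \<psi>'_def by (rule order_trans[OF cutoff_simps(2)[OF M0] grow])
      then show "norm (h w * \<psi>' n (w k)) \<le> B * (a + (L + 1) * \<bar>w k\<bar>)"
        using hB[of w] B by (auto simp: abs_mult intro!: mult_mono)
    qed
  qed
  show ?thesis using LIMSEQ_le[OF lim1 lim2] le by auto
qed

lemma upper_mean_ge: "P \<in> \<Theta> \<Longrightarrow> (\<integral>w. w 0 \<partial>P) \<le> upper_mean E"
  and lower_mean_le: "P \<in> \<Theta> \<Longrightarrow> lower_mean E \<le> (\<integral>w. w 0 \<partial>P)"
proof -
  obtain C where C: "\<And>P. P \<in> \<Theta> \<Longrightarrow> (\<integral>w. \<bar>w 0\<bar> powr 1 \<partial>P) \<le> C"
    using moment_bound_le[of 1 0] \<gamma> by auto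
  have b: "\<bar>\<integral>w. w 0 \<partial>P\<bar> \<le> C" if "P \<in> \<Theta>" for P
    using C[OF that] by (intro order_trans[OF integral_abs_bound]) simp
  assume P: "P \<in> \<Theta>"
  have "bdd_above ((\<lambda>P. \<integral>w. xi 0 w \<partial>P) ` \<Theta>)"
    using b unfolding xi_def by (intro bdd_aboveI2[of _ _ C]) (meson abs_le_D1)
  then show "(\<integral>w. w 0 \<partial>P) \<le> upper_mean E"
    unfolding upper_mean_def ext_expectation_def using cSUP_upper[OF P] by (fastforce simp: xi_def)
  have "bdd_above ((\<lambda>P. \<integral>w. - xi 0 w \<partial>P) ` \<Theta>)"
    using b unfolding xi_def by (intro bdd_aboveI2[of _ _ C]) (auto dest: abs_le_D2)
  then have "(\<integral>w. - xi 0 w \<partial>P) \<le> ext_expectation E (\<lambda>w. - xi 0 w)"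
    unfolding ext_expectation_def using cSUP_upper[OF P] by fastforce
  then show "lower_mean E \<le> (\<integral>w. w 0 \<partial>P)"
    unfolding lower_mean_def by (simp add: xi_def)
qed

end

section \<open>An exposed marginal\<close>

lemma prob_measures_distr_trunc:
  assumes "P \<in> prob_measures" shows "distr P borel (trunc d) \<in> prob_measures"
proof -
  interpret prob_space P using prob_measuresD[OF assms] by simp
  have "trunc d \<in> P \<rightarrow>\<^sub>M borel" by (simp add: prob_measures_measurable[OF assms])
  then show ?thesis by (auto simp: prob_measures_def intro: prob_space_distr)
qed

lemma integral_past_distr:
  assumes "P \<in> prob_measures" "h \<in> past d"
  shows "integral\<^sup>L P h = integral\<^sup>L (distr P borel (trunc d)) h"
proof -
  have "trunc d \<in> P \<rightarrow>\<^sub>M borel" by (simp add: prob_measures_measurable[OF assms(1)])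
  then have "integral\<^sup>L (distr P borel (trunc d)) h = (\<integral>w. h (trunc d w) \<partial>P)"
    by (rule integral_distr) (rule pastD(1)[OF assms(2)])
  also have "(\<lambda>w. h (trunc d w)) = h" using assms(2) by (auto simp: past_def)
  finally show ?thesis by simp
qed

text \<open>The law of the first \<open>d\<close> coordinates is determined by countably many functions, which are normalized
  so that they can be summed with geometric weights: distances to the complements of the sets of a
  countable base closed under finite intersections, capped at \<open>1 / (m + 1)\<close>. Multiplied by \<open>m + 1\<close>
  they increase to the indicator function of the set, up to the factor \<open>1 / 2\<close> that makes the Lipschitz
  constant \<open>1\<close>.\<close>

lemma countable_determining_family:
  obtains f :: "nat \<Rightarrow> seqspace \<Rightarrow> real" where
    "\<And>i x. \<bar>f i x\<bar> \<le> 1" "\<And>i x y. \<bar>f i x - f i y\<bar> \<le> (\<Sum>j<d. \<bar>x j - y j\<bar>)"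
    "\<And>P Q h. P \<in> prob_measures \<Longrightarrow> Q \<in> prob_measures \<Longrightarrow> (\<And>i. integral\<^sup>L P (f i) = integral\<^sup>L Q (f i)) \<Longrightarrow>
      h \<in> past d \<Longrightarrow> integral\<^sup>L P h = integral\<^sup>L Q h"
proof -
  obtain B :: "seqspace set set" where B: "countable B" "topological_basis B"
    using ex_countable_basis by blast
  define G where "G = Inter ` {F. finite F \<and> F \<subseteq> B}"
  have G: "countable G" unfolding G_def by (intro countable_image countable_Collect_finite_subset B)
  have Gopen: "open U" if "U \<in> G" for U
  proof -
    from \<open>U \<in> G\<close> obtain F where F: "finite F" "F \<subseteq> B" "U = \<Inter>F" unfolding G_def by blast
    have "open V" if "V \<in> F" for V using that F(2) topological_basis_open[OF B(2)] by blast
    then show ?thesis unfolding F(3) by (intro open_Inter F(1)) auto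
  qed
  have GU: "UNIV \<in> G" unfolding G_def by (rule image_eqI[of _ _ "{}"]) auto
  have Gint: "Int_stable G"
  proof (rule Int_stableI)
    fix a b assume "a \<in> G" "b \<in> G"
    then obtain F F' where "finite F" "F \<subseteq> B" "finite F'" "F' \<subseteq> B" "a = \<Inter>F" "b = \<Inter>F'" by (auto simp: G_def)
    then show "a \<inter> b \<in> G" unfolding G_def by (intro image_eqI[of _ _ "F \<union> F'"]) auto
  qed
  have sG: "sigma_sets UNIV G = sets borel"
  proof
    show "sigma_sets UNIV G \<subseteq> sets borel"
      using Gopen by (intro sets.sigma_sets_subset'[of G borel UNIV]) auto
    have "B \<subseteq> G"
    proof
      fix b assume "b \<in> B" then show "b \<in> G" unfolding G_def by (intro image_eqI[of _ _ "{b}"]) auto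
    qed
    have "sets (borel :: seqspace measure) = sets (sigma UNIV B)"
      by (subst borel_eq_countable_basis[OF B]) (rule refl)
    also have "\<dots> = sigma_sets UNIV B" by (rule sets_measure_of) simp
    also have "\<dots> \<subseteq> sigma_sets UNIV G" by (rule sigma_sets_mono') fact
    finally show "sets borel \<subseteq> sigma_sets UNIV G" .
  qed
  define e where "e = from_nat_into G"
  have e: "e i \<in> G" for i unfolding e_def using GU by (intro from_nat_into) auto
  have e_surj: "\<exists>i. e i = U" if "U \<in> G" for U
    unfolding e_def using from_nat_into_surj[OF G that] by blast
  define g where "g U m w = min (1 / real (Suc m)) (infdist (trunc d w) (- U)) / 2" for U m w
  define f where "f i = g (e (fst (prod_decode i))) (snd (prod_decode i))" for i
  have g1: "\<bar>g U m x\<bar> \<le> 1" for U m x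
  proof -
    have "1 / real (Suc m) \<le> 1" by simp
    then have "min (1 / real (Suc m)) (infdist (trunc d x) (- U)) \<le> 1" by (rule min.coboundedI1)
    then show ?thesis using infdist_nonneg[of "trunc d x" "- U"] by (simp add: g_def)
  qed
  have gL: "\<bar>g U m x - g U m y\<bar> \<le> (\<Sum>j<d. \<bar>x j - y j\<bar>)" for U m x y
  proof -
    have half: "\<bar>min c s / 2 - min c t / 2\<bar> \<le> \<bar>s - t\<bar> / 2" for c s t :: real
      by (auto simp: min_def abs_if)
    have "\<bar>infdist (trunc d x) (- U) - infdist (trunc d y) (- U)\<bar> / 2 \<le> (\<Sum>j<d. \<bar>x j - y j\<bar>)"
      using order_trans[OF infdist_triangle_abs[of _ "- U"] dist_trunc_le[of d x y]] by (simp add: mult.commute)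
    then show ?thesis unfolding g_def by (rule order_trans[OF half])
  qed
  have gC: "g U m \<in> Cb" for U m
    by (rule cyl_Lip_Cb[of _ d], rule cyl_LipI[of _ 1 1]) (use g1 gL in auto)
  show thesis
  proof
    show "\<bar>f i x\<bar> \<le> 1" for i x unfolding f_def by (rule g1)
    show "\<bar>f i x - f i y\<bar> \<le> (\<Sum>j<d. \<bar>x j - y j\<bar>)" for i x y unfolding f_def by (rule gL)
    fix P Q h assume PQ: "P \<in> prob_measures" "Q \<in> prob_measures"
      and eq: "\<And>i. integral\<^sup>L P (f i) = integral\<^sup>L Q (f i)" and h: "h \<in> past d"
    have geq: "integral\<^sup>L P (g U m) = integral\<^sup>L Q (g U m)" if "U \<in> G" for U m
    proof -
      from e_surj[OF that] obtain i where "e i = U" by blast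
      then show ?thesis using eq[of "prod_encode (i, m)"] by (simp add: f_def)
    qed
    have lim: "(\<lambda>m. 2 * real (Suc m) * integral\<^sup>L R (g U m)) \<longlonglongrightarrow> measure (distr R borel (trunc d)) U"
      if R: "R \<in> prob_measures" and U: "open U" "U \<noteq> UNIV" for R U
    proof -
      interpret R: prob_space R using prob_measuresD[OF R] by simp
      have tm: "trunc d \<in> R \<rightarrow>\<^sub>M borel" by (simp add: prob_measures_measurable[OF R])
      have "(\<lambda>m. \<integral>w. 2 * real (Suc m) * g U m w \<partial>R) \<longlonglongrightarrow> (\<integral>w. indicat_real U (trunc d w) \<partial>R)"
      proof (rule integral_dominated_convergence[where w="\<lambda>_. 1"])
        show "(\<lambda>w. 2 * real (Suc m) * g U m w) \<in> borel_measurable R" for m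
          using CbD(1)[OF gC, of U m] by (simp add: prob_measures_measurable[OF R])
        show "(\<lambda>w. indicat_real U (trunc d w)) \<in> borel_measurable R"
        proof -
          have "U \<in> sets borel" using U(1) by simp
          then show ?thesis unfolding prob_measures_measurable[OF R] by measurable
        qed
        have bd: "2 * real (Suc m) * g U m w = min 1 (real (Suc m) * infdist (trunc d w) (- U))" for m w
        proof -
          have scale: "2 * c * (min (1 / c) t / 2) = min 1 (c * t)" if "c > 0" for c t :: real
            using that by (auto simp: min_def field_simps)
          show ?thesis unfolding g_def by (rule scale) simp
        qed
        show "AE w in R. norm (2 * real (Suc m) * g U m w) \<le> 1" for m
          unfolding bd using infdist_nonneg[of _ "- U"] by (auto simp: min_def)
        show "AE w in R. (\<lambda>m. 2 * real (Suc m) * g U m w) \<longlonglongrightarrow> indicat_real U (trunc d w)"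
        proof (rule AE_I2)
          fix w
          show "(\<lambda>m. 2 * real (Suc m) * g U m w) \<longlonglongrightarrow> indicat_real U (trunc d w)"
          proof (cases "trunc d w \<in> U")
            case False
            then show ?thesis unfolding bd by simp
          next
            case True
            have "closed (- U)" "- U \<noteq> {}" using U by auto
            then have pos: "infdist (trunc d w) (- U) > 0"
              using True infdist_pos_not_in_closed[of "- U" "trunc d w"] by auto
            then obtain N where N: "1 < real N * infdist (trunc d w) (- U)" by (meson reals_Archimedean3)
            have "2 * real (Suc m) * g U m w = 1" if "m \<ge> N" for m
            proof -
              have "real N * infdist (trunc d w) (- U) \<le> real (Suc m) * infdist (trunc d w) (- U)"
                using that pos by (intro mult_right_mono) auto
              with N show ?thesis unfolding bd by simp
            qed
            then have "\<forall>\<^sub>F m in sequentially. 2 * real (Suc m) * g U m w = 1"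
              unfolding eventually_sequentially by auto
            then show ?thesis using True by (simp add: tendsto_eventually)
          qed
        qed
      qed simp
      moreover have "(\<integral>w. indicat_real U (trunc d w) \<partial>R) = measure (distr R borel (trunc d)) U"
        using U(1) tm by (subst integral_distr[symmetric, of "trunc d" R borel "indicat_real U"]) auto
      ultimately show ?thesis by simp
    qed
    let ?P = "distr P borel (trunc d)" and ?Q = "distr Q borel (trunc d)"
    interpret P: prob_space ?P using prob_measuresD(1)[OF prob_measures_distr_trunc[OF PQ(1)]] .
    interpret Q: prob_space ?Q using prob_measuresD(1)[OF prob_measures_distr_trunc[OF PQ(2)]] .
    have "?P = ?Q"
    proof (rule measure_eqI_generator_eq[OF Gint, of UNIV _ _ "\<lambda>_. UNIV"])
      show "emeasure ?P U = emeasure ?Q U" if U: "U \<in> G" for U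
      proof (cases "U = UNIV")
        case True
        then show ?thesis using P.emeasure_space_1 Q.emeasure_space_1 by simp
      next
        case False
        have "measure ?P U = measure ?Q U"
          using lim[OF PQ(1) Gopen[OF U] False] lim[OF PQ(2) Gopen[OF U] False]
          unfolding geq[OF U] by (rule LIMSEQ_unique)
        then show ?thesis by (simp add: P.emeasure_eq_measure Q.emeasure_eq_measure)
      qed
    qed (use GU in \<open>auto simp: sG P.emeasure_eq_measure\<close>)
    then show "integral\<^sup>L P h = integral\<^sup>L Q h"
      using integral_past_distr[OF PQ(1) h] integral_past_distr[OF PQ(2) h] by simp
  qed
qed

lemma geometric_weights:
  fixes b :: "nat \<Rightarrow> real"
  assumes b: "\<And>i. \<bar>b i\<bar> \<le> c"
  shows "summable (\<lambda>i. (1/2)^i * b i)" and "\<bar>\<Sum>i. (1/2)^i * b i\<bar> \<le> 2 * c"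
proof -
  have sg: "summable (\<lambda>i. (1/2::real)^i * c)" by (intro summable_mult2 summable_geometric) simp
  have le: "\<bar>(1/2)^i * b i\<bar> \<le> (1/2)^i * c" for i
    using b[of i] by (auto simp: abs_mult intro: mult_left_mono)
  have sa: "summable (\<lambda>i. \<bar>(1/2)^i * b i\<bar>)"
    by (rule summable_comparison_test'[OF sg, of 0]) (use le in simp)
  then show "summable (\<lambda>i. (1/2)^i * b i)" by (rule summable_rabs_cancel)
  have "\<bar>\<Sum>i. (1/2)^i * b i\<bar> \<le> (\<Sum>i. \<bar>(1/2)^i * b i\<bar>)" by (rule summable_rabs[OF sa])
  also have "\<dots> \<le> (\<Sum>i. (1/2)^i * c)" by (rule suminf_le[OF le sa sg])
  also have "\<dots> = 2 * c"
    by (subst suminf_mult2[symmetric]) (simp_all add: suminf_geometric summable_geometric)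
  finally show "\<bar>\<Sum>i. (1/2)^i * b i\<bar> \<le> 2 * c" .
qed

context weakly_compact_expectation
begin

text \<open>The integrals of a determining family embed the laws of the first \<open>d\<close> coordinates affinely into a
  Hilbert space of weighted square summable sequences. A point \<open>P\<close> of a compact subset that is
  farthest from the origin is exposed by the linear functional given by the inner product with \<open>P\<close>:
  if \<open>\<parallel>Q\<parallel> \<le> \<parallel>P\<parallel>\<close> then \<open>2 \<langle>P, Q\<rangle> = \<parallel>P\<parallel>\<^sup>2 + \<parallel>Q\<parallel>\<^sup>2 - \<parallel>P - Q\<parallel>\<^sup>2 \<le> 2 \<parallel>P\<parallel>\<^sup>2\<close>, with equality only for \<open>Q = P\<close>. This
  functional is integration of the function \<open>f\<close>.\<close>

lemma exposed_marginal:
  obtains f P where "f \<in> cyl_Lip d" "P \<in> \<Theta>\<^sub>0" "integral\<^sup>L P f = E f"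
    "\<And>Q h. Q \<in> \<Theta>\<^sub>0 \<Longrightarrow> integral\<^sup>L Q f = E f \<Longrightarrow> h \<in> past d \<Longrightarrow> integral\<^sup>L Q h = integral\<^sup>L P h"
proof (rule countable_determining_family[of d])
  fix f :: "nat \<Rightarrow> seqspace \<Rightarrow> real"
  assume f1: "\<And>i x. \<bar>f i x\<bar> \<le> 1" and fL: "\<And>i x y. \<bar>f i x - f i y\<bar> \<le> (\<Sum>j<d. \<bar>x j - y j\<bar>)"
    and fdet: "\<And>P Q h. P \<in> prob_measures \<Longrightarrow> Q \<in> prob_measures \<Longrightarrow> (\<And>i. integral\<^sup>L P (f i) = integral\<^sup>L Q (f i)) \<Longrightarrow>
      h \<in> past d \<Longrightarrow> integral\<^sup>L P h = integral\<^sup>L Q h"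
  have fC: "f i \<in> Cb" for i
    by (rule cyl_Lip_Cb[of _ d], rule cyl_LipI[of _ 1 1]) (use f1 fL in auto)
  define a where "a P i = integral\<^sup>L P (f i)" for P i
  have a1: "\<bar>a P i\<bar> \<le> 1" if "P \<in> prob_measures" for P i
  proof -
    have "integral\<^sup>L P (f i) \<le> 1" using f1 by (intro integral_le_bound[OF that fC]) (meson abs_le_D1)
    moreover have "- integral\<^sup>L P (f i) \<le> 1"
    proof -
      have "(\<lambda>x. - f i x) \<in> Cb"
        by (rule cyl_Lip_Cb[of _ d], rule cyl_LipI[of _ 1 1]) (use f1 fL in \<open>auto simp: abs_minus_commute\<close>)
      moreover have "- f i x \<le> 1" for x using f1[of i x] by linarith
      ultimately have "(\<integral>x. - f i x \<partial>P) \<le> 1" by (rule integral_le_bound[OF that])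
      then show ?thesis by simp
    qed
    ultimately show ?thesis by (simp add: a_def)
  qed
  have sg: "summable (\<lambda>i. (1/2::real)^i)" by (rule summable_geometric) simp
  have a2: "\<bar>a P i * a Q i\<bar> \<le> 1" if "P \<in> prob_measures" "Q \<in> prob_measures" for P Q i
    using a1[OF that(1), of i] a1[OF that(2), of i] by (simp add: abs_mult mult_le_one)
  define ip where "ip P Q = (\<Sum>i. (1/2)^i * (a P i * a Q i))" for P Q
  have sip: "summable (\<lambda>i. (1/2)^i * (a P i * a Q i))" if "P \<in> prob_measures" "Q \<in> prob_measures" for P Q
    by (rule geometric_weights[OF a2[OF that]])
  have ip2: "ip P P \<le> 2" if P: "P \<in> prob_measures" for P
    using geometric_weights(2)[of "\<lambda>i. a P i * a P i", OF a2[OF P P]] unfolding ip_def by simp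
  \<comment> \<open>A farthest point exists by compactness.\<close>
  define S where "S = (SUP P\<in>\<Theta>\<^sub>0. ip P P)"
  have bdd: "bdd_above ((\<lambda>P. ip P P) ` \<Theta>\<^sub>0)" using ip2 \<Theta>\<^sub>0_prob by (intro bdd_aboveI2[of _ _ 2]) auto
  have "\<exists>P\<in>\<Theta>\<^sub>0. S - 1 / real (Suc n) < ip P P" for n
  proof -
    have "S - 1 / real (Suc n) < S" by simp
    then show ?thesis unfolding S_def using less_cSUP_iff[OF nonempty bdd] by blast
  qed
  then obtain Pn where Pn: "\<And>n. Pn n \<in> \<Theta>\<^sub>0" "\<And>n. S - 1 / real (Suc n) < ip (Pn n) (Pn n)" by metis
  obtain P r where P: "P \<in> \<Theta>\<^sub>0" "strict_mono r"
    "\<And>i. (\<lambda>n. integral\<^sup>L (Pn (r n)) (f i)) \<longlonglongrightarrow> integral\<^sup>L P (f i)"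
    by (rule weak_subsequence[where Pn = Pn and X = f, OF compact Pn(1) fC], rule that)
  note Pp = \<Theta>\<^sub>0_prob[OF P(1)]
  have lim: "(\<lambda>n. ip (Pn (r n)) (Pn (r n))) \<longlonglongrightarrow> ip P P"
    unfolding ip_def
  proof (rule conjunct2[OF conjunct2[OF tannerys_theorem[of _ _ sequentially "\<lambda>i. (1/2)^i"]]])
    show "((\<lambda>n. (1/2)^i * (a (Pn (r n)) i * a (Pn (r n)) i)) \<longlongrightarrow> (1/2)^i * (a P i * a P i)) sequentially" for i
      unfolding a_def by (intro tendsto_intros P(3))
    show "\<forall>\<^sub>F (i, n) in at_top \<times>\<^sub>F sequentially. norm ((1/2)^i * (a (Pn (r n)) i * a (Pn (r n)) i)) \<le> (1/2)^i"
    proof (intro always_eventually allI, clarify)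
      fix i n
      show "norm ((1/2)^i * (a (Pn (r n)) i * a (Pn (r n)) i)) \<le> (1/2)^i"
        using a2[OF \<Theta>\<^sub>0_prob[OF Pn(1)] \<Theta>\<^sub>0_prob[OF Pn(1)], of "r n" i "r n"]
        by (simp add: abs_mult mult_left_le)
    qed
  qed (use sg in auto)
  have SP: "S \<le> ip P P"
  proof -
    have "(\<lambda>n. S - 1 / real (Suc n)) \<longlonglongrightarrow> S - 0"
      using LIMSEQ_inverse_real_of_nat by (intro tendsto_intros) (simp add: inverse_eq_divide)
    from LIMSEQ_subseq_LIMSEQ[OF this P(2)]
    have "(\<lambda>n. S - 1 / real (Suc (r n))) \<longlonglongrightarrow> S - 0" by (simp add: o_def)
    from LIMSEQ_le[OF this lim] have "S - 0 \<le> ip P P" using less_imp_le[OF Pn(2)] by blast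
    then show ?thesis by simp
  qed
  have max: "ip Q Q \<le> ip P P" if "Q \<in> \<Theta>\<^sub>0" for Q
    using cSUP_upper[OF that bdd] SP by (simp add: S_def)
  \<comment> \<open>Integration of \<open>F\<close> is the inner product with \<open>P\<close>.\<close>
  define F where "F x = (\<Sum>i. (1/2)^i * (a P i * f i x))" for x
  have af: "\<bar>a P i * f i x\<bar> \<le> 1" for i x
    using a1[OF Pp, of i] f1[of i x] by (simp add: abs_mult mult_le_one)
  have sF: "summable (\<lambda>i. (1/2)^i * (a P i * f i x))" for x by (rule geometric_weights[OF af])
  have F: "F \<in> cyl_Lip d"
  proof (rule cyl_LipI[of _ 2 2])
    show "\<bar>F x\<bar> \<le> 2" for x
      using geometric_weights(2)[of "\<lambda>i. a P i * f i x", OF af] unfolding F_def by simp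
    show "\<bar>F x - F y\<bar> \<le> 2 * (\<Sum>j<d. \<bar>x j - y j\<bar>)" for x y
    proof -
      let ?S = "\<Sum>j<d. \<bar>x j - y j\<bar>"
      have b: "\<bar>a P i * f i x - a P i * f i y\<bar> \<le> ?S" for i
      proof -
        have "\<bar>a P i * f i x - a P i * f i y\<bar> = \<bar>a P i\<bar> * \<bar>f i x - f i y\<bar>"
          by (simp add: abs_mult[symmetric] algebra_simps)
        also have "\<dots> \<le> 1 * ?S" by (intro mult_mono a1[OF Pp] fL) auto
        finally show ?thesis by simp
      qed
      have "F x - F y = (\<Sum>i. (1/2)^i * (a P i * f i x - a P i * f i y))"
        unfolding F_def using suminf_diff[OF sF sF, of x y] by (simp add: right_diff_distrib)
      also have "\<bar>\<dots>\<bar> \<le> 2 * ?S" by (rule geometric_weights(2)[OF b])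
      finally show ?thesis .
    qed
  qed simp
  have FQ: "integral\<^sup>L Q F = ip P Q" if Q: "Q \<in> prob_measures" for Q
  proof -
    interpret Q: prob_space Q using prob_measuresD[OF Q] by simp
    have i: "integrable Q (\<lambda>x. (1/2)^i * (a P i * f i x))" for i
      using integrable_Cb[OF Q fC] by simp
    have "integral\<^sup>L Q F = (\<Sum>i. \<integral>x. (1/2)^i * (a P i * f i x) \<partial>Q)"
      unfolding F_def
    proof (rule integral_suminf[OF i])
      have sa: "summable (\<lambda>i. (1/2)^i * \<bar>a P i * f i x\<bar>)" for x by (rule geometric_weights) (use af in simp)
      then show "AE x in Q. summable (\<lambda>i. norm ((1/2)^i * (a P i * f i x)))" by (simp add: abs_mult)
      show "summable (\<lambda>i. \<integral>x. norm ((1/2)^i * (a P i * f i x)) \<partial>Q)"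
      proof (rule summable_comparison_test'[OF sg, of 0])
        fix i
        have "(\<integral>x. norm ((1/2)^i * (a P i * f i x)) \<partial>Q) \<le> (\<integral>x. (1/2)^i \<partial>Q)"
          using i af by (intro integral_mono) (auto simp: abs_mult intro: mult_left_le)
        then show "norm (\<integral>x. norm ((1/2)^i * (a P i * f i x)) \<partial>Q) \<le> (1/2)^i" by (simp add: Q.prob_space)
      qed
    qed
    also have "\<dots> = ip P Q" by (simp add: ip_def a_def)
    finally show ?thesis .
  qed
  have sq: "(\<lambda>i. (1/2)^i * (a P i - a Q i)\<^sup>2) sums (ip P P + ip Q Q - 2 * ip P Q)" if Q: "Q \<in> prob_measures" for Q
  proof -
    have "(\<lambda>i. (1/2)^i * (a P i * a P i) + (1/2)^i * (a Q i * a Q i) - 2 * ((1/2)^i * (a P i * a Q i)))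
        sums (ip P P + ip Q Q - 2 * ip P Q)"
      unfolding ip_def by (intro sums_diff sums_add sums_mult summable_sums sip Pp Q)
    then show ?thesis by (simp add: power2_eq_square algebra_simps)
  qed
  have EF: "E F = ip P P"
  proof (rule antisym)
    show "E F \<le> ip P P"
    proof (rule E_least[OF cyl_Lip_Cb[OF F]])
      fix Q assume Q: "Q \<in> \<Theta>\<^sub>0"
      have "0 \<le> ip P P + ip Q Q - 2 * ip P Q"
        by (rule sums_le[OF _ sums_zero sq[OF \<Theta>\<^sub>0_prob[OF Q]]]) simp
      then show "integral\<^sup>L Q F \<le> ip P P" using max[OF Q] FQ[OF \<Theta>\<^sub>0_prob[OF Q]] by simp
    qed
    show "ip P P \<le> E F"
      using \<Theta>_le[OF \<Theta>\<^sub>0_subset[OF P(1)] cyl_Lip_Cb[OF F]] FQ[OF Pp] by simp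
  qed
  show thesis
  proof (rule that[OF F P(1)])
    show "integral\<^sup>L P F = E F" using EF FQ[OF Pp] by simp
    fix Q h assume Q: "Q \<in> \<Theta>\<^sub>0" "integral\<^sup>L Q F = E F" and h: "h \<in> past d"
    note Qp = \<Theta>\<^sub>0_prob[OF Q(1)]
    have "ip P P + ip Q Q - 2 * ip P Q \<le> 0" using Q EF FQ[OF Qp] max[OF Q(1)] by simp
    moreover have "0 \<le> ip P P + ip Q Q - 2 * ip P Q"
      by (rule sums_le[OF _ sums_zero sq[OF Qp]]) simp
    ultimately have "(\<Sum>i. (1/2)^i * (a P i - a Q i)\<^sup>2) = 0"
      using sums_unique[OF sq[OF Qp]] by linarith
    then have "\<forall>i. (1/2)^i * (a P i - a Q i)\<^sup>2 = 0"
      by (subst (asm) suminf_eq_zero_iff[OF sums_summable[OF sq[OF Qp]]]) simp_all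
    then have "a Q i = a P i" for i by simp
    then show "integral\<^sup>L Q h = integral\<^sup>L P h"
      unfolding a_def by (intro fdet[OF Qp Pp _ h])
  qed
qed

end

section \<open>A measure with prescribed conditional means\<close>

context iid_expectation
begin

text \<open>Given the past, \<open>s k * \<psi> (w k)\<close> has conditional expectation at most the function integrated on the right
  of the last equation. Independence, used from the last coordinate backwards, shows that adding
  these differences to \<open>f\<close> does not change its upper expectation. At a maximizer of the sum every
  summand therefore has its largest possible expectation.\<close>

lemma conditional_sup_attained:
  assumes d: "d \<ge> 1" and f: "f \<in> cyl_Lip d" and s: "\<And>k. s k \<in> cyl_Lip d" and \<psi>: "\<psi> \<in> bLip"
  obtains P where "P \<in> \<Theta>\<^sub>0" "integral\<^sup>L P f = E f"
    "\<And>k. d \<le> k \<Longrightarrow> k < K \<Longrightarrow> (\<integral>w. s k w * \<psi> (w k) \<partial>P) =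
      (\<integral>w. scaled_exp \<psi> (s k w) \<partial>P)"
proof -
  define H where "H k w = scaled_exp \<psi> (s k w)" for k w
  define G where "G k w = s k w * \<psi> (w k)" for k w
  define F where "F K w = f w + (\<Sum>k\<in>{d..<K}. G k w - H k w)" for K w
  have H: "H k \<in> cyl_Lip d" for k
    unfolding H_def by (intro cyl_Lip_add cyl_Lip_mult cyl_Lip_const cyl_Lip_posneg s)
  have mH: "(\<lambda>w. - H k w) \<in> cyl_Lip d" for k by (rule cyl_Lip_posneg(3)[OF H])
  have G: "G k \<in> cyl_Lip n" if "d \<le> k" "k < n" for k n
    unfolding G_def using that by (intro cyl_Lip_mult cyl_Lip_coordinate[OF \<psi>] cyl_Lip_mono[OF _ s]) auto
  have F: "F n \<in> cyl_Lip n" if "d \<le> n" for n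
    unfolding F_def
  proof (intro cyl_Lip_add cyl_Lip_sum cyl_Lip_mono[OF that f])
    fix k assume k: "k \<in> {d..<n}"
    have "(\<lambda>w. G k w + - H k w) \<in> cyl_Lip n"
      using k by (intro cyl_Lip_add G cyl_Lip_mono[OF that mH]) auto
    then show "(\<lambda>w. G k w - H k w) \<in> cyl_Lip n" by simp
  qed
  have E_step: "E (\<lambda>w. A w + (G k w - H k w)) = E A" if "d \<le> k" "A \<in> cyl_Lip k" for A k
  proof -
    have "(\<lambda>w. A w + - H k w) \<in> cyl_Lip k"
      by (intro cyl_Lip_add that cyl_Lip_mono[OF _ mH])
    from independence[OF _ this cyl_Lip_mono[OF that(1) s[of k]] \<psi>] d that(1)
    have "E (\<lambda>w. (A w + - H k w) + s k w * \<psi> (w k)) = E (\<lambda>w. (A w + - H k w) + H k w)"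
      unfolding H_def by simp
    moreover have "(\<lambda>w. (A w + - H k w) + s k w * \<psi> (w k)) = (\<lambda>w. A w + (G k w - H k w))"
      by (auto simp: G_def)
    ultimately show ?thesis by simp
  qed
  have EF: "E (F n) = E f" if "d \<le> n" for n
    using that
  proof (induction n rule: dec_induct)
    case base then show ?case by (simp add: F_def)
  next
    case (step n)
    have "F (Suc n) = (\<lambda>w. F n w + (G n w - H n w))"
      using step(1) by (auto simp: F_def)
    then show ?case using E_step[OF step(1) F[OF step(1)]] step(3) by simp
  qed
  define n where "n = max d K"
  have dn: "d \<le> n" by (simp add: n_def)
  obtain P where P: "P \<in> \<Theta>\<^sub>0" "integral\<^sup>L P (F n) = E (F n)"
    by (rule E_attained[OF cyl_Lip_Cb[OF F[OF dn]]])
  have P\<Theta>: "P \<in> \<Theta>" by (rule \<Theta>\<^sub>0_subset[OF P(1)])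
  note int = integrable_Cb[OF \<Theta>_prob[OF P\<Theta>] cyl_Lip_Cb]
  have if': "integrable P f" by (rule int[OF f])
  have iGH: "integrable P (\<lambda>w. G k w - H k w)" if "d \<le> k" for k
    using int[OF G[OF that, of "Suc k"]] int[OF H[of k]] by auto
  have le0: "(\<integral>w. G k w - H k w \<partial>P) \<le> 0" if "d \<le> k" for k
  proof -
    have "(\<lambda>w. 0 + (G k w + - H k w)) \<in> cyl_Lip (Suc k)"
      using that by (intro cyl_Lip_add cyl_Lip_const G cyl_Lip_mono[OF _ mH]) auto
    then have "(\<integral>w. 0 + (G k w - H k w) \<partial>P) \<le> E (\<lambda>w. 0 + (G k w - H k w))"
      by (intro \<Theta>_le[OF P\<Theta>] cyl_Lip_Cb[of _ "Suc k"]) simp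
    also have "\<dots> = 0" using E_step[OF that cyl_Lip_const[of 0]] by (simp add: E_const)
    finally show ?thesis by simp
  qed
  have fle: "integral\<^sup>L P f \<le> E f" by (rule \<Theta>_le[OF P\<Theta> cyl_Lip_Cb[OF f]])
  have sum: "integral\<^sup>L P f + (\<Sum>k\<in>{d..<n}. \<integral>w. G k w - H k w \<partial>P) = E f"
  proof -
    have "integral\<^sup>L P (F n) = integral\<^sup>L P f + (\<Sum>k\<in>{d..<n}. \<integral>w. G k w - H k w \<partial>P)"
    proof -
      have "integral\<^sup>L P (F n) = integral\<^sup>L P f + (\<integral>w. (\<Sum>k\<in>{d..<n}. G k w - H k w) \<partial>P)"
        unfolding F_def by (intro Bochner_Integration.integral_add if' Bochner_Integration.integrable_sum iGH) auto
      also have "(\<integral>w. (\<Sum>k\<in>{d..<n}. G k w - H k w) \<partial>P) = (\<Sum>k\<in>{d..<n}. \<integral>w. G k w - H k w \<partial>P)"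
        by (intro Bochner_Integration.integral_sum iGH) auto
      finally show ?thesis .
    qed
    then show ?thesis using P(2) EF[OF dn] by simp
  qed
  have sle: "(\<Sum>k\<in>{d..<n}. \<integral>w. G k w - H k w \<partial>P) \<le> 0" by (rule sum_nonpos) (use le0 in auto)
  show thesis
  proof
    show "P \<in> \<Theta>\<^sub>0" by fact
    show "integral\<^sup>L P f = E f" using sum sle fle by linarith
    fix k assume k: "d \<le> k" "k < K"
    have "(\<Sum>k\<in>{d..<n}. - (\<integral>w. G k w - H k w \<partial>P)) = 0"
      unfolding sum_negf using sum sle fle by linarith
    then have "\<forall>k\<in>{d..<n}. - (\<integral>w. G k w - H k w \<partial>P) = 0"
      by (subst (asm) sum_nonneg_eq_0_iff) (use le0 in auto)
    then have "(\<integral>w. G k w - H k w \<partial>P) = 0" using k by (simp add: n_def)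
    then have "integral\<^sup>L P (G k) = integral\<^sup>L P (H k)"
      using int[OF G[OF k(1), of "Suc k"]] int[OF H[of k]] by simp
    then show "(\<integral>w. s k w * \<psi> (w k) \<partial>P) = (\<integral>w. scaled_exp \<psi> (s k w) \<partial>P)"
      by (simp add: G_def[abs_def] H_def[abs_def])
  qed
qed

end

context iid_moment_expectation
begin

lemma cutoff_bLip: "M \<ge> 0 \<Longrightarrow> cutoff M \<in> bLip"
  by (rule bLipI[of _ M 1]) (use cutoff_simps in auto)

lemma upper_exp_cutoff_ge:
  obtains \<tau> where "\<tau> \<longlonglongrightarrow> 0" "\<And>n. \<tau> n \<ge> 0" "\<And>n. upper_mean E - \<tau> n \<le> upper_exp (cutoff (real (Suc n)))"
    "\<And>n. - lower_mean E - \<tau> n \<le> upper_exp (\<lambda>x. - cutoff (real (Suc n)) x)"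
proof -
  obtain C where C: "C \<ge> 0" "\<And>Q M. Q \<in> \<Theta> \<Longrightarrow> M > 0 \<Longrightarrow> (\<integral>w. max 0 (\<bar>w 0\<bar> - M) \<partial>Q) \<le> C * M powr (1 - \<gamma>)"
    using tail_bound[of 0] by blast
  define \<tau> where "\<tau> n = C * real (Suc n) powr (1 - \<gamma>)" for n
  have "\<tau> \<longlonglongrightarrow> C * 0" unfolding \<tau>_def by (intro tendsto_intros tail_rate)
  then have \<tau>0: "\<tau> \<longlonglongrightarrow> 0" by simp
  have close: "\<bar>(\<integral>w. w 0 \<partial>P) - (\<integral>w. cutoff (real (Suc n)) (w 0) \<partial>P)\<bar> \<le> \<tau> n" if P: "P \<in> \<Theta>" for P n
  proof -
    have i: "integrable P (\<lambda>w. w 0)" "integrable P (\<lambda>w. cutoff (real (Suc n)) (w 0))"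
      using integrable_abs_coordinate[OF P] integrable_Cb[OF \<Theta>_prob[OF P] coordinate_Cb[OF cutoff_bLip]] by auto
    have "\<bar>(\<integral>w. w 0 \<partial>P) - (\<integral>w. cutoff (real (Suc n)) (w 0) \<partial>P)\<bar> = \<bar>\<integral>w. w 0 - cutoff (real (Suc n)) (w 0) \<partial>P\<bar>"
      using i by simp
    also have "\<dots> \<le> (\<integral>w. \<bar>w 0 - cutoff (real (Suc n)) (w 0)\<bar> \<partial>P)" by (rule integral_abs_bound)
    also have "\<dots> = (\<integral>w. max 0 (\<bar>w 0\<bar> - real (Suc n)) \<partial>P)" by (simp add: cutoff_simps)
    also have "\<dots> \<le> \<tau> n" unfolding \<tau>_def by (rule C(2)[OF P]) simp
    finally show ?thesis .
  qed
  show thesis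
  proof (rule that[OF \<tau>0])
    show "\<tau> n \<ge> 0" for n using C(1) by (simp add: \<tau>_def)
    fix n
    have "upper_mean E \<le> upper_exp (cutoff (real (Suc n))) + \<tau> n"
      unfolding upper_mean_def ext_expectation_def xi_def
    proof (rule cSUP_least[OF \<Theta>_nonempty])
      fix P assume P: "P \<in> \<Theta>"
      show "(\<integral>w. w 0 \<partial>P) \<le> upper_exp (cutoff (real (Suc n))) + \<tau> n"
        using close[OF P, of n] le_upper_exp[OF cutoff_bLip P, of "real (Suc n)" 0] by auto
    qed
    then show "upper_mean E - \<tau> n \<le> upper_exp (cutoff (real (Suc n)))" by simp
    have "ext_expectation E (\<lambda>w. - xi 0 w) \<le> upper_exp (\<lambda>x. - cutoff (real (Suc n)) x) + \<tau> n"
      unfolding ext_expectation_def xi_def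
    proof (rule cSUP_least[OF \<Theta>_nonempty])
      fix P assume P: "P \<in> \<Theta>"
      show "(\<integral>w. - w 0 \<partial>P) \<le> upper_exp (\<lambda>x. - cutoff (real (Suc n)) x) + \<tau> n"
        using close[OF P, of n] le_upper_exp[OF bLip_uminus[OF cutoff_bLip] P, of "real (Suc n)" 0] by auto
    qed
    then show "- lower_mean E - \<tau> n \<le> upper_exp (\<lambda>x. - cutoff (real (Suc n)) x)" by (simp add: lower_mean_def)
  qed
qed

text \<open>The maximum of \<open>s * m\<close> over the means \<open>m\<close> between the lower and the upper mean.\<close>

definition drift :: "real \<Rightarrow> real" where
  "drift s = max 0 s * upper_mean E + max 0 (- s) * (- lower_mean E)"

lemma drift_Lipschitz:
  "\<bar>drift s - drift t\<bar> \<le> (\<bar>upper_mean E\<bar> + \<bar>lower_mean E\<bar>) * \<bar>s - t\<bar>"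
proof -
  have "drift s - drift t = (max 0 s - max 0 t) * upper_mean E + (max 0 (- s) - max 0 (- t)) * (- lower_mean E)"
    by (simp add: drift_def algebra_simps)
  also have "\<bar>\<dots>\<bar> \<le> \<bar>max 0 s - max 0 t\<bar> * \<bar>upper_mean E\<bar> + \<bar>max 0 (- s) - max 0 (- t)\<bar> * \<bar>lower_mean E\<bar>"
    by (rule order_trans[OF abs_triangle_ineq]) (simp add: abs_mult)
  also have "\<dots> \<le> \<bar>s - t\<bar> * \<bar>upper_mean E\<bar> + \<bar>s - t\<bar> * \<bar>lower_mean E\<bar>"
    by (intro add_mono mult_right_mono) auto
  finally show ?thesis by (simp add: algebra_simps)
qed

lemma drift_measurable [measurable]: "drift \<in> borel_measurable borel"
  unfolding drift_def[abs_def] by measurable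

text \<open>For Lipschitz \<open>s k\<close> and cut-off coordinates \<open>conditional_sup_attained\<close> gives the equality. Here \<open>P\<close> is a
  weak limit of the measures \<open>Pn n\<close> obtained for Lipschitz approximants \<open>g n k\<close> of \<open>s k\<close> and cut-offs at
  level \<open>n + 1\<close>. All \<open>Pn n\<close> and \<open>P\<close> have the law of \<open>P0\<close> on the first \<open>d\<close> coordinates, so that the
  approximation errors obey the same bounds under each of them.\<close>

lemma extremal_drift:
  assumes d: "d \<ge> 1" and s: "\<And>k. s k \<in> past d" and s1: "\<And>k w. s k w \<in> {-1..1}"
  obtains P where "P \<in> \<Theta>\<^sub>0" "\<And>k. d \<le> k \<Longrightarrow> (\<integral>w. drift (s k w) \<partial>P) \<le> (\<integral>w. s k w * w k \<partial>P)"
proof -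
  have [measurable]: "s k \<in> borel_measurable borel" for k by (rule pastD(1)[OF s])
  obtain f P0 where f: "f \<in> cyl_Lip d" and P0: "P0 \<in> \<Theta>\<^sub>0" "integral\<^sup>L P0 f = E f"
    and marg: "\<And>Q h. Q \<in> \<Theta>\<^sub>0 \<Longrightarrow> integral\<^sup>L Q f = E f \<Longrightarrow> h \<in> past d \<Longrightarrow> integral\<^sup>L Q h = integral\<^sup>L P0 h"
    by (rule exposed_marginal[of d], rule that)
  have "\<exists>g. g \<in> cyl_Lip d \<and> (\<forall>x. g x \<in> {-1..1}) \<and> (\<integral>x. \<bar>s k x - g x\<bar> \<partial>P0) < 1 / real (Suc n)" for k n
  proof -
    have e: "1 / real (Suc n) > 0" by simp
    show ?thesis by (rule cyl_Lip_dense[OF \<Theta>\<^sub>0_prob[OF P0(1)] s s1 e]) blast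
  qed
  then have "\<forall>p. \<exists>g. g \<in> cyl_Lip d \<and> (\<forall>x. g x \<in> {-1..1}) \<and> (\<integral>x. \<bar>s (snd p) x - g x\<bar> \<partial>P0) < 1 / real (Suc (fst p))"
    by blast
  from choice[OF this] obtain g' where g': "\<And>p. g' p \<in> cyl_Lip d \<and> (\<forall>x. g' p x \<in> {-1..1}) \<and>
      (\<integral>x. \<bar>s (snd p) x - g' p x\<bar> \<partial>P0) < 1 / real (Suc (fst p))" by blast
  define g where "g n k = g' (n, k)" for n k
  have g: "g n k \<in> cyl_Lip d" "g n k x \<in> {-1..1}" "(\<integral>x. \<bar>s k x - g n k x\<bar> \<partial>P0) < 1 / real (Suc n)" for n k x
    using g'[of "(n, k)"] by (auto simp: g_def)
  have [measurable]: "g n k \<in> borel_measurable borel" for n k by (rule cyl_Lip_measurable[OF g(1)])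
  have gk1: "\<bar>g n k x\<bar> \<le> 1" for n k x using g(2)[of n k x] by auto
  have "\<exists>P. P \<in> \<Theta>\<^sub>0 \<and> integral\<^sup>L P f = E f \<and> (\<forall>k. d \<le> k \<longrightarrow> k < n \<longrightarrow>
      (\<integral>w. g n k w * cutoff (real (Suc n)) (w k) \<partial>P) =
      (\<integral>w. scaled_exp (cutoff (real (Suc n))) (g n k w) \<partial>P))"
    (is "\<exists>P. ?good n P") for n
  proof -
    have c: "cutoff (real (Suc n)) \<in> bLip" by (rule cutoff_bLip) simp
    show ?thesis by (rule conditional_sup_attained[where s = "g n" and K = n, OF d f g(1) c]) blast
  qed
  then have "\<forall>n. \<exists>P. ?good n P" by blast
  from choice[OF this] obtain Pn where good: "\<And>n. ?good n (Pn n)" by blast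
  have Pn: "Pn n \<in> \<Theta>\<^sub>0" "integral\<^sup>L (Pn n) f = E f" for n using good[of n] by auto
  have att: "(\<integral>w. g n k w * cutoff (real (Suc n)) (w k) \<partial>Pn n) =
      (\<integral>w. scaled_exp (cutoff (real (Suc n))) (g n k w) \<partial>Pn n)"
    if "d \<le> k" "k < n" for n k
    using good[of n] that by blast
  define X where "X m k w = g m k w * cutoff (real (Suc m)) (w k)" for m k w
  have X: "X m k \<in> Cb" for m k
    unfolding X_def
    by (rule cyl_Lip_Cb[of _ "max d (Suc k)"])
      (intro cyl_Lip_mult cyl_Lip_coordinate cutoff_bLip cyl_Lip_mono[OF _ g(1)]; simp)
  define W where "W i = (case i of 0 \<Rightarrow> f | Suc j \<Rightarrow> X (fst (prod_decode j)) (snd (prod_decode j)))" for i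
  have W: "W i \<in> Cb" for i
    unfolding W_def using X cyl_Lip_Cb[OF f] by (cases i) auto
  obtain P r where P: "P \<in> \<Theta>\<^sub>0" and r: "strict_mono r"
    and lim: "\<And>i. (\<lambda>n. integral\<^sup>L (Pn (r n)) (W i)) \<longlonglongrightarrow> integral\<^sup>L P (W i)"
    by (rule weak_subsequence[where Pn = Pn and X = W, OF compact Pn(1) W], rule that)
  have limX: "(\<lambda>n. integral\<^sup>L (Pn (r n)) (X m k)) \<longlonglongrightarrow> integral\<^sup>L P (X m k)" for m k
    using lim[of "Suc (prod_encode (m, k))"] by (simp add: W_def)
  have Pf: "integral\<^sup>L P f = E f"
    using lim[of 0] by (simp add: W_def Pn(2) LIMSEQ_const_iff)
  show thesis
  proof (rule that[OF P])
    fix k assume k: "d \<le> k"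
    obtain c where c: "c \<ge> 0" "\<And>Q. Q \<in> \<Theta> \<Longrightarrow> (\<integral>w. \<bar>w 0\<bar> \<partial>Q) \<le> c"
    proof -
      obtain c where "c \<ge> 0" "\<forall>Q\<in>\<Theta>. integrable Q (\<lambda>w. \<bar>w 0\<bar> powr 1) \<and> (\<integral>w. \<bar>w 0\<bar> powr 1 \<partial>Q) \<le> c"
        using moment_bound_le[of 1 0] \<gamma> by auto
      then show thesis using that by simp
    qed
    obtain C where C: "C \<ge> 0" "\<And>Q M. Q \<in> \<Theta> \<Longrightarrow> M > 0 \<Longrightarrow> (\<integral>w. max 0 (\<bar>w k\<bar> - M) \<partial>Q) \<le> C * M powr (1 - \<gamma>)"
      using tail_bound[of k] by blast
    \<comment> \<open>A bound for the \<open>L\<^sup>1\<close> distance of \<open>s k w * w k\<close> and \<open>X m k\<close> under every maximizer of \<open>f\<close>.\<close>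
    define \<delta> where "\<delta> m = c * (1 / real (Suc m)) + C * real (Suc m) powr (1 - \<gamma>)" for m
    have inv0: "(\<lambda>m. 1 / real (Suc m)) \<longlonglongrightarrow> 0"
      using LIMSEQ_inverse_real_of_nat by (simp add: inverse_eq_divide)
    have \<delta>0: "\<delta> \<longlonglongrightarrow> 0"
    proof -
      have "\<delta> \<longlonglongrightarrow> c * 0 + C * 0" unfolding \<delta>_def by (intro tendsto_intros inv0 tail_rate)
      then show ?thesis by simp
    qed
    have sxi: "integrable Q (\<lambda>w. s k w * w k)" if Q: "Q \<in> \<Theta>" for Q
      using integrable_past_times_coordinate[OF Q s, of k 1 "\<lambda>x. x" 0 1 k] s1 by (auto simp: abs_le_iff)
    have approx: "\<bar>(\<integral>w. s k w * w k \<partial>Q) - integral\<^sup>L Q (X m k)\<bar> \<le> \<delta> m"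
      if Q0: "Q \<in> \<Theta>\<^sub>0" and Qf: "integral\<^sup>L Q f = E f" for Q m
    proof -
      note Q = \<Theta>\<^sub>0_subset[OF Q0]
      note Qp = \<Theta>_prob[OF Q]
      define h where "h w = \<bar>s k w - g m k w\<bar>" for w
      have hp: "h \<in> past d"
        unfolding h_def[abs_def] by (intro past_compose[OF past_diff] s cyl_Lip_past g) auto
      have h2: "h w \<in> {0..2}" for w using s1[of k w] g(2)[of m k w] by (auto simp: h_def)
      have ih: "integrable Q (\<lambda>w. h w * \<bar>w k\<bar>)"
      proof (rule integrable_past_times_coordinate[OF Q hp, of 2 _ 0 1])
        show "\<bar>h w\<bar> \<le> 2" for w using h2[of w] by auto
      qed auto
      have it: "integrable Q (\<lambda>w. max 0 (\<bar>w k\<bar> - real (Suc m)))"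
      proof -
        interpret Q: prob_space Q using prob_measuresD[OF Qp] by simp
        show ?thesis using integrable_abs_coordinate[OF Q] by simp
      qed
      have "\<bar>(\<integral>w. s k w * w k \<partial>Q) - integral\<^sup>L Q (X m k)\<bar> = \<bar>\<integral>w. s k w * w k - X m k w \<partial>Q\<bar>"
        using sxi[OF Q] integrable_Cb[OF Qp X] by simp
      also have "\<dots> \<le> (\<integral>w. \<bar>s k w * w k - X m k w\<bar> \<partial>Q)" by (rule integral_abs_bound)
      also have "\<dots> \<le> (\<integral>w. h w * \<bar>w k\<bar> + max 0 (\<bar>w k\<bar> - real (Suc m)) \<partial>Q)"
      proof (rule integral_mono)
        fix w :: seqspace
        have "s k w * w k - X m k w = (s k w - g m k w) * w k + g m k w * (w k - cutoff (real (Suc m)) (w k))"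
          by (simp add: X_def algebra_simps)
        also have "\<bar>\<dots>\<bar> \<le> h w * \<bar>w k\<bar> + \<bar>g m k w\<bar> * \<bar>w k - cutoff (real (Suc m)) (w k)\<bar>"
          unfolding h_def by (rule order_trans[OF abs_triangle_ineq]) (simp add: abs_mult)
        also have "\<dots> \<le> h w * \<bar>w k\<bar> + 1 * \<bar>w k - cutoff (real (Suc m)) (w k)\<bar>"
          by (intro add_left_mono mult_right_mono gk1) auto
        also have "\<dots> = h w * \<bar>w k\<bar> + max 0 (\<bar>w k\<bar> - real (Suc m))"
          using cutoff_simps(4)[of "real (Suc m)" "w k"] by simp
        finally show "\<bar>s k w * w k - X m k w\<bar> \<le> h w * \<bar>w k\<bar> + max 0 (\<bar>w k\<bar> - real (Suc m))" .
      qed (use ih it sxi[OF Q] integrable_Cb[OF Qp X] in auto)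
      also have "\<dots> = (\<integral>w. h w * \<bar>w k\<bar> \<partial>Q) + (\<integral>w. max 0 (\<bar>w k\<bar> - real (Suc m)) \<partial>Q)"
        using ih it by (rule Bochner_Integration.integral_add)
      also have "\<dots> \<le> \<delta> m"
        unfolding \<delta>_def
      proof (rule add_mono)
        have "(\<integral>w. h w * \<bar>w k\<bar> \<partial>Q) \<le> c * integral\<^sup>L Q h"
          by (rule conditional_mean_le[OF Q _ past_mono[OF k hp] h2, of 1]) (use d k c in auto)
        also have "\<dots> \<le> c * (1 / real (Suc m))"
          using marg[OF Q0 Qf hp] less_imp_le[OF g(3)[of k m]] c(1) by (intro mult_left_mono) (auto simp: h_def[abs_def])
        finally show "(\<integral>w. h w * \<bar>w k\<bar> \<partial>Q) \<le> c * (1 / real (Suc m))" .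
        show "(\<integral>w. max 0 (\<bar>w k\<bar> - real (Suc m)) \<partial>Q) \<le> C * real (Suc m) powr (1 - \<gamma>)"
          by (rule C(2)[OF Q]) simp
      qed
      finally show ?thesis .
    qed
    define c' where "c' = \<bar>upper_mean E\<bar> + \<bar>lower_mean E\<bar>"
    have c'0: "c' \<ge> 0" by (simp add: c'_def)
    have drift_bd: "\<bar>drift u\<bar> \<le> c'" if "\<bar>u\<bar> \<le> 1" for u
    proof -
      have "\<bar>drift u - drift 0\<bar> \<le> c' * \<bar>u - 0\<bar>" unfolding c'_def by (rule drift_Lipschitz)
      also have "\<dots> \<le> c' * 1" using that c'0 by (intro mult_left_mono) auto
      finally show ?thesis by (simp add: drift_def)
    qed
    define I where "I = (\<integral>w. drift (s k w) \<partial>P0)"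
    have marg_drift: "(\<integral>w. drift (s k w) \<partial>Q) = I" if "Q \<in> \<Theta>\<^sub>0" "integral\<^sup>L Q f = E f" for Q
      unfolding I_def by (rule marg[OF that past_compose[OF s drift_measurable]])
    obtain \<tau> where \<tau>: "\<tau> \<longlonglongrightarrow> 0" "\<And>n. \<tau> n \<ge> 0" "\<And>n. upper_mean E - \<tau> n \<le> upper_exp (cutoff (real (Suc n)))"
      "\<And>n. - lower_mean E - \<tau> n \<le> upper_exp (\<lambda>x. - cutoff (real (Suc n)) x)"
      by (rule upper_exp_cutoff_ge, rule that)
    have lower: "I - c' * (1 / real (Suc n)) - \<tau> n \<le> integral\<^sup>L (Pn n) (X n k)" if n: "k < n" for n
    proof -
      note Qp = \<Theta>\<^sub>0_prob[OF Pn(1)[of n]]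
      interpret Q: prob_space "Pn n" using prob_measuresD[OF Qp] by simp
      let ?H = "\<lambda>w. scaled_exp (cutoff (real (Suc n))) (g n k w)"
      have hp: "(\<lambda>w. \<bar>s k w - g n k w\<bar>) \<in> past d"
        by (intro past_compose[OF past_diff] s cyl_Lip_past g) auto
      have i1: "integrable (Pn n) (\<lambda>w. drift (s k w))"
        by (rule integrable_bounded[OF Qp, of _ c']) (use s1 drift_bd in \<open>auto simp: abs_le_iff\<close>)
      have i2: "integrable (Pn n) (\<lambda>w. \<bar>s k w - g n k w\<bar>)"
      proof (rule integrable_bounded[OF Qp, of _ 2])
        show "\<bar>\<bar>s k w - g n k w\<bar>\<bar> \<le> 2" for w using s1[of k w] g(2)[of n k w] by auto
      qed measurable
      have i3: "integrable (Pn n) ?H"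
        by (rule integrable_Cb[OF Qp cyl_Lip_Cb[of _ d]])
          (intro cyl_Lip_add cyl_Lip_mult cyl_Lip_const cyl_Lip_posneg g)
      have "I - c' * (1 / real (Suc n)) - \<tau> n \<le> (\<integral>w. drift (s k w) - c' * \<bar>s k w - g n k w\<bar> - \<tau> n \<partial>Pn n)"
      proof -
        have "(\<integral>w. drift (s k w) - c' * \<bar>s k w - g n k w\<bar> - \<tau> n \<partial>Pn n) =
            I - c' * (\<integral>w. \<bar>s k w - g n k w\<bar> \<partial>P0) - \<tau> n"
          using i1 i2 marg_drift[OF Pn(1,2)] marg[OF Pn(1,2) hp] by (simp add: Q.prob_space)
        moreover have "c' * (\<integral>w. \<bar>s k w - g n k w\<bar> \<partial>P0) \<le> c' * (1 / real (Suc n))"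
          using g(3)[of k n] c'0 by (intro mult_left_mono) auto
        ultimately show ?thesis by linarith
      qed
      also have "\<dots> \<le> integral\<^sup>L (Pn n) ?H"
      proof (rule integral_mono[OF _ i3])
        show "integrable (Pn n) (\<lambda>w. drift (s k w) - c' * \<bar>s k w - g n k w\<bar> - \<tau> n)"
          using i1 i2 by simp
        fix w
        let ?u = "g n k w"
        have "drift (s k w) - drift ?u \<le> c' * \<bar>s k w - ?u\<bar>"
          using drift_Lipschitz[of "s k w" ?u] unfolding c'_def by linarith
        moreover have "drift ?u - \<tau> n \<le> ?H w"
        proof -
          have "max 0 ?u * (upper_mean E - \<tau> n) + max 0 (- ?u) * (- lower_mean E - \<tau> n) \<le> ?H w"
            using \<tau>(3,4)[of n] by (intro add_mono mult_left_mono) auto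
          moreover have "max 0 ?u * (upper_mean E - \<tau> n) + max 0 (- ?u) * (- lower_mean E - \<tau> n) = drift ?u - \<bar>?u\<bar> * \<tau> n"
            by (auto simp: drift_def max_def algebra_simps)
          moreover have "\<bar>?u\<bar> * \<tau> n \<le> 1 * \<tau> n" using gk1 \<tau>(2) by (intro mult_right_mono) auto
          ultimately show ?thesis by linarith
        qed
        ultimately show "drift (s k w) - c' * \<bar>s k w - ?u\<bar> - \<tau> n \<le> ?H w" by linarith
      qed
      also have "\<dots> = integral\<^sup>L (Pn n) (X n k)"
        using att[OF k n] by (simp add: X_def[abs_def])
      finally show ?thesis .
    qed
    have "I - 2 * \<delta> m \<le> (\<integral>w. s k w * w k \<partial>P)" for m
    proof -
      have "(\<lambda>n. I - c' * (1 / real (Suc n)) - \<tau> n - \<delta> n - \<delta> m) \<longlonglongrightarrow> I - c' * 0 - 0 - 0 - \<delta> m"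
        by (intro tendsto_intros inv0 \<tau> \<delta>0)
      from LIMSEQ_subseq_LIMSEQ[OF this r]
      have l: "(\<lambda>n. I - c' * (1 / real (Suc (r n))) - \<tau> (r n) - \<delta> (r n) - \<delta> m) \<longlonglongrightarrow> I - c' * 0 - 0 - 0 - \<delta> m"
        by (simp add: o_def)
      have "I - c' * 0 - 0 - 0 - \<delta> m \<le> integral\<^sup>L P (X m k)"
      proof (rule LIMSEQ_le[OF l limX])
        have "I - c' * (1 / real (Suc (r n))) - \<tau> (r n) - \<delta> (r n) - \<delta> m \<le> integral\<^sup>L (Pn (r n)) (X m k)" if "n \<ge> Suc k" for n
        proof -
          have "k < r n" using that seq_suble[OF r, of n] by simp
          from lower[OF this] approx[OF Pn(1,2), of "r n" "r n"] approx[OF Pn(1,2), of "r n" m]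
          show ?thesis by linarith
        qed
        then show "\<exists>N. \<forall>n\<ge>N. I - c' * (1 / real (Suc (r n))) - \<tau> (r n) - \<delta> (r n) - \<delta> m \<le> integral\<^sup>L (Pn (r n)) (X m k)"
          by blast
      qed
      with approx[OF P Pf, of m] show ?thesis by linarith
    qed
    moreover have "(\<lambda>m. I - 2 * \<delta> m) \<longlonglongrightarrow> I - 2 * 0" by (intro tendsto_intros \<delta>0)
    ultimately have "I - 2 * 0 \<le> (\<integral>w. s k w * w k \<partial>P)" by (intro LIMSEQ_le_const2) auto
    then show "(\<integral>w. drift (s k w) \<partial>P) \<le> (\<integral>w. s k w * w k \<partial>P)" using marg_drift[OF P Pf] by simp
  qed
qed

end

context iid_moment_expectation
begin

text \<open>Weighted with any \<open>g \<in> past k\<close> between \<open>0\<close> and \<open>B\<close>, the gain \<open>s k * (w k - D)\<close> has expectation at most \<open>0\<close>,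
  whereas \<open>extremal_drift\<close> makes the unweighted gain nonnegative. Applied to \<open>g\<close> and to \<open>B - g\<close>, this
  leaves only gain \<open>0\<close> for each weight.\<close>

lemma prescribed_conditional_mean:
  assumes d: "d \<ge> 1" and s: "\<And>k. s k \<in> past d" and s1: "\<And>k w. s k w = 1 \<or> s k w = - 1"
  shows "\<exists>P\<in>\<Theta>\<^sub>0. \<forall>k\<ge>d. \<forall>h\<in>past k. \<forall>B. (\<forall>w. h w \<in> {0..B}) \<longrightarrow>
      (\<integral>w. h w * w k \<partial>P) = (\<integral>w. h w * (if s k w = 1 then upper_mean E else lower_mean E) \<partial>P)"
proof -
  have s2: "s k w \<in> {-1..1}" for k w using s1[of k w] by auto
  obtain P where P0: "P \<in> \<Theta>\<^sub>0" and ge: "\<And>k. d \<le> k \<Longrightarrow> (\<integral>w. drift (s k w) \<partial>P) \<le> (\<integral>w. s k w * w k \<partial>P)"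
    by (rule extremal_drift[OF d s s2], rule that)
  note P = \<Theta>\<^sub>0_subset[OF P0]
  note Pp = \<Theta>_prob[OF P]
  interpret prob_space P using prob_measuresD[OF Pp] by simp
  show ?thesis
  proof (intro bexI[OF _ P0] allI ballI impI)
    fix k h B assume k: "d \<le> k" and h: "h \<in> past k" and "\<forall>w. h w \<in> {0..B}"
    then have hB: "h w \<in> {0..B}" for w by blast
    define D where "D w = (if s k w = 1 then upper_mean E else lower_mean E)" for w
    have B: "B \<ge> 0" using hB[of undefined] by simp
    have sk: "s k \<in> past k" by (rule past_mono[OF k s])
    have [measurable]: "s k \<in> borel_measurable borel" by (rule pastD(1)[OF s])
    have Dm [measurable]: "D \<in> borel_measurable borel" unfolding D_def by measurable
    define c where "c = \<bar>upper_mean E\<bar> + \<bar>lower_mean E\<bar>"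
    have Dc: "\<bar>D w\<bar> \<le> c" for w by (auto simp: D_def c_def)
    have ix: "integrable P (\<lambda>w. g w * w k)" if "g \<in> past k" "\<And>w. \<bar>g w\<bar> \<le> C" for g C
      by (rule integrable_past_times_coordinate[OF P that, of "\<lambda>x. x" 0 1]) auto
    have iD: "integrable P (\<lambda>w. g w * D w)" if "g \<in> past k" "\<And>w. \<bar>g w\<bar> \<le> C" for g C
    proof (rule integrable_bounded[OF Pp, of _ "C * c"])
      have [measurable]: "g \<in> borel_measurable borel" by (rule pastD(1)[OF that(1)])
      show "(\<lambda>w. g w * D w) \<in> borel_measurable borel" by measurable
      show "\<bar>g w * D w\<bar> \<le> C * c" for w
        unfolding abs_mult using that(2)[of w] Dc[of w] by (intro mult_mono) auto
    qed
    have ig: "integrable P g" if "g \<in> past k" "\<And>w. \<bar>g w\<bar> \<le> C" for g C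
      by (rule integrable_bounded[OF Pp pastD(1)[OF that(1)] that(2)])
    define gain where "gain g = (\<integral>w. g w * s k w * w k \<partial>P) - (\<integral>w. g w * s k w * D w \<partial>P)" for g
    have gs: "(\<lambda>w. g w * s k w) \<in> past k" "\<And>w. \<bar>g w * s k w\<bar> \<le> C" if "g \<in> past k" "\<And>w. \<bar>g w\<bar> \<le> C" for g C
    proof -
      show "(\<lambda>w. g w * s k w) \<in> past k" by (intro past_mult that sk)
      show "\<bar>g w * s k w\<bar> \<le> C" for w using that(2)[of w] s1[of k w] by (auto simp: abs_mult)
    qed
    have gain_le: "gain g \<le> 0" if g: "g \<in> past k" "\<And>w. g w \<in> {0..C}" for g C
    proof -
      have gC: "\<bar>g w\<bar> \<le> C" for w using g(2)[of w] by auto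
      have C0: "0 \<le> C" using g(2)[of undefined] by simp
      define u where "u w = (if s k w = 1 then g w else 0)" for w
      define v where "v w = (if s k w = 1 then 0 else g w)" for w
      have u: "u \<in> past k" "\<And>w. u w \<in> {0..C}" and v: "v \<in> past k" "\<And>w. v w \<in> {0..C}"
        unfolding u_def v_def using g C0 by (auto intro!: past_if sk past_const)
      have uC: "\<bar>u w\<bar> \<le> C" and vC: "\<bar>v w\<bar> \<le> C" for w using u(2)[of w] v(2)[of w] by auto
      have k1: "1 \<le> k" using d k by simp
      have 1: "(\<integral>w. u w * w k \<partial>P) \<le> upper_mean E * (\<integral>w. u w \<partial>P)"
        by (rule conditional_mean_le[OF P k1 u, of 1]) (use upper_mean_ge in auto)
      have 2: "(\<integral>w. v w * - w k \<partial>P) \<le> - lower_mean E * (\<integral>w. v w \<partial>P)"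
        by (rule conditional_mean_le[OF P k1 v, of 1]) (use lower_mean_le in auto)
      have "(\<lambda>w. g w * s k w * w k) = (\<lambda>w. u w * w k + v w * - w k)"
        using s1[of k] by (fastforce simp: u_def v_def)
      moreover have "(\<lambda>w. g w * s k w * D w) = (\<lambda>w. upper_mean E * u w + - lower_mean E * v w)"
        using s1[of k] by (fastforce simp: u_def v_def D_def)
      ultimately show ?thesis
        unfolding gain_def using 1 2 ix[OF u(1) uC] ix[OF v(1) vC] ig[OF u(1) uC] ig[OF v(1) vC] by simp
    qed
    have one: "(\<lambda>_. 1) \<in> past k" by (rule cyl_Lip_past[OF cyl_Lip_const])
    have gain1: "gain (\<lambda>_. 1) \<ge> 0"
    proof -
      have "drift (s k w) = s k w * D w" for w using s1[of k w] by (auto simp: drift_def D_def)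
      then show ?thesis using ge[OF k] by (simp add: gain_def)
    qed
    have gain0: "gain g = 0" if g: "g \<in> past k" "\<And>w. g w \<in> {0..B}" for g
    proof -
      have gB: "\<bar>g w\<bar> \<le> B" for w using g(2)[of w] by auto
      have c: "(\<lambda>w. B - g w) \<in> past k" by (intro past_diff past_const g)
      have "gain (\<lambda>w. B - g w) \<le> 0"
        by (rule gain_le[OF c, of B]) (use g(2) in auto)
      moreover have "gain (\<lambda>w. B - g w) = B * gain (\<lambda>_. 1) - gain g"
      proof -
        note i = ix[OF gs[OF one, of 1]] ix[OF gs[OF g(1) gB]] iD[OF gs[OF one, of 1]] iD[OF gs[OF g(1) gB]]
        have "(\<integral>w. (B - g w) * s k w * w k \<partial>P) = (\<integral>w. B * (1 * s k w * w k) - g w * s k w * w k \<partial>P)"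
          by (rule Bochner_Integration.integral_cong) (auto simp: algebra_simps)
        moreover have "(\<integral>w. (B - g w) * s k w * D w \<partial>P) = (\<integral>w. B * (1 * s k w * D w) - g w * s k w * D w \<partial>P)"
          by (rule Bochner_Integration.integral_cong) (auto simp: algebra_simps)
        ultimately show ?thesis unfolding gain_def using i by (simp add: algebra_simps)
      qed
      moreover have "B * gain (\<lambda>_. 1) \<ge> 0" using B gain1 by simp
      moreover have "gain g \<le> 0" by (rule gain_le[OF g])
      ultimately show ?thesis by linarith
    qed
    define u where "u w = (if s k w = 1 then h w else 0)" for w
    define v where "v w = (if s k w = 1 then 0 else h w)" for w
    have u: "u \<in> past k" "\<And>w. u w \<in> {0..B}" and v: "v \<in> past k" "\<And>w. v w \<in> {0..B}"
      unfolding u_def v_def using h hB B by (auto intro!: past_if sk past_const)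
    have uB: "\<bar>u w\<bar> \<le> B" and vB: "\<bar>v w\<bar> \<le> B" for w using u(2)[of w] v(2)[of w] by auto
    have "(\<lambda>w. h w * w k) = (\<lambda>w. u w * s k w * w k - v w * s k w * w k)"
      using s1[of k] by (fastforce simp: u_def v_def)
    moreover have "(\<lambda>w. h w * D w) = (\<lambda>w. u w * s k w * D w - v w * s k w * D w)"
      using s1[of k] by (fastforce simp: u_def v_def)
    ultimately have "(\<integral>w. h w * w k \<partial>P) - (\<integral>w. h w * D w \<partial>P) = gain u - gain v"
      unfolding gain_def using ix[OF gs[OF u(1) uB]] ix[OF gs[OF v(1) vB]] iD[OF gs[OF u(1) uB]] iD[OF gs[OF v(1) vB]] by simp
    then show "(\<integral>w. h w * w k \<partial>P) = (\<integral>w. h w * (if s k w = 1 then upper_mean E else lower_mean E) \<partial>P)"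
      using gain0[OF u] gain0[OF v] by (simp add: D_def)
  qed
qed

end

section \<open>A strong law of large numbers\<close>

text \<open>Kolmogorov's inequality for partial sums of supermartingale differences. Switching the
  differences off once the level \<open>r\<close> is reached keeps the supermartingale property and makes the
  last partial sum \<open>T b\<close> at least \<open>r\<close> on the event. The second moment of the positive part of the partial
  sums grows by at most the second moment of the increment, because the mixed term is nonpositive.\<close>

lemma one_sided_maximal_inequality:
  assumes P: "P \<in> prob_measures"
    and V: "\<And>k. a \<le> k \<Longrightarrow> V k \<in> past (Suc k)" "\<And>k w. \<bar>V k w\<bar> \<le> B k"
    and super: "\<And>k h C. a \<le> k \<Longrightarrow> h \<in> past k \<Longrightarrow> (\<And>w. h w \<in> {0..C}) \<Longrightarrow> (\<integral>w. h w * V k w \<partial>P) \<le> 0"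
    and var: "\<And>k. a \<le> k \<Longrightarrow> (\<integral>w. (V k w)\<^sup>2 \<partial>P) \<le> v k"
    and ab: "a \<le> b" and r: "r > 0"
  shows "measure P {w. \<exists>n. a \<le> n \<and> n \<le> b \<and> r \<le> (\<Sum>k\<in>{a..<n}. V k w)} \<le> (\<Sum>k\<in>{a..<b}. v k) / r\<^sup>2"
proof -
  interpret prob_space P using prob_measuresD[OF P] by simp
  have B0: "B k \<ge> 0" for k using V(2)[of k undefined] by linarith
  define S where "S n w = (\<Sum>k\<in>{a..<n}. V k w)" for n w
  \<comment> \<open>The level \<open>r\<close> has not been reached up to time \<open>k\<close>.\<close>
  define A where "A k w = (if \<forall>n\<in>{a..k}. S n w < r then 1 else 0 :: real)" for k w
  define T where "T n w = (\<Sum>k\<in>{a..<n}. A k w * V k w)" for n w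
  have Sp: "S m \<in> past n" if "m \<le> n" for m n
    unfolding S_def using that by (intro past_sum past_mono[OF _ V(1)]) auto
  have Ap: "A k \<in> past n" if "k \<le> n" for k n
  proof (rule past_mono[OF that], rule pastI)
    have [measurable]: "S n \<in> borel_measurable borel" for n by (rule pastD(1)[OF Sp[of n n]]) simp
    show "A k \<in> borel_measurable borel" unfolding A_def by measurable
    fix x y :: seqspace assume *: "\<And>j. j < k \<Longrightarrow> x j = y j"
    have "S n x = S n y" if "n \<in> {a..k}" for n using pastD(2)[OF Sp[of n k] *] that by simp
    then show "A k x = A k y" by (simp add: A_def)
  qed
  have Tp: "T m \<in> past n" if "m \<le> n" for m n
    unfolding T_def using that by (intro past_sum past_mult Ap past_mono[OF _ V(1)]) auto
  have A01: "A k w = 0 \<or> A k w = 1" for k w by (simp add: A_def)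
  have AV: "\<bar>A k w * V k w\<bar> \<le> B k" for k w using A01[of k w] V(2)[of k w] B0[of k] by auto
  have TB: "\<bar>T n w\<bar> \<le> (\<Sum>k\<in>{a..<n}. B k)" for n w
    unfolding T_def by (rule order_trans[OF sum_abs sum_mono[OF AV]])
  have TB0: "(\<Sum>k\<in>{a..<n}. B k) \<ge> 0" for n by (intro sum_nonneg B0)
  have int: "integrable P g" if "g \<in> past n" "\<And>w. \<bar>g w\<bar> \<le> C" for g n C
    by (rule integrable_bounded[OF P pastD(1)[OF that(1)] that(2)])
  have sqp: "(\<lambda>w. (max 0 (T n w))\<^sup>2) \<in> past n" for n
    by (rule past_compose[OF Tp]) auto
  have isq: "integrable P (\<lambda>w. (max 0 (T n w))\<^sup>2)" for n
  proof (rule int[OF sqp])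
    show "\<bar>(max 0 (T n w))\<^sup>2\<bar> \<le> (\<Sum>k\<in>{a..<n}. B k)\<^sup>2" for w
    proof -
      have "max 0 (T n w) \<le> (\<Sum>k\<in>{a..<n}. B k)" using TB[of n w] TB0[of n] by auto
      then show ?thesis by (simp add: power_mono)
    qed
  qed
  have second_moment: "(\<integral>w. (max 0 (T n w))\<^sup>2 \<partial>P) \<le> (\<Sum>k\<in>{a..<n}. v k)" if "a \<le> n" for n
    using that
  proof (induction n rule: dec_induct)
    case base then show ?case by (simp add: T_def)
  next
    case (step n)
    define h where "h w = max 0 (T n w) * A n w" for w
    have hp: "h \<in> past n" unfolding h_def by (intro past_mult past_compose[OF Tp] Ap) auto
    have h01: "h w \<in> {0..\<Sum>k\<in>{a..<n}. B k}" for w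
      using TB[of n w] A01[of n w] TB0[of n] by (auto simp: h_def)
    have iV2: "integrable P (\<lambda>w. (V n w)\<^sup>2)"
      by (rule int[OF past_compose[OF V(1)[OF step(1)]], of _ "(B n)\<^sup>2"])
        (use V(2)[of n] B0[of n] in \<open>auto intro: power2_le_iff_abs_le[THEN iffD2]\<close>)
    have hVp: "(\<lambda>w. h w * V n w) \<in> past (Suc n)"
      using past_mono[OF _ hp, of "Suc n"] V(1)[OF step(1)] by (intro past_mult) auto
    have ihV: "integrable P (\<lambda>w. h w * V n w)"
    proof (rule int[OF hVp])
      show "\<bar>h w * V n w\<bar> \<le> (\<Sum>k\<in>{a..<n}. B k) * B n" for w
        unfolding abs_mult using h01[of w] V(2)[of n w] TB0[of n] by (intro mult_mono) auto
    qed
    have "(\<integral>w. (max 0 (T (Suc n) w))\<^sup>2 \<partial>P) \<le> (\<integral>w. (max 0 (T n w))\<^sup>2 + 2 * (h w * V n w) + (V n w)\<^sup>2 \<partial>P)"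
    proof (rule integral_mono)
      fix w
      have T: "T (Suc n) w = T n w + A n w * V n w" using step(1) by (simp add: T_def)
      have "(max 0 (T (Suc n) w))\<^sup>2 \<le> (max 0 (T n w) + A n w * V n w)\<^sup>2"
      proof (rule abs_le_square_iff[THEN iffD1])
        show "\<bar>max 0 (T (Suc n) w)\<bar> \<le> \<bar>max 0 (T n w) + A n w * V n w\<bar>" unfolding T by auto
      qed
      also have "\<dots> = (max 0 (T n w))\<^sup>2 + 2 * (h w * V n w) + (A n w)\<^sup>2 * (V n w)\<^sup>2"
        by (simp add: h_def power2_eq_square algebra_simps)
      also have "(A n w)\<^sup>2 * (V n w)\<^sup>2 \<le> 1 * (V n w)\<^sup>2"
        using A01[of n w] by (intro mult_right_mono) auto
      finally show "(max 0 (T (Suc n) w))\<^sup>2 \<le> (max 0 (T n w))\<^sup>2 + 2 * (h w * V n w) + (V n w)\<^sup>2" by simp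
    qed (use isq ihV iV2 in auto)
    also have "\<dots> = (\<integral>w. (max 0 (T n w))\<^sup>2 \<partial>P) + 2 * (\<integral>w. h w * V n w \<partial>P) + (\<integral>w. (V n w)\<^sup>2 \<partial>P)"
      using isq ihV iV2 by simp
    also have "\<dots> \<le> (\<Sum>k\<in>{a..<n}. v k) + 2 * 0 + v n"
      using step(3) super[OF step(1) hp h01] var[OF step(1)] by (intro add_mono mult_left_mono) auto
    finally show ?case using step(1) by simp
  qed
  have stopped: "(\<exists>n. a \<le> n \<and> n \<le> m \<and> r \<le> S n w) \<longrightarrow> r \<le> T m w"
    "(\<forall>n. a \<le> n \<and> n \<le> m \<longrightarrow> S n w < r) \<longrightarrow> T m w = S m w" if "a \<le> m" for m w
    using that
  proof (induction m rule: dec_induct)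
    case base
    {
      case 1
      show ?case using r by (auto simp: S_def)
    next
      case 2
      show ?case by (auto simp: S_def T_def)
    }
  next
    case (step m)
    have T: "T (Suc m) w = T m w + A m w * V m w" and S: "S (Suc m) w = S m w + V m w"
      using step(1) by (simp_all add: T_def S_def)
    have *: "(r \<le> T (Suc m) w \<and> (\<exists>n. a \<le> n \<and> n \<le> m \<and> r \<le> S n w)) \<or>
      (T (Suc m) w = S (Suc m) w \<and> (\<forall>n. a \<le> n \<and> n \<le> m \<longrightarrow> S n w < r))"
    proof (cases "\<exists>n. a \<le> n \<and> n \<le> m \<and> r \<le> S n w")
      case True
      then have "A m w = 0" by (force simp: A_def)
      then show ?thesis using True step(3) T by simp
    next
      case False
      then have "\<forall>n. a \<le> n \<and> n \<le> m \<longrightarrow> S n w < r" using not_le by blast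
      moreover from this have "A m w = 1" by (simp add: A_def)
      ultimately show ?thesis using step(4) S T by simp
    qed
    {
      case 1
      show ?case using * le_Suc_eq by auto
    next
      case 2
      show ?case using * le_SucI not_le by blast
    }
  qed
  define D where "D = {w. \<exists>n. a \<le> n \<and> n \<le> b \<and> r \<le> S n w}"
  have "D \<in> sets borel"
  proof -
    have [measurable]: "S n \<in> borel_measurable borel" for n by (rule pastD(1)[OF Sp[of n n]]) simp
    have "{w \<in> space borel. \<exists>n. a \<le> n \<and> n \<le> b \<and> r \<le> S n w} \<in> sets borel" by measurable
    then show ?thesis unfolding D_def by (simp only: space_borel UNIV_I simp_thms)
  qed
  then have Ds: "D \<in> sets P" using prob_measuresD(2)[OF P] by simp
  have "r\<^sup>2 * measure P D = (\<integral>w. r\<^sup>2 * indicat_real D w \<partial>P)"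
    using Ds by simp
  also have "\<dots> \<le> (\<integral>w. (max 0 (T b w))\<^sup>2 \<partial>P)"
  proof (rule integral_mono[OF _ isq])
    show "integrable P (\<lambda>w. r\<^sup>2 * indicat_real D w)"
      using Ds by (intro integrable_mult_right integrable_real_indicator) (auto simp: less_top[symmetric])
    fix w
    show "r\<^sup>2 * indicat_real D w \<le> (max 0 (T b w))\<^sup>2"
    proof (cases "w \<in> D")
      case True
      then have "r \<le> T b w" using stopped(1)[OF ab, of w] unfolding D_def by blast
      then show ?thesis using True r by (simp add: power_mono)
    qed simp
  qed
  also have "\<dots> \<le> (\<Sum>k\<in>{a..<b}. v k)" by (rule second_moment[OF ab])
  finally have "measure P D \<le> (\<Sum>k\<in>{a..<b}. v k) / r\<^sup>2" using r by (simp add: field_simps)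
  then show ?thesis unfolding D_def S_def .
qed

text \<open>Up to time \<open>N = 2\<^sup>j\<^sup>+\<^sup>1\<close> the second moments add up to at most \<open>c * N powr (3 - p)\<close>, so the maximal
  inequality at level \<open>r * 2 ^ j\<close> gives probabilities of order \<open>N powr (1 - p)\<close>. They are summable over \<open>j\<close>
  because \<open>p > 1\<close>, and the Borel--Cantelli lemma applies.\<close>

lemma supermartingale_difference_average:
  assumes P: "P \<in> prob_measures"
    and V: "\<And>k. a \<le> k \<Longrightarrow> V k \<in> past (Suc k)" "\<And>k w. \<bar>V k w\<bar> \<le> B k"
    and super: "\<And>k h C. a \<le> k \<Longrightarrow> h \<in> past k \<Longrightarrow> (\<And>w. h w \<in> {0..C}) \<Longrightarrow> (\<integral>w. h w * V k w \<partial>P) \<le> 0"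
    and var: "\<And>k. a \<le> k \<Longrightarrow> (\<integral>w. (V k w)\<^sup>2 \<partial>P) \<le> c * real k powr (2 - p)"
    and p: "1 < p" "p \<le> 2" and c: "c \<ge> 0" and r: "r > 0"
  shows "AE w in P. \<forall>\<^sub>F n in sequentially. (\<Sum>k\<in>{a..<n}. V k w) \<le> r * real n"
proof -
  interpret prob_space P using prob_measuresD[OF P] by simp
  define S where "S n w = (\<Sum>k\<in>{a..<n}. V k w)" for n w
  define D where "D j = {w. \<exists>n. a \<le> n \<and> n \<le> 2 ^ Suc j \<and> r * 2 ^ j \<le> S n w}" for j :: nat
  have Dm: "D j \<in> sets P" for j
  proof -
    have "S n \<in> past n" for n unfolding S_def by (intro past_sum past_mono[OF _ V(1)]) auto
    then have [measurable]: "S n \<in> borel_measurable borel" for n by (rule pastD(1))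
    have "{w \<in> space borel. \<exists>n. a \<le> n \<and> n \<le> 2 ^ Suc j \<and> r * 2 ^ j \<le> S n w} \<in> sets borel" by measurable
    then have "D j \<in> sets borel" unfolding D_def by (simp only: space_borel UNIV_I simp_thms)
    then show ?thesis by (simp only: prob_measuresD(2)[OF P])
  qed
  define q where "q = 2 powr (1 - p)"
  have q: "0 < q" "q < 1" using p by (auto simp: q_def powr_less_one)
  define K where "K = 4 * c / r\<^sup>2 * q"
  have bound: "measure P (D j) \<le> K * q ^ j" if j: "j \<ge> a" for j
  proof -
    define N :: nat where "N = 2 ^ Suc j"
    have N: "real N > 0" by (simp add: N_def)
    have "a \<le> N"
    proof -
      have "j < 2 ^ Suc j" by (rule less_trans[OF lessI less_exp])
      then show ?thesis using j unfolding N_def by linarith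
    qed
    then have "measure P (D j) \<le> (\<Sum>k\<in>{a..<N}. c * real k powr (2 - p)) / (r * 2 ^ j)\<^sup>2"
      unfolding D_def S_def N_def
      by (intro one_sided_maximal_inequality[where B = B, OF P V super var]) (use r in auto)
    also have "(\<Sum>k\<in>{a..<N}. c * real k powr (2 - p)) \<le> (\<Sum>k\<in>{a..<N}. c * real N powr (2 - p))"
      using p c by (intro sum_mono mult_left_mono powr_mono2) auto
    also have "\<dots> \<le> real N * (c * real N powr (2 - p))"
      using c by (simp add: mult_right_mono)
    also have "\<dots> / (r * 2 ^ j)\<^sup>2 = 4 * c / r\<^sup>2 * real N powr (1 - p)"
    proof -
      have den: "(r * 2 ^ j)\<^sup>2 = r\<^sup>2 * (real N)\<^sup>2 / 4" by (simp add: N_def power_mult_distrib power2_eq_square)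
      have "real N powr (2 - p) = real N powr (1 + (1 - p))" by (rule arg_cong) simp
      also have "\<dots> = real N powr 1 * real N powr (1 - p)" by (rule powr_add)
      finally have num: "real N powr (2 - p) = real N * real N powr (1 - p)" by simp
      show ?thesis unfolding den num using N r by (simp add: field_simps power2_eq_square)
    qed
    also have "real N powr (1 - p) = q ^ Suc j"
    proof -
      have "real N = 2 powr real (Suc j)" by (subst powr_realpow) (simp_all add: N_def)
      moreover have "q ^ Suc j = q powr real (Suc j)" by (rule powr_realpow[symmetric]) (rule q)
      ultimately show ?thesis by (simp only: q_def powr_powr mult.commute)
    qed
    finally show ?thesis by (simp add: K_def divide_right_mono mult.assoc)
  qed
  have "summable (\<lambda>j. measure P (D j))"
  proof (rule summable_comparison_test_ev)
    show "\<forall>\<^sub>F j in sequentially. norm (measure P (D j)) \<le> K * q ^ j"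
      using eventually_ge_at_top[of a] by eventually_elim (use bound in simp)
    show "summable (\<lambda>j. K * q ^ j)" using q by (intro summable_mult summable_geometric) simp
  qed
  then have "AE w in P. \<forall>\<^sub>F j in sequentially. w \<in> space P - D j"
    by (intro borel_cantelli_AE1 Dm) (simp_all add: less_top[symmetric])
  then show ?thesis
  proof eventually_elim
    case (elim w)
    then obtain J where J: "\<And>j. j \<ge> J \<Longrightarrow> w \<notin> D j" by (auto simp: eventually_sequentially)
    have "S n w \<le> r * real n" if n: "n \<ge> a + 2 ^ J" for n
    proof -
      have "n \<ge> 1" using n by (meson le_add2 one_le_numeral one_le_power order_trans)
      then obtain j where j: "2 ^ j \<le> n" "n < 2 ^ Suc j"
        using ex_power_ivl1[of 2 n] by auto
      have "(2::nat) ^ J < 2 ^ Suc j" using n j(2) by linarith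
      then have "J \<le> j" by (simp only: power_strict_increasing_iff less_Suc_eq_le one_less_numeral_iff semiring_norm)
      from J[OF this] have "\<not> r * 2 ^ j \<le> S n w"
        unfolding D_def using j(2) n by (auto simp del: power_Suc)
      moreover have "r * 2 ^ j \<le> r * real n"
      proof -
        have "real (2 ^ j) \<le> real n" using j(1) by (rule of_nat_mono)
        then show ?thesis using r by simp
      qed
      ultimately show ?thesis by linarith
    qed
    then show ?case unfolding eventually_sequentially S_def by blast
  qed
qed

lemma integrable_min_square:
  assumes "P \<in> prob_measures" "c \<ge> 0"
  shows "integrable P (\<lambda>w. (min \<bar>w k\<bar> c)\<^sup>2)"
proof (rule integrable_bounded[OF assms(1), of _ "c\<^sup>2"])
  show "\<bar>(min \<bar>x k\<bar> c)\<^sup>2\<bar> \<le> c\<^sup>2" for x :: seqspace using assms(2) by (simp add: power_mono)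
qed measurable

text \<open>Finitely many terms do not influence an average. The starting index \<open>a\<close> may depend on \<open>\<delta>\<close>, which is
  how the bound arises in \<open>strong_law\<close>.\<close>

lemma average_tendsto_zero:
  fixes u w :: "nat \<Rightarrow> real"
  assumes u: "\<And>\<delta>. \<delta> > 0 \<Longrightarrow> \<exists>a. \<forall>\<^sub>F n in sequentially. \<bar>\<Sum>k\<in>{a..<n}. u k\<bar> \<le> \<delta> * real n"
    and w: "\<forall>\<^sub>F k in sequentially. w k = u k"
  shows "(\<lambda>n. (\<Sum>k\<in>{d..<n}. w k) / real n) \<longlonglongrightarrow> 0"
proof (rule LIMSEQ_I)
  fix e :: real assume e: "e > 0"
  obtain a N where N: "\<And>n. n \<ge> N \<Longrightarrow> \<bar>\<Sum>k\<in>{a..<n}. u k\<bar> \<le> (e/3) * real n"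
    using u[of "e/3"] e by (auto simp: eventually_sequentially)
  obtain M where M: "\<And>k. k \<ge> M \<Longrightarrow> w k = u k" using w by (auto simp: eventually_sequentially)
  define b where "b = max a (max d M)"
  define K where "K = \<bar>(\<Sum>k\<in>{d..<b}. w k) - (\<Sum>k\<in>{a..<b}. u k)\<bar>"
  obtain L where L: "3 * K / e < real L" using reals_Archimedean2 by blast
  have "norm ((\<Sum>k\<in>{d..<n}. w k) / real n - 0) < e" if n: "n \<ge> max b (max N (Suc L))" for n
  proof -
    have 1: "(\<Sum>k\<in>{d..<n}. w k) = (\<Sum>k\<in>{d..<b}. w k) + (\<Sum>k\<in>{b..<n}. w k)"
      using n by (intro sum.atLeastLessThan_concat[symmetric]) (auto simp: b_def)
    have 2: "(\<Sum>k\<in>{a..<n}. u k) = (\<Sum>k\<in>{a..<b}. u k) + (\<Sum>k\<in>{b..<n}. u k)"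
      using n by (intro sum.atLeastLessThan_concat[symmetric]) (auto simp: b_def)
    have 3: "(\<Sum>k\<in>{b..<n}. w k) = (\<Sum>k\<in>{b..<n}. u k)"
      by (rule sum.cong) (use M in \<open>auto simp: b_def\<close>)
    have "\<bar>\<Sum>k\<in>{d..<n}. w k\<bar> \<le> K + (e/3) * real n"
    proof -
      have "\<bar>\<Sum>k\<in>{a..<n}. u k\<bar> \<le> (e/3) * real n" using N n by simp
      then show ?thesis unfolding 1 2 3 K_def by linarith
    qed
    moreover have "3 * K < e * real n"
    proof -
      have "3 * K < e * real L" using L e by (simp add: field_simps)
      also have "\<dots> \<le> e * real n" using n e by (intro mult_left_mono) auto
      finally show ?thesis .
    qed
    moreover have "real n > 0" using n by simp
    ultimately have "\<bar>\<Sum>k\<in>{d..<n}. w k\<bar> < e * real n" using e mult_pos_pos[OF e \<open>real n > 0\<close>] by linarith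
    then show ?thesis using \<open>real n > 0\<close> by (simp add: field_simps)
  qed
  then show "\<exists>n0. \<forall>n\<ge>n0. norm ((\<Sum>k\<in>{d..<n}. w k) / real n - 0) < e" by blast
qed

context iid_moment_expectation
begin

text \<open>The coordinates are cut off at the levels \<open>\<plusminus> k\<close>. The bias which this causes tends to \<open>0\<close>, and the
  second moments of the cut-off coordinates are of order \<open>k powr (2 - p)\<close>. By the same second moment
  bound, almost surely only finitely many coordinates are affected.\<close>

lemma strong_law:
  assumes P: "P \<in> \<Theta>" and d: "d \<ge> 1"
    and D: "\<And>k. d \<le> k \<Longrightarrow> D k \<in> past k" "\<And>k w. \<bar>D k w\<bar> \<le> c"
    and mean: "\<And>k h B. d \<le> k \<Longrightarrow> h \<in> past k \<Longrightarrow> (\<And>w. h w \<in> {0..B}) \<Longrightarrow>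
      (\<integral>w. h w * w k \<partial>P) = (\<integral>w. h w * D k w \<partial>P)"
  shows "AE w in P. (\<lambda>n. (\<Sum>k\<in>{d..<n}. w k - D k w) / real n) \<longlonglongrightarrow> 0"
proof -
  note Pp = \<Theta>_prob[OF P]
  interpret prob_space P using prob_measuresD[OF Pp] by simp
  \<comment> \<open>The bound on truncated second moments requires an exponent of at most \<open>2\<close>.\<close>
  define p where "p = min \<gamma> 2"
  have p: "1 < p" "p \<le> 2" "0 \<le> p" "p \<le> \<gamma>" using \<gamma> by (auto simp: p_def)
  obtain C where C: "C \<ge> 0" "\<And>Q. Q \<in> \<Theta> \<Longrightarrow> integrable Q (\<lambda>w. \<bar>w 0\<bar> powr p)"
    "\<And>Q. Q \<in> \<Theta> \<Longrightarrow> (\<integral>w. \<bar>w 0\<bar> powr p \<partial>Q) \<le> C"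
    using moment_bound_le[OF p(3,4), of 0] by blast
  obtain C' where C': "C' \<ge> 0" "\<And>Q M. Q \<in> \<Theta> \<Longrightarrow> M > 0 \<Longrightarrow> (\<integral>w. max 0 (\<bar>w 0\<bar> - M) \<partial>Q) \<le> C' * M powr (1 - \<gamma>)"
    using tail_bound[of 0] by blast
  have c0: "c \<ge> 0" using D(2)[of 0 undefined] by linarith
  have tail: "(\<integral>w. h w * max 0 (\<bar>w k\<bar> - real k) \<partial>P) \<le> C' * real k powr (1 - \<gamma>) * (\<integral>w. h w \<partial>P)"
    if "k \<ge> 1" "h \<in> past k" "\<And>w. h w \<in> {0..B}" for k h B
    by (rule conditional_mean_le[OF P that, of 1]) (use C'(2) that(1) in auto)
  have square: "(\<integral>w. (min \<bar>w k\<bar> (real k))\<^sup>2 \<partial>P) \<le> C * real k powr (2 - p)" if k: "k \<ge> 1" for k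
  proof -
    have "(\<integral>w. 1 * (min \<bar>w k\<bar> (real k))\<^sup>2 \<partial>P) \<le> C * real k powr (2 - p) * (\<integral>w. 1 \<partial>P)"
    proof (rule conditional_mean_le[OF P k past_const, of 1 1 "2 * real k"])
      fix x y :: real
      have "(min \<bar>x\<bar> (real k))\<^sup>2 - (min \<bar>y\<bar> (real k))\<^sup>2 = (min \<bar>x\<bar> (real k) + min \<bar>y\<bar> (real k)) * (min \<bar>x\<bar> (real k) - min \<bar>y\<bar> (real k))"
        by (simp add: power2_eq_square algebra_simps)
      also have "\<bar>\<dots>\<bar> \<le> (2 * real k) * \<bar>x - y\<bar>"
        unfolding abs_mult by (intro mult_mono) auto
      finally show "\<bar>(min \<bar>x\<bar> (real k))\<^sup>2 - (min \<bar>y\<bar> (real k))\<^sup>2\<bar> \<le> 2 * real k * \<bar>x - y\<bar>" .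
    next
      fix Q assume Q: "Q \<in> \<Theta>"
      interpret Q: prob_space Q using prob_measuresD[OF \<Theta>_prob[OF Q]] by simp
      have "(\<integral>w. (min \<bar>w 0\<bar> (real k))\<^sup>2 \<partial>Q) \<le> (\<integral>w. real k powr (2 - p) * \<bar>w 0\<bar> powr p \<partial>Q)"
      proof (rule integral_mono)
        show "integrable Q (\<lambda>w. (min \<bar>w 0\<bar> (real k))\<^sup>2)"
          by (rule integrable_min_square[OF \<Theta>_prob[OF Q]]) simp
      qed (use C(2)[OF Q] min_square_le_powr k p in auto)
      also have "\<dots> = real k powr (2 - p) * (\<integral>w. \<bar>w 0\<bar> powr p \<partial>Q)" by simp
      also have "\<dots> \<le> real k powr (2 - p) * C" by (intro mult_left_mono C(3)[OF Q]) auto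
      finally show "(\<integral>w. (min \<bar>w 0\<bar> (real k))\<^sup>2 \<partial>Q) \<le> C * real k powr (2 - p)" by (simp add: mult.commute)
    qed auto
    then show ?thesis by (simp add: prob_space)
  qed
  define U where "U k w = cutoff (real k) (w k) - D k w" for k w
  have one_side: "\<exists>a. AE w in P. \<forall>\<^sub>F n in sequentially. (\<Sum>k\<in>{b..<n}. \<epsilon> * U k w) \<le> 2 * \<delta> * real n"
    if \<epsilon>: "\<bar>\<epsilon>\<bar> = 1" and \<delta>: "\<delta> > 0" and b: "b \<ge> d" "\<And>k. k \<ge> b \<Longrightarrow> C' * real k powr (1 - \<gamma>) \<le> \<delta>" for \<epsilon> \<delta> :: real and b
  proof -
    \<comment> \<open>From index \<open>b\<close> on, subtracting \<open>\<delta>\<close> outweighs the bias, which makes \<open>V\<close> a supermartingale difference.\<close>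
    define V where "V k w = \<epsilon> * U k w + - \<delta>" for k w
    have "AE w in P. \<forall>\<^sub>F n in sequentially. (\<Sum>k\<in>{b..<n}. V k w) \<le> \<delta> * real n"
    proof (rule supermartingale_difference_average[OF Pp])
      show "V k \<in> past (Suc k)" if "b \<le> k" for k
      proof -
        have "(\<lambda>w. \<epsilon> * (cutoff (real k) (w k) + - 1 * D k w) + - \<delta>) \<in> past (Suc k)"
          using that b(1) by (intro past_add past_mult past_const past_compose[OF past_coordinate] past_mono[OF _ D(1)])
            (auto simp: cutoff_def[abs_def])
        then show ?thesis by (simp add: V_def[abs_def] U_def[abs_def])
      qed
      show "\<bar>V k w\<bar> \<le> real k + c + \<delta>" for k w
      proof -
        have "\<bar>V k w\<bar> \<le> \<bar>\<epsilon> * U k w\<bar> + \<delta>" using \<delta> unfolding V_def by linarith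
        also have "\<bar>\<epsilon> * U k w\<bar> = \<bar>U k w\<bar>" using \<epsilon> by (simp add: abs_mult)
        also have "\<bar>U k w\<bar> \<le> real k + c"
          using cutoff_simps(1)[of "real k" "w k"] D(2)[of k w] unfolding U_def by simp
        finally show ?thesis by simp
      qed
      show "(\<integral>w. h w * V k w \<partial>P) \<le> 0" if k: "b \<le> k" and h: "h \<in> past k" and hB: "\<And>w. h w \<in> {0..B}" for k h B
      proof -
        have k1: "k \<ge> 1" and dk: "d \<le> k" using k b(1) d by auto
        have hB': "\<bar>h w\<bar> \<le> B" for w using hB[of w] by auto
        have [measurable]: "h \<in> borel_measurable borel" "D k \<in> borel_measurable borel"
          using pastD(1)[OF h] pastD(1)[OF D(1)[OF dk]] by auto
        have ih: "integrable P h" by (rule integrable_bounded[OF Pp _ hB']) measurable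
        have ix: "integrable P (\<lambda>w. h w * w k)"
          by (rule integrable_past_times_coordinate[OF P h hB', of "\<lambda>x. x" 0 1]) auto
        have ic: "integrable P (\<lambda>w. h w * cutoff (real k) (w k))"
          by (rule integrable_past_times_coordinate[OF P h hB', of "cutoff (real k)" 0 1])
            (auto simp: cutoff_def[abs_def])
        have it: "integrable P (\<lambda>w. h w * max 0 (\<bar>w k\<bar> - real k))"
          by (rule integrable_past_times_coordinate[OF P h hB', of "\<lambda>x. max 0 (\<bar>x\<bar> - real k)" 0 1]) auto
        have iD: "integrable P (\<lambda>w. h w * D k w)"
        proof (rule integrable_bounded[OF Pp, of _ "B * c"])
          show "\<bar>h w * D k w\<bar> \<le> B * c" for w
            unfolding abs_mult using hB'[of w] D(2)[of k w] by (intro mult_mono) auto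
        qed measurable
        have h0: "(\<integral>w. h w \<partial>P) \<ge> 0" using hB by (intro integral_nonneg_AE) auto
        have "(\<integral>w. h w * V k w \<partial>P) =
            (\<integral>w. \<epsilon> * (h w * cutoff (real k) (w k)) - \<epsilon> * (h w * D k w) - \<delta> * h w \<partial>P)"
          by (rule Bochner_Integration.integral_cong) (auto simp: V_def U_def algebra_simps)
        also have "\<dots> = \<epsilon> * (\<integral>w. h w * cutoff (real k) (w k) \<partial>P) - \<epsilon> * (\<integral>w. h w * D k w \<partial>P) - \<delta> * (\<integral>w. h w \<partial>P)"
          using ic iD ih by simp
        also have "\<dots> = (\<integral>w. \<epsilon> * (h w * cutoff (real k) (w k)) - \<epsilon> * (h w * w k) \<partial>P) - \<delta> * (\<integral>w. h w \<partial>P)"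
          using ic ix mean[OF dk h hB] by simp
        also have "(\<integral>w. \<epsilon> * (h w * cutoff (real k) (w k)) - \<epsilon> * (h w * w k) \<partial>P) \<le> (\<integral>w. h w * max 0 (\<bar>w k\<bar> - real k) \<partial>P)"
        proof (rule integral_mono[OF _ it])
          show "integrable P (\<lambda>w. \<epsilon> * (h w * cutoff (real k) (w k)) - \<epsilon> * (h w * w k))" using ic ix by simp
          fix w :: seqspace
          have "\<epsilon> * (h w * cutoff (real k) (w k)) - \<epsilon> * (h w * w k) = h w * (- \<epsilon> * (w k - cutoff (real k) (w k)))"
            by (simp add: algebra_simps)
          also have "\<dots> \<le> h w * \<bar>w k - cutoff (real k) (w k)\<bar>"
          proof (rule mult_left_mono)
            have "- \<epsilon> * (w k - cutoff (real k) (w k)) \<le> \<bar>- \<epsilon> * (w k - cutoff (real k) (w k))\<bar>" by (rule abs_ge_self)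
            then show "- \<epsilon> * (w k - cutoff (real k) (w k)) \<le> \<bar>w k - cutoff (real k) (w k)\<bar>" using \<epsilon> by (simp add: abs_mult)
          qed (use hB[of w] in auto)
          finally show "\<epsilon> * (h w * cutoff (real k) (w k)) - \<epsilon> * (h w * w k) \<le> h w * max 0 (\<bar>w k\<bar> - real k)"
            by (simp add: cutoff_simps(4))
        qed
        also have "\<dots> \<le> \<delta> * (\<integral>w. h w \<partial>P)"
          using tail[OF k1 h hB] mult_right_mono[OF b(2)[OF k] h0] by linarith
        finally show ?thesis by simp
      qed
      show "(\<integral>w. (V k w)\<^sup>2 \<partial>P) \<le> 3 * (C + c\<^sup>2 + \<delta>\<^sup>2) * real k powr (2 - p)" if k: "b \<le> k" for k
      proof -
        have k1: "k \<ge> 1" and dk: "d \<le> k" using k b(1) d by auto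
        have [measurable]: "D k \<in> borel_measurable borel"
          using pastD(1)[OF D(1)[OF dk]] by auto
        have Ub: "\<bar>U k w\<bar> \<le> real k + c" for w
          using cutoff_simps(1)[of "real k" "w k"] D(2)[of k w] unfolding U_def by simp
        have im: "integrable P (\<lambda>w. (min \<bar>w k\<bar> (real k))\<^sup>2)"
          by (rule integrable_min_square[OF Pp]) simp
        have pw: "(V k w)\<^sup>2 \<le> 3 * ((min \<bar>w k\<bar> (real k))\<^sup>2 + (c\<^sup>2 + \<delta>\<^sup>2))" for w
        proof -
          have sq3: "(x + y + z)\<^sup>2 \<le> 3 * (x\<^sup>2 + (y\<^sup>2 + z\<^sup>2))" for x y z :: real
            using sum_squares_bound[of x y] sum_squares_bound[of x z] sum_squares_bound[of y z]
            by (simp add: power2_eq_square algebra_simps)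
          have "(V k w)\<^sup>2 \<le> 3 * ((\<epsilon> * cutoff (real k) (w k))\<^sup>2 + ((- \<epsilon> * D k w)\<^sup>2 + (- \<delta>)\<^sup>2))"
            using sq3[of "\<epsilon> * cutoff (real k) (w k)" "- \<epsilon> * D k w" "- \<delta>"] by (simp add: V_def U_def algebra_simps)
          moreover have "(\<epsilon> * cutoff (real k) (w k))\<^sup>2 = (min \<bar>w k\<bar> (real k))\<^sup>2"
          proof -
            have "(\<epsilon> * cutoff (real k) (w k))\<^sup>2 = \<bar>\<epsilon> * cutoff (real k) (w k)\<bar>\<^sup>2" by simp
            also have "\<bar>\<epsilon> * cutoff (real k) (w k)\<bar> = min \<bar>w k\<bar> (real k)"
              using \<epsilon> cutoff_simps(6)[of "real k" "w k"] by (simp add: abs_mult)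
            finally show ?thesis .
          qed
          moreover have "(- \<epsilon> * D k w)\<^sup>2 \<le> c\<^sup>2"
          proof -
            have "\<bar>- \<epsilon> * D k w\<bar> \<le> \<bar>c\<bar>" using \<epsilon> D(2)[of k w] by (simp add: abs_mult)
            then show ?thesis by (rule abs_le_square_iff[THEN iffD1])
          qed
          ultimately show ?thesis by simp
        qed
        have "(\<integral>w. (V k w)\<^sup>2 \<partial>P) \<le> (\<integral>w. 3 * ((min \<bar>w k\<bar> (real k))\<^sup>2 + (c\<^sup>2 + \<delta>\<^sup>2)) \<partial>P)"
        proof (rule integral_mono[OF _ _ pw])
          show "integrable P (\<lambda>w. 3 * ((min \<bar>w k\<bar> (real k))\<^sup>2 + (c\<^sup>2 + \<delta>\<^sup>2)))" using im by simp
          have m: "(\<lambda>w. (V k w)\<^sup>2) \<in> borel_measurable P"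
            unfolding prob_measures_measurable[OF Pp] V_def U_def cutoff_def by measurable
          show "integrable P (\<lambda>w. (V k w)\<^sup>2)"
            by (rule Bochner_Integration.integrable_bound[OF _ m, of "\<lambda>w. 3 * ((min \<bar>w k\<bar> (real k))\<^sup>2 + (c\<^sup>2 + \<delta>\<^sup>2))"])
              (use im in \<open>auto intro!: AE_I2 order_trans[OF pw] simp del: distrib_left_numeral\<close>)
        qed
        also have "\<dots> = 3 * ((\<integral>w. (min \<bar>w k\<bar> (real k))\<^sup>2 \<partial>P) + (c\<^sup>2 + \<delta>\<^sup>2))"
          using im by (simp add: prob_space)
        also have "\<dots> \<le> 3 * (C * real k powr (2 - p) + (c\<^sup>2 + \<delta>\<^sup>2) * real k powr (2 - p))"
        proof -
          have "1 \<le> real k powr (2 - p)" using k1 p by (intro ge_one_powr_ge_zero) auto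
          then have "(c\<^sup>2 + \<delta>\<^sup>2) * 1 \<le> (c\<^sup>2 + \<delta>\<^sup>2) * real k powr (2 - p)" by (intro mult_left_mono) auto
          then show ?thesis using square[OF k1] by simp
        qed
        finally show ?thesis by (simp add: algebra_simps)
      qed
    qed (use p C(1) \<delta> in auto)
    then have "AE w in P. \<forall>\<^sub>F n in sequentially. (\<Sum>k\<in>{b..<n}. \<epsilon> * U k w) \<le> 2 * \<delta> * real n"
    proof eventually_elim
      case (elim w)
      then show ?case
      proof eventually_elim
        case (elim n)
        have "(\<Sum>k\<in>{b..<n}. V k w) = (\<Sum>k\<in>{b..<n}. \<epsilon> * U k w) - real (n - b) * \<delta>"
          unfolding V_def by (simp add: sum.distrib sum_subtractf)
        moreover have "real (n - b) * \<delta> \<le> real n * \<delta>" using \<delta> by (intro mult_right_mono) auto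
        ultimately show ?case using elim by (simp add: algebra_simps)
      qed
    qed
    then show ?thesis by blast
  qed
  have two_sided: "\<exists>b. AE w in P. \<forall>\<^sub>F n in sequentially. \<bar>\<Sum>k\<in>{b..<n}. U k w\<bar> \<le> 2 * \<delta> * real n" if \<delta>: "\<delta> > 0" for \<delta>
  proof -
    have "(\<lambda>k. C' * real k powr (1 - \<gamma>)) \<longlonglongrightarrow> C' * 0" by (intro tendsto_intros tail_rate)
    then have "\<forall>\<^sub>F k in sequentially. C' * real k powr (1 - \<gamma>) < \<delta>" using \<delta> by (intro order_tendstoD) auto
    then obtain M where M: "\<And>k. k \<ge> M \<Longrightarrow> C' * real k powr (1 - \<gamma>) < \<delta>" by (auto simp: eventually_sequentially)
    define b where "b = max d M"
    have b: "b \<ge> d" "\<And>k. k \<ge> b \<Longrightarrow> C' * real k powr (1 - \<gamma>) \<le> \<delta>" using M less_imp_le by (auto simp: b_def)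
    have "AE w in P. \<forall>\<^sub>F n in sequentially. (\<Sum>k\<in>{b..<n}. 1 * U k w) \<le> 2 * \<delta> * real n"
      using one_side[of 1, OF _ \<delta> b] by simp
    moreover have "AE w in P. \<forall>\<^sub>F n in sequentially. (\<Sum>k\<in>{b..<n}. - 1 * U k w) \<le> 2 * \<delta> * real n"
      using one_side[of "- 1", OF _ \<delta> b] by simp
    ultimately have "AE w in P. \<forall>\<^sub>F n in sequentially. \<bar>\<Sum>k\<in>{b..<n}. U k w\<bar> \<le> 2 * \<delta> * real n"
    proof eventually_elim
      case (elim w)
      then show ?case by eventually_elim (simp add: sum_negf)
    qed
    then show ?thesis by blast
  qed
  have "\<exists>b. AE w in P. \<forall>\<^sub>F n in sequentially. \<bar>\<Sum>k\<in>{b..<n}. U k w\<bar> \<le> 2 * (1 / real (Suc m)) * real n" for m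
    by (rule two_sided) simp
  then have "\<forall>m. \<exists>b. AE w in P. \<forall>\<^sub>F n in sequentially. \<bar>\<Sum>k\<in>{b..<n}. U k w\<bar> \<le> 2 * (1 / real (Suc m)) * real n"
    by blast
  from choice[OF this] obtain b where b: "\<And>m. AE w in P. \<forall>\<^sub>F n in sequentially. \<bar>\<Sum>k\<in>{b m..<n}. U k w\<bar> \<le> 2 * (1 / real (Suc m)) * real n"
    by blast
  have AE1: "AE w in P. \<forall>m. \<forall>\<^sub>F n in sequentially. \<bar>\<Sum>k\<in>{b m..<n}. U k w\<bar> \<le> 2 * (1 / real (Suc m)) * real n"
    by (subst AE_all_countable) (use b in blast)
  have AE2: "AE w in P. \<forall>\<^sub>F k in sequentially. w \<in> space P - {w. real k \<le> \<bar>w k\<bar>}"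
  proof (rule borel_cantelli_AE1)
    have bm: "{w::seqspace. real k \<le> \<bar>w k\<bar>} \<in> sets borel" for k
    proof -
      have "{w \<in> space borel. real k \<le> \<bar>(w::seqspace) k\<bar>} \<in> sets borel" by measurable
      then show ?thesis by simp
    qed
    then show m: "{w. real k \<le> \<bar>w k\<bar>} \<in> sets P" for k by (simp add: prob_measuresD(2)[OF Pp])
    show "summable (\<lambda>k. measure P {w. real k \<le> \<bar>w k\<bar>})"
    proof (rule summable_comparison_test_ev)
      show "\<forall>\<^sub>F k in sequentially. norm (measure P {w. real k \<le> \<bar>w k\<bar>}) \<le> C * real k powr (- p)"
        using eventually_ge_at_top[of 1]
      proof eventually_elim
        case (elim k)
        have im: "integrable P (\<lambda>w. (min \<bar>w k\<bar> (real k))\<^sup>2)"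
          by (rule integrable_min_square[OF Pp]) simp
        have "(real k)\<^sup>2 * measure P {w. real k \<le> \<bar>w k\<bar>} = (\<integral>w. (real k)\<^sup>2 * indicat_real {w. real k \<le> \<bar>w k\<bar>} w \<partial>P)"
          using m[of k] by simp
        also have "\<dots> \<le> (\<integral>w. (min \<bar>w k\<bar> (real k))\<^sup>2 \<partial>P)"
        proof (rule integral_mono[OF _ im])
          show "integrable P (\<lambda>w. (real k)\<^sup>2 * indicat_real {w. real k \<le> \<bar>w k\<bar>} w)"
            using m[of k] by (intro integrable_mult_right integrable_real_indicator) (auto simp: less_top[symmetric])
        qed (auto simp: indicator_def)
        also have "\<dots> \<le> C * real k powr (2 - p)" using square elim by simp
        also have "real k powr (2 - p) = (real k)\<^sup>2 * real k powr (- p)"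
          using elim by (simp add: powr_numeral[symmetric] powr_add[symmetric] del: powr_numeral)
        finally have "(real k)\<^sup>2 * measure P {w. real k \<le> \<bar>w k\<bar>} \<le> (real k)\<^sup>2 * (C * real k powr (- p))"
          by (simp add: mult_ac)
        then have "measure P {w. real k \<le> \<bar>w k\<bar>} \<le> C * real k powr (- p)"
          using elim by (subst (asm) mult_le_cancel_left_pos) auto
        then show ?case by simp
      qed
      show "summable (\<lambda>k. C * real k powr (- p))"
        using p by (intro summable_mult) (simp add: summable_real_powr_iff)
    qed
  qed (simp add: less_top[symmetric])
  from AE1 AE2 show ?thesis
  proof eventually_elim
    case (elim w)
    show ?case
    proof (rule average_tendsto_zero[where u = "\<lambda>k. U k w"])
      show "\<forall>\<^sub>F k in sequentially. w k - D k w = U k w"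
        using elim(2) by eventually_elim (auto simp: U_def cutoff_def)
      fix \<delta> :: real assume \<delta>: "\<delta> > 0"
      obtain m where m: "2 / \<delta> < real m" using reals_Archimedean2 by blast
      have "2 * (1 / real (Suc m)) \<le> \<delta>"
      proof -
        have "2 < real m * \<delta>" using m \<delta> by (simp add: field_simps)
        then have "2 \<le> real (Suc m) * \<delta>" using \<delta> by (simp add: algebra_simps)
        then show ?thesis by (simp add: field_simps)
      qed
      then have le: "2 * (1 / real (Suc m)) * real n \<le> \<delta> * real n" for n by (intro mult_right_mono) auto
      from elim(1) have "\<forall>\<^sub>F n in sequentially. \<bar>\<Sum>k\<in>{b m..<n}. U k w\<bar> \<le> \<delta> * real n"
        by (auto elim!: eventually_mono dest!: spec[of _ m] intro: order_trans[OF _ le])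
      then show "\<exists>a. \<forall>\<^sub>F n in sequentially. \<bar>\<Sum>k\<in>{a..<n}. U k w\<bar> \<le> \<delta> * real n" by blast
    qed
  qed
qed

end

section \<open>The law of large numbers with a prescribed random limit\<close>

text \<open>Sets of the \<open>\<sigma>\<close>-algebra cannot separate two sequences that agree in the first \<open>d\<close> coordinates.\<close>

lemma past_coord_algebra:
  assumes "Z \<in> borel_measurable (coord_algebra d)"
  shows "Z \<in> past d"
proof -
  define A where "A = {xi k -` B | k B. k < d \<and> B \<in> sets (borel :: real measure)}"
  have sets_eq: "sets (coord_algebra d) = sigma_sets UNIV A" and sp: "space (coord_algebra d) = UNIV"
    unfolding coord_algebra_def A_def by (rule sets_measure_of, simp, simp add: space_measure_of_conv)
  have "A \<subseteq> sets borel"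
  proof
    fix S assume "S \<in> A"
    then obtain k B where S: "S = xi k -` B" "B \<in> sets borel" unfolding A_def by blast
    have "xi k \<in> borel_measurable borel" unfolding xi_def by measurable
    from measurable_sets[OF this S(2)] show "S \<in> sets borel" using S(1) by simp
  qed
  then have sub: "sets (coord_algebra d) \<subseteq> sets borel"
    unfolding sets_eq by (intro sets.sigma_sets_subset'[of A borel UNIV]) auto
  have Zm: "Z \<in> borel_measurable borel"
  proof (rule measurableI)
    fix B :: "real set" assume "B \<in> sets borel"
    from measurable_sets[OF assms this] show "Z -` B \<inter> space borel \<in> sets borel" using sub sp by auto
  qed simp
  have inv: "w \<in> S \<longleftrightarrow> w' \<in> S" if "S \<in> sigma_sets UNIV A" and eq: "\<And>j. j < d \<Longrightarrow> w j = w' j" for S w w'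
    using that(1)
  proof induction
    case (Basic a)
    then show ?case using eq by (auto simp: A_def xi_def)
  qed auto
  show ?thesis
  proof (rule pastI[OF Zm])
    fix x y :: seqspace assume eq: "\<And>j. j < d \<Longrightarrow> x j = y j"
    have "Z -` {Z x} \<in> sigma_sets UNIV A"
      using measurable_sets[OF assms, of "{Z x}"] unfolding sets_eq sp by simp
    then have "x \<in> Z -` {Z x} \<longleftrightarrow> y \<in> Z -` {Z x}" by (rule inv) (rule eq)
    then show "Z x = Z y" by simp
  qed
qed

lemma floor_average_tendsto:
  fixes t :: real
  shows "(\<lambda>n. real_of_int \<lfloor>real n * t\<rfloor> / real n) \<longlonglongrightarrow> t"
proof (rule LIM_zero_cancel, rule Lim_null_comparison)
  show "\<forall>\<^sub>F n in sequentially. norm (real_of_int \<lfloor>real n * t\<rfloor> / real n - t) \<le> 1 / real n"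
    using eventually_gt_at_top[of 0]
  proof eventually_elim
    case (elim n)
    have "\<bar>real_of_int \<lfloor>real n * t\<rfloor> - real n * t\<bar> \<le> 1" by linarith
    moreover have "real_of_int \<lfloor>real n * t\<rfloor> / real n - t = (real_of_int \<lfloor>real n * t\<rfloor> - real n * t) / real n"
      using elim by (simp add: field_simps)
    ultimately show ?case using elim by (simp add: divide_right_mono)
  qed
  show "(\<lambda>n. 1 / real n) \<longlonglongrightarrow> 0" by (rule lim_1_over_n)
qed

theorem corollary4p2:
  fixes E :: "(seqspace \<Rightarrow> real) \<Rightarrow> real"
    and \<gamma> :: real
    and \<Theta>\<^sub>0 :: "seqspace measure set"
    and d :: nat
    and \<pi> :: "(nat \<Rightarrow> real) \<Rightarrow> real"
    and Z :: "seqspace \<Rightarrow> real"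
  assumes "sublinear_expectation E"
    and "regular_expectation E"
    and "\<gamma> > 1"
    and "\<forall>k. xi k \<in> Lp_space \<gamma> E"
    and "iid E xi"
    and "compactin weak_topology \<Theta>\<^sub>0"
    and "\<forall>X\<in>Cb. E X = (SUP P\<in>\<Theta>\<^sub>0. integral\<^sup>L P X)"
    and "d \<ge> 1"
    and "\<pi> \<in> borel_measurable (borel_Rn d)"
    and "Z = (\<lambda>\<omega>. \<pi> (rvec xi 0 d \<omega>))"
    and "Z \<in> borel_measurable (coord_algebra d)"
    and "\<forall>\<omega>. Z \<omega> \<in> {lower_mean E..upper_mean E}"
  shows "\<exists>P\<in>\<Theta>\<^sub>0. AE \<omega> in P. (\<lambda>n. sample_mean n \<omega>) \<longlonglongrightarrow> Z \<omega>"
proof -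
  \<comment> \<open>Over the empty set all constants would have the same upper expectation.\<close>
  have "\<Theta>\<^sub>0 \<noteq> {}"
  proof
    assume empty: "\<Theta>\<^sub>0 = {}"
    obtain \<Theta> where \<Theta>: "\<Theta> \<noteq> {}" "\<Theta> \<subseteq> prob_measures" "\<And>X. X \<in> Cb \<Longrightarrow> E X = (SUP P\<in>\<Theta>. integral\<^sup>L P X)"
      using assms(1) unfolding sublinear_expectation_def by blast
    have Cb: "(\<lambda>_. c) \<in> Cb" for c by (rule cyl_Lip_Cb[OF cyl_Lip_const])
    have "E (\<lambda>_. c) = c" for c
    proof -
      have "(\<integral>\<omega>. c \<partial>P) = c" if "P \<in> \<Theta>" for P
      proof -
        interpret prob_space P using that \<Theta>(2) prob_measuresD by blast
        show ?thesis by (simp add: prob_space)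
      qed
      then have "(SUP P\<in>\<Theta>. \<integral>\<omega>. c \<partial>P) = (SUP P\<in>\<Theta>. c)" by (intro SUP_cong) auto
      then show ?thesis using \<Theta>(1,3) Cb by simp
    qed
    moreover have "E (\<lambda>_. 0) = E (\<lambda>_. 1)"
      using assms(7) Cb empty by simp
    ultimately show False by (metis zero_neq_one)
  qed
  then interpret iid_moment_expectation E \<Theta>\<^sub>0 \<gamma>
    using assms by unfold_locales auto
  let ?l = "lower_mean E" and ?u = "upper_mean E"
  have lu: "?l \<le> ?u" using assms(12) by (auto dest: spec[of _ undefined])
  \<comment> \<open>If both means coincide, this is \<open>0\<close> and the representation of \<open>Z\<close> below still holds.\<close>
  define \<theta> where "\<theta> \<omega> = (Z \<omega> - ?l) / (?u - ?l)" for \<omega>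
  have \<theta>: "0 \<le> \<theta> \<omega>" "\<theta> \<omega> \<le> 1" "Z \<omega> = ?l + (?u - ?l) * \<theta> \<omega>" for \<omega>
  proof -
    have Z: "?l \<le> Z \<omega>" "Z \<omega> \<le> ?u" using assms(12) by auto
    show "0 \<le> \<theta> \<omega>" "\<theta> \<omega> \<le> 1" "Z \<omega> = ?l + (?u - ?l) * \<theta> \<omega>"
      using Z by (cases "?l = ?u"; auto simp: \<theta>_def divide_le_eq_1)+
  qed
  \<comment> \<open>A sequence of zeros and ones in which the ones have frequency \<open>\<theta> \<omega>\<close>.\<close>
  define a where "a k \<omega> = \<lfloor>real (Suc k) * \<theta> \<omega>\<rfloor> - \<lfloor>real k * \<theta> \<omega>\<rfloor>" for k \<omega>
  have a01: "a k \<omega> = 0 \<or> a k \<omega> = 1" for k \<omega>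
  proof -
    have "real (Suc k) * \<theta> \<omega> = real k * \<theta> \<omega> + \<theta> \<omega>" by (simp add: algebra_simps)
    then have le: "real k * \<theta> \<omega> \<le> real (Suc k) * \<theta> \<omega>" "real (Suc k) * \<theta> \<omega> \<le> real k * \<theta> \<omega> + 1"
      using \<theta>(1,2)[of \<omega>] by linarith+
    have "\<lfloor>real k * \<theta> \<omega>\<rfloor> \<le> \<lfloor>real (Suc k) * \<theta> \<omega>\<rfloor>" "\<lfloor>real (Suc k) * \<theta> \<omega>\<rfloor> \<le> \<lfloor>real k * \<theta> \<omega>\<rfloor> + 1"
      using floor_mono[OF le(1)] floor_mono[OF le(2)] by simp_all
    then show ?thesis unfolding a_def by linarith
  qed
  have sum_a: "(\<Sum>k<n. a k \<omega>) = \<lfloor>real n * \<theta> \<omega>\<rfloor>" for n \<omega>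
    unfolding a_def by (subst sum_lessThan_telescope) simp
  define s where "s k \<omega> = (if a k \<omega> = 1 then 1 else - 1 :: real)" for k \<omega>
  have s1: "s k \<omega> = 1 \<or> s k \<omega> = - 1" for k \<omega> by (simp add: s_def)
  have Zp: "Z \<in> past d" by (rule past_coord_algebra[OF assms(11)])
  have sp: "s k \<in> past d" for k
  proof -
    have "(\<lambda>z. if \<lfloor>real (Suc k) * ((z - ?l) / (?u - ?l))\<rfloor> - \<lfloor>real k * ((z - ?l) / (?u - ?l))\<rfloor> = 1 then 1 else - 1 :: real)
        \<in> borel_measurable borel" by measurable
    from past_compose[OF Zp this] show ?thesis by (simp add: s_def[abs_def] a_def \<theta>_def)
  qed
  obtain P where P: "P \<in> \<Theta>\<^sub>0" and mean: "\<And>k h B. d \<le> k \<Longrightarrow> h \<in> past k \<Longrightarrow> (\<And>\<omega>. h \<omega> \<in> {0..B}) \<Longrightarrow>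
      (\<integral>\<omega>. h \<omega> * \<omega> k \<partial>P) = (\<integral>\<omega>. h \<omega> * (if s k \<omega> = 1 then ?u else ?l) \<partial>P)"
    using prescribed_conditional_mean[where s = s, OF assms(8) sp s1] by blast
  define D where "D k \<omega> = (if s k \<omega> = 1 then ?u else ?l)" for k \<omega>
  have D_eq: "D k \<omega> = ?l + (?u - ?l) * real_of_int (a k \<omega>)" for k \<omega>
    using a01[of k \<omega>] by (auto simp: D_def s_def)
  have "AE \<omega> in P. (\<lambda>n. (\<Sum>k\<in>{d..<n}. \<omega> k - D k \<omega>) / real n) \<longlonglongrightarrow> 0"
  proof (rule strong_law[OF \<Theta>\<^sub>0_subset[OF P] assms(8)])
    show "D k \<in> past k" if "d \<le> k" for k
    proof (rule past_mono[OF that])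
      have "(\<lambda>x::real. if x = 1 then ?u else ?l) \<in> borel_measurable borel" by measurable
      from past_compose[OF sp this] show "D k \<in> past d" by (simp add: D_def[abs_def])
    qed
    show "\<bar>D k \<omega>\<bar> \<le> \<bar>?u\<bar> + \<bar>?l\<bar>" for k \<omega> by (simp add: D_def)
    show "(\<integral>\<omega>. h \<omega> * \<omega> k \<partial>P) = (\<integral>\<omega>. h \<omega> * D k \<omega> \<partial>P)"
      if "d \<le> k" "h \<in> past k" "\<And>\<omega>. h \<omega> \<in> {0..B}" for k h B
      unfolding D_def by (rule mean[OF that])
  qed
  then have "AE \<omega> in P. (\<lambda>n. sample_mean n \<omega>) \<longlonglongrightarrow> Z \<omega>"
  proof eventually_elim
    case (elim \<omega>)
    define c where "c = (\<Sum>k<d. \<omega> k - D k \<omega>)"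
    have D_avg: "(\<lambda>n. ?l + (?u - ?l) * (real_of_int \<lfloor>real n * \<theta> \<omega>\<rfloor> / real n)) \<longlonglongrightarrow> Z \<omega>"
      unfolding \<theta>(3)[of \<omega>] by (intro tendsto_intros floor_average_tendsto)
    have "(\<lambda>n. c * (1 / real n)) \<longlonglongrightarrow> c * 0" by (intro tendsto_intros lim_1_over_n)
    then have "(\<lambda>n. c * (1 / real n)) \<longlonglongrightarrow> 0" by simp
    from tendsto_add[OF tendsto_add[OF this elim] D_avg]
    have "(\<lambda>n. c * (1 / real n) + (\<Sum>k\<in>{d..<n}. \<omega> k - D k \<omega>) / real n +
        (?l + (?u - ?l) * (real_of_int \<lfloor>real n * \<theta> \<omega>\<rfloor> / real n))) \<longlonglongrightarrow> Z \<omega>" by simp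
    moreover have "\<forall>\<^sub>F n in sequentially. c * (1 / real n) + (\<Sum>k\<in>{d..<n}. \<omega> k - D k \<omega>) / real n +
        (?l + (?u - ?l) * (real_of_int \<lfloor>real n * \<theta> \<omega>\<rfloor> / real n)) = sample_mean n \<omega>"
      using eventually_ge_at_top[of "Suc d"]
    proof eventually_elim
      case (elim n)
      then have n: "real n > 0" "d \<le> n" by auto
      have 1: "(\<Sum>k<n. \<omega> k - D k \<omega>) = c + (\<Sum>k\<in>{d..<n}. \<omega> k - D k \<omega>)"
        unfolding c_def lessThan_atLeast0 using n by (intro sum.atLeastLessThan_concat[symmetric]) auto
      have 2: "(\<Sum>k<n. D k \<omega>) = real n * ?l + (?u - ?l) * real_of_int \<lfloor>real n * \<theta> \<omega>\<rfloor>"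
        unfolding D_eq sum_a[symmetric] by (simp add: sum.distrib sum_distrib_left)
      have "(\<Sum>k<n. \<omega> k) = c + (\<Sum>k\<in>{d..<n}. \<omega> k - D k \<omega>) + (real n * ?l + (?u - ?l) * real_of_int \<lfloor>real n * \<theta> \<omega>\<rfloor>)"
        using 1 unfolding sum_subtractf[of _ _ "{..<n}"] 2 by simp
      then show ?case
        unfolding sample_mean_def xi_def using n by (simp add: add_divide_distrib)
    qed
    ultimately show ?case by (rule Lim_transform_eventually)
  qed
  then show ?thesis using P by blast
qed

end
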